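(* Every non-perfect profinite $F$-group $\Delta$ admits a torsion-free open characteristic subgroup whose quotient has derived length at most $3$. When $\Delta$ is affine, or is proper and satisfies the abelian-period condition, the quotient can furthermore be supposed abelian.
   Context: A profinite group $\Delta$ is a profinite $F$-group if it admits a topological presentation $$\Bigl\langle \alpha_1,\beta_1,\dots,\alpha_g,\beta_g,\gamma_1,\dots,\gamma_r,\delta_1,\dots,\delta_k\ \Bigm|\ \prod_{i=1}^g[\alpha_i,\beta_i]\prod_{j=1}^r\gamma_j\prod_{\ell=1}^k\delta_\ell=1,\ \delta_1^{n_1}=\cdots=\delta_k^{n_k}=1\Bigr\rangle$$ with integers $g,r,k\ge0$ and $n_i\ge2$; the tuple $(g,r;\{n_1,\dots,n_k\})$ is its signature ($g$ genus, $r$ number of cusps, $n_i$ periods). $\Delta$ is affine if $r\ge1$ and proper if $r=0$. Abelian-period condition: if $k\ge2$, $\Delta$ satisfies it when for all $i\in\{1,\dots,k\}$, $n_i$ divides $\operatorname{lcm}(n_j\mid j\ne i)$. By convention it is satisfied if $k=0$ and not satisfied if $k=1$. For a profinite group $G$, $G^{(0)}=G$ and $G^{(m)}$ is the closure of $[G^{(m-1)},G^{(m-1)}]$; the derived length is the minimal $m$ with $G^{(m)}=1$; $G$ is perfect if $G=G^{(1)}$. *)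

theory Defs
  imports "HOL-Analysis.Analysis" "HOL-Algebra.Generated_Groups" "HOL-Library.Extended_Nat"
begin

section \<open>Topological and profinite groups\<close>

locale topological_group = group G for G (structure) +
  fixes T :: "'a topology"
  assumes topspace_eq: "topspace T = carrier G"
    and continuous_mult: "continuous_map (prod_topology T T) T (\<lambda>(x, y). x \<otimes> y)"
    and continuous_inv: "continuous_map T T (\<lambda>x. inv x)"

locale profinite_group = topological_group +
  assumes compact: "compact_space T"
    and Hausdorff: "Hausdorff_space T"
    and totally_disconnected: "connectedin T S \<Longrightarrow> \<exists>a. S \<subseteq> {a}"

definition top_iso ::
  "('a, 'c) monoid_scheme \<Rightarrow> 'a topology \<Rightarrow> ('b, 'd) monoid_scheme \<Rightarrow> 'b topology \<Rightarrow> ('a \<Rightarrow> 'b) set"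
  where "top_iso G T H S = {\<phi>. \<phi> \<in> iso G H \<and> homeomorphic_map T S \<phi>}"

text \<open>The points of \<open>G Mod N\<close> are cosets, so the preimage of a set of points under the
  projection is its union.\<close>

definition quotient_topology :: "('a, 'b) monoid_scheme \<Rightarrow> 'a topology \<Rightarrow> 'a set \<Rightarrow> 'a set topology"
  where "quotient_topology G T N = topology (\<lambda>U. U \<subseteq> carrier (G Mod N) \<and> openin T (\<Union>U))"

lemma (in topological_group) openin_quotient_topology:
  assumes "N \<lhd> G"
  shows "openin (quotient_topology G T N) U \<longleftrightarrow> U \<subseteq> carrier (G Mod N) \<and> openin T (\<Union>U)"
proof -
  interpret N: normal N G by fact
  have inter: "\<Union>(U \<inter> V) = \<Union>U \<inter> \<Union>V"
    if "U \<subseteq> carrier (G Mod N)" "V \<subseteq> carrier (G Mod N)" for U V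
  proof
    show "\<Union>U \<inter> \<Union>V \<subseteq> \<Union>(U \<inter> V)"
    proof
      fix x assume "x \<in> \<Union>U \<inter> \<Union>V"
      then obtain A B where AB: "A \<in> U" "B \<in> V" "x \<in> A" "x \<in> B" by blast
      then have "A \<in> rcosets N" "B \<in> rcosets N"
        using that by (auto simp: FactGroup_def)
      with AB have "A = B"
        using rcos_disjoint[OF N.is_subgroup] by (auto simp: pairwise_def disjnt_iff)
      with AB show "x \<in> \<Union>(U \<inter> V)" by blast
    qed
  qed blast
  have "istopology (\<lambda>U. U \<subseteq> carrier (G Mod N) \<and> openin T (\<Union>U))"
    unfolding istopology_def
  proof (intro conjI allI impI)
    fix K assume "\<forall>U\<in>K. U \<subseteq> carrier (G Mod N) \<and> openin T (\<Union>U)"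
    then have "openin T (\<Union>(Union ` K))"
      by (intro openin_Union) auto
    moreover have "\<Union>(Union ` K) = \<Union>(\<Union>K)"
      by blast
    ultimately show "openin T (\<Union>(\<Union>K))"
      by simp
  qed (auto simp: inter)
  then show ?thesis
    by (simp add: quotient_topology_def)
qed

definition characteristic_subgroup :: "'a set \<Rightarrow> ('a, 'b) monoid_scheme \<Rightarrow> 'a topology \<Rightarrow> bool"
  where "characteristic_subgroup N G T \<longleftrightarrow>
    subgroup N G \<and> (\<forall>\<phi> \<in> top_iso G T G T. \<phi> ` N = N)"

definition torsion_free :: "('a, 'b) monoid_scheme \<Rightarrow> 'a set \<Rightarrow> bool"
  where "torsion_free G N \<longleftrightarrow>
    (\<forall>x\<in>N. \<forall>n::nat. n > 0 \<and> x [^]\<^bsub>G\<^esub> n = \<one>\<^bsub>G\<^esub> \<longrightarrow> x = \<one>\<^bsub>G\<^esub>)"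

primrec closed_derived :: "('a, 'b) monoid_scheme \<Rightarrow> 'a topology \<Rightarrow> nat \<Rightarrow> 'a set"
  where
    "closed_derived G T 0 = carrier G"
  | "closed_derived G T (Suc m) = T closure_of (derived G (closed_derived G T m))"

text \<open>The value is \<open>\<infinity>\<close> if the closed derived series never reaches the trivial subgroup.\<close>

definition derived_length :: "('a, 'b) monoid_scheme \<Rightarrow> 'a topology \<Rightarrow> enat"
  where "derived_length G T = Inf (enat ` {m. closed_derived G T m = {\<one>\<^bsub>G\<^esub>}})"

definition perfect :: "('a, 'b) monoid_scheme \<Rightarrow> 'a topology \<Rightarrow> bool"
  where "perfect G T \<longleftrightarrow> carrier G = closed_derived G T 1"

definition closed_normal_closure :: "('a, 'b) monoid_scheme \<Rightarrow> 'a topology \<Rightarrow> 'a set \<Rightarrow> 'a set"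
  where "closed_normal_closure G T R = \<Inter>{N. N \<lhd> G \<and> closedin T N \<and> R \<subseteq> N}"


section \<open>Free groups\<close>

text \<open>The letter \<open>(x, True)\<close> stands for the generator \<open>x\<close> and \<open>(x, False)\<close> for its inverse.\<close>

type_synonym 'x word = "('x \<times> bool) list"

definition inv_letter :: "'x \<times> bool \<Rightarrow> 'x \<times> bool"
  where "inv_letter a = (fst a, \<not> snd a)"

definition reduced_word :: "'x word \<Rightarrow> bool"
  where "reduced_word w \<longleftrightarrow> (\<forall>i. Suc i < length w \<longrightarrow> w ! Suc i \<noteq> inv_letter (w ! i))"

definition push :: "'x \<times> bool \<Rightarrow> 'x word \<Rightarrow> 'x word"
  where "push a w = (if w \<noteq> [] \<and> hd w = inv_letter a then tl w else a # w)"

definition free_group :: "'x set \<Rightarrow> 'x word monoid"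
  where "free_group X =
    \<lparr>carrier = {w. reduced_word w \<and> fst ` set w \<subseteq> X}, mult = foldr push, one = []\<rparr>"


section \<open>Profinite completions and free profinite groups\<close>

definition finite_index_normal :: "('a, 'b) monoid_scheme \<Rightarrow> 'a set set"
  where "finite_index_normal G = {N. N \<lhd> G \<and> finite (carrier (G Mod N))}"

text \<open>The inverse limit of the finite quotients \<open>G Mod N\<close>, where for \<open>N \<subseteq> M\<close> the transition map
  sends a coset of \<open>N\<close> to the coset of \<open>M\<close> containing it.\<close>

definition profinite_completion :: "('a, 'b) monoid_scheme \<Rightarrow> ('a set \<Rightarrow> 'a set) monoid"
  where "profinite_completion G =
    \<lparr>carrier = {c \<in> (\<Pi>\<^sub>E N\<in>finite_index_normal G. carrier (G Mod N)).
       \<forall>N\<in>finite_index_normal G. \<forall>M\<in>finite_index_normal G. N \<subseteq> M \<longrightarrow> c N \<subseteq> c M},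
     mult = (\<lambda>c d. \<lambda>N\<in>finite_index_normal G. c N \<otimes>\<^bsub>G Mod N\<^esub> d N),
     one = (\<lambda>N\<in>finite_index_normal G. \<one>\<^bsub>G Mod N\<^esub>)\<rparr>"

definition profinite_completion_topology :: "('a, 'b) monoid_scheme \<Rightarrow> ('a set \<Rightarrow> 'a set) topology"
  where "profinite_completion_topology G =
    subtopology
      (product_topology (\<lambda>N. discrete_topology (carrier (G Mod N))) (finite_index_normal G))
      (carrier (profinite_completion G))"

definition completion_map :: "('a, 'b) monoid_scheme \<Rightarrow> 'a \<Rightarrow> ('a set \<Rightarrow> 'a set)"
  where "completion_map G x = (\<lambda>N\<in>finite_index_normal G. N #>\<^bsub>G\<^esub> x)"

type_synonym 'x profinite_word = "'x word set \<Rightarrow> 'x word set"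

definition free_profinite :: "'x set \<Rightarrow> 'x profinite_word monoid"
  where "free_profinite X = profinite_completion (free_group X)"

definition free_profinite_topology :: "'x set \<Rightarrow> 'x profinite_word topology"
  where "free_profinite_topology X = profinite_completion_topology (free_group X)"

definition free_gen :: "'x set \<Rightarrow> 'x \<Rightarrow> 'x profinite_word"
  where "free_gen X x = completion_map (free_group X) [(x, True)]"


section \<open>Topological presentations\<close>

definition has_profinite_presentation ::
  "('a, 'b) monoid_scheme \<Rightarrow> 'a topology \<Rightarrow> 'x set \<Rightarrow> 'x profinite_word set \<Rightarrow> bool"
  where "has_profinite_presentation G T X R \<longleftrightarrow>
    (let F = free_profinite X; S = free_profinite_topology X; K = closed_normal_closure F S R
     in top_iso (F Mod K) (quotient_topology F S K) G T \<noteq> {})"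


section \<open>Profinite F-groups\<close>

datatype F_gen = Alpha nat | Beta nat | Gamma nat | Delta nat

text \<open>A signature \<open>(g, r; {n\<^sub>1, \<dots>, n\<^sub>k})\<close> is given by \<open>g\<close>, \<open>r\<close> and the list \<open>ns\<close> of periods, with
  \<open>k = length ns\<close>. All indices start at \<open>0\<close>.\<close>

definition F_gens :: "nat \<Rightarrow> nat \<Rightarrow> nat list \<Rightarrow> F_gen set"
  where "F_gens g r ns =
    Alpha ` {..<g} \<union> Beta ` {..<g} \<union> Gamma ` {..<r} \<union> Delta ` {..<length ns}"

definition commutator :: "('a, 'b) monoid_scheme \<Rightarrow> 'a \<Rightarrow> 'a \<Rightarrow> 'a"
  where "commutator G x y = x \<otimes>\<^bsub>G\<^esub> y \<otimes>\<^bsub>G\<^esub> inv\<^bsub>G\<^esub> x \<otimes>\<^bsub>G\<^esub> inv\<^bsub>G\<^esub> y"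

definition list_mult :: "('a, 'b) monoid_scheme \<Rightarrow> 'a list \<Rightarrow> 'a"
  where "list_mult G xs = foldr (mult G) xs \<one>\<^bsub>G\<^esub>"

definition F_relators ::
  "('a, 'b) monoid_scheme \<Rightarrow> (F_gen \<Rightarrow> 'a) \<Rightarrow> nat \<Rightarrow> nat \<Rightarrow> nat list \<Rightarrow> 'a set"
  where "F_relators G x g r ns =
    insert
      (list_mult G
        (map (\<lambda>i. commutator G (x (Alpha i)) (x (Beta i))) [0..<g] @
         map (\<lambda>j. x (Gamma j)) [0..<r] @
         map (\<lambda>l. x (Delta l)) [0..<length ns]))
      {x (Delta l) [^]\<^bsub>G\<^esub> (ns ! l) | l. l < length ns}"

definition profinite_F_group ::
  "('a, 'b) monoid_scheme \<Rightarrow> 'a topology \<Rightarrow> nat \<Rightarrow> nat \<Rightarrow> nat list \<Rightarrow> bool"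
  where "profinite_F_group G T g r ns \<longleftrightarrow>
    profinite_group G T \<and> (\<forall>n\<in>set ns. n \<ge> 2) \<and>
    (let X = F_gens g r ns
     in has_profinite_presentation G T X (F_relators (free_profinite X) (free_gen X) g r ns))"

definition abelian_period_condition :: "nat list \<Rightarrow> bool"
  where "abelian_period_condition ns \<longleftrightarrow>
    ns = [] \<or>
    length ns \<ge> 2 \<and>
      (\<forall>i<length ns. ns ! i dvd Lcm {ns ! j | j. j < length ns \<and> j \<noteq> i})"

definition torsion_free_open_characteristic ::
  "'a set \<Rightarrow> ('a, 'b) monoid_scheme \<Rightarrow> 'a topology \<Rightarrow> bool"
  where "torsion_free_open_characteristic N G T \<longleftrightarrow>
    torsion_free G N \<and> openin T N \<and> characteristic_subgroup N G T"

end

theory Submission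
  imports Defs
begin

text \<open>
  A homomorphism from \<open>\<Delta>\<close> to a finite group is a tuple of elements satisfying the relations. For the
  monomial groups \<open>C \<wr> Sym X\<close> with \<open>C\<close> a finite subgroup of \<open>\<rat>/\<int>\<close> such tuples can be found by deforming:
  if the relations hold modulo \<open>B\<^sup>X\<close> and the permutations are transitive on \<open>X\<close>, multiplying the
  generators by elements of \<open>B\<^sup>X\<close>, where the \<open>\<delta>\<^sub>l\<close> are only conjugated, changes the long relator by
  any function in \<open>B\<^sup>X\<close> with coordinate sum zero (the image of the Fox derivatives contains the
  augmentation submodule).

  This is used twice. First, let \<open>N\<close> be an open normal subgroup such that every \<open>\<delta>\<^sub>l\<close> has order
  \<open>n\<^sub>l\<close> modulo \<open>N\<close>. Then for every open subgroup \<open>H\<close> of \<open>N\<close> all characters of \<open>H\<close> are divisible: a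
  character is a homomorphism of \<open>\<Delta>\<close> to a monomial group on \<open>X = \<Delta>/H\<close>, and since \<open>\<delta>\<^sub>l\<close> acts freely,
  its image is conjugate to a permutation, so that the obstruction to dividing, a coordinate sum, is
  zero. Hence the abelianizations of all open subgroups of \<open>N\<close> are torsion-free, and so is \<open>N\<close>.

  Secondly, it yields finite quotients in which \<open>\<delta>\<^sub>l\<close> keeps its order: abelian ones in the affine
  case and under the abelian-period condition, and in general towers of at most three abelian
  covers. If the genus is zero, non-perfectness gives a prime \<open>p\<close> dividing two periods, and the tower
  starts with a cyclic cover of degree \<open>p\<close> ramified over these two points. The intersection of the images
  of such a kernel under all automorphisms is still open because there are only finitely many of
  them.
\<close>

section \<open>Monomial groups\<close>

text \<open>Without cusps, the coordinate sum of the long relator cannot be changed by deformation: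
  the sum is a homomorphism, so it kills commutators and ignores conjugation. A coefficient that
  gives a \<delta> its order must therefore come with its negative at another cycle of the same
  \<delta>, or with a compensation at another \<delta>. This decides the number of steps. In genus
  zero, a cyclic cover of degree \<open>p\<close> ramified over two periods a and b gives every
  other \<delta> \<open>p\<close> fixed points, and one more abelian cover restores its order. But
  \<delta>_a is a single \<open>p\<close>-cycle there, which leaves no room for an opposite pair. So
  a third period is used to build a cover in which \<delta>_a has several cycles, and only above
  that can the missing factor of its order be restored: length three. If there is no third period,
  the group is finite cyclic. Open subgroups never get presentations of their own. A character of a
  subgroup is treated as a tuple in a monomial group, where only the relations of the whole group
  occur; this is Shapiro's lemma by hand.\<close>

locale additive_subgroup_set =
  fixes C :: "'c::ab_group_add set"
  assumes zero_mem [simp]: "0 \<in> C"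
    and add_mem: "a \<in> C \<Longrightarrow> b \<in> C \<Longrightarrow> a + b \<in> C"
    and uminus_mem: "a \<in> C \<Longrightarrow> - a \<in> C"
begin

lemma diff_mem: "a \<in> C \<Longrightarrow> b \<in> C \<Longrightarrow> a - b \<in> C"
  using add_mem[of a "- b"] uminus_mem[of b] by simp

lemma sum_mem: "(\<And>i. i \<in> I \<Longrightarrow> f i \<in> C) \<Longrightarrow> sum f I \<in> C"
  by (induction I rule: infinite_finite_induct) (auto intro: add_mem)

end

text \<open>Extension by zero outside \<open>X\<close> matches the convention of
  \<open>permutes\<close>, so that equality in the monomial group is plain equality of pairs of
  functions.\<close>

definition supported_funs :: "'x set \<Rightarrow> 'c::zero set \<Rightarrow> ('x \<Rightarrow> 'c) set"
  where "supported_funs X C = {v. (\<forall>x. v x \<in> C) \<and> (\<forall>x. x \<notin> X \<longrightarrow> v x = 0)}"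

text \<open>The pair \<open>(v, \<sigma>)\<close> stands for the bijection \<open>(x, c) \<mapsto> (\<sigma> x, v x + c)\<close> of \<open>X \<times> C\<close>.\<close>

definition monomial_group :: "'x set \<Rightarrow> 'c::ab_group_add set \<Rightarrow> (('x \<Rightarrow> 'c) \<times> ('x \<Rightarrow> 'x)) monoid"
  where "monomial_group X C =
    \<lparr>carrier = {(v, \<sigma>). v \<in> supported_funs X C \<and> \<sigma> permutes X},
     mult = (\<lambda>p q. (\<lambda>x. fst p (snd q x) + fst q x, snd p \<circ> snd q)),
     one = (\<lambda>_. 0, id)\<rparr>"

lemma monomial_group_simps [simp]:
  "p \<in> carrier (monomial_group X C) \<longleftrightarrow> fst p \<in> supported_funs X C \<and> snd p permutes X"
  "mult (monomial_group X C) p q = (\<lambda>x. fst p (snd q x) + fst q x, snd p \<circ> snd q)"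
  "one (monomial_group X C) = (\<lambda>_. 0, id)"
  by (auto simp: monomial_group_def mem_Times_iff)

context additive_subgroup_set
begin

lemma supported_funs_zero [simp]: "(\<lambda>_. 0) \<in> supported_funs X C"
  by (simp add: supported_funs_def)

lemma supported_funs_add:
  "v \<in> supported_funs X C \<Longrightarrow> w \<in> supported_funs X C \<Longrightarrow> (\<lambda>x. v x + w x) \<in> supported_funs X C"
  by (auto simp: supported_funs_def add_mem)

lemma supported_funs_uminus:
  "v \<in> supported_funs X C \<Longrightarrow> (\<lambda>x. - v x) \<in> supported_funs X C"
  by (auto simp: supported_funs_def uminus_mem)

lemma supported_funs_diff:
  "v \<in> supported_funs X C \<Longrightarrow> w \<in> supported_funs X C \<Longrightarrow> (\<lambda>x. v x - w x) \<in> supported_funs X C"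
  by (auto simp: supported_funs_def diff_mem)

lemma supported_funs_comp:
  "v \<in> supported_funs X C \<Longrightarrow> \<sigma> permutes X \<Longrightarrow> (\<lambda>x. v (\<sigma> x)) \<in> supported_funs X C"
  by (auto simp: supported_funs_def permutes_in_image)

lemma monomial_group_inverse:
  assumes "v \<in> supported_funs X C" and \<sigma>: "\<sigma> permutes X"
  shows "(\<lambda>x. - v (inv_into UNIV \<sigma> x), inv_into UNIV \<sigma>) \<in> carrier (monomial_group X C)"
    and "(\<lambda>x. - v (inv_into UNIV \<sigma> x), inv_into UNIV \<sigma>) \<otimes>\<^bsub>monomial_group X C\<^esub> (v, \<sigma>)
      = \<one>\<^bsub>monomial_group X C\<^esub>"
  using supported_funs_uminus[OF supported_funs_comp[OF assms(1) permutes_inv[OF \<sigma>]]]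
    permutes_inv[OF \<sigma>] permutes_inverses[OF \<sigma>]
  by (simp_all add: fun_eq_iff)

lemma group_monomial_group: "group (monomial_group X C)"
proof (rule groupI)
  fix p q assume "p \<in> carrier (monomial_group X C)" "q \<in> carrier (monomial_group X C)"
  then show "p \<otimes>\<^bsub>monomial_group X C\<^esub> q \<in> carrier (monomial_group X C)"
    by (simp add: supported_funs_add supported_funs_comp permutes_compose)
next
  show "\<one>\<^bsub>monomial_group X C\<^esub> \<in> carrier (monomial_group X C)"
    by (simp add: permutes_id)
next
  fix p assume "p \<in> carrier (monomial_group X C)"
  then show "\<exists>q\<in>carrier (monomial_group X C). q \<otimes>\<^bsub>monomial_group X C\<^esub> p = \<one>\<^bsub>monomial_group X C\<^esub>"
    using monomial_group_inverse[of "fst p" X "snd p"] by (metis monomial_group_simps(1) prod.collapse)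
qed (simp_all add: fun_eq_iff add.assoc)

lemma inv_monomial_group:
  assumes "v \<in> supported_funs X C" "\<sigma> permutes X"
  shows "inv\<^bsub>monomial_group X C\<^esub> (v, \<sigma>) = (\<lambda>x. - v (inv_into UNIV \<sigma> x), inv_into UNIV \<sigma>)"
  by (rule group.inv_equality[OF group_monomial_group])
    (use assms monomial_group_inverse[OF assms] in simp_all)

end

lemma finite_carrier_monomial_group:
  fixes C :: "'c::ab_group_add set"
  assumes "finite X" "finite C"
  shows "finite (carrier (monomial_group X C))"
proof -
  have "finite (supported_funs X C)"
    using finite_set_of_finite_funs[OF assms, of 0]
    by (rule rev_finite_subset) (auto simp: supported_funs_def)
  moreover have "finite {\<sigma>. \<sigma> permutes X}"
    using assms(1) by (rule finite_permutations)
  ultimately have "finite (supported_funs X C \<times> {\<sigma>. \<sigma> permutes X})" by (rule finite_cartesian_product)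
  then show ?thesis
    by (rule rev_finite_subset) (simp add: subset_iff mem_Times_iff)
qed

text \<open>The long relator is a product of blocks, where \<open>Alpha i\<close> stands for the block
  \<open>[\<alpha>\<^sub>i, \<beta>\<^sub>i]\<close> and every other generator for itself.\<close>

definition relator_blocks :: "nat \<Rightarrow> nat \<Rightarrow> nat \<Rightarrow> F_gen list"
  where "relator_blocks g r k = map Alpha [0..<g] @ map Gamma [0..<r] @ map Delta [0..<k]"

definition block_value :: "('a, 'b) monoid_scheme \<Rightarrow> (F_gen \<Rightarrow> 'a) \<Rightarrow> F_gen \<Rightarrow> 'a"
  where "block_value G y b = (case b of Alpha i \<Rightarrow> commutator G (y (Alpha i)) (y (Beta i)) | _ \<Rightarrow> y b)"

fun block_gens :: "F_gen \<Rightarrow> F_gen set"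
  where "block_gens (Alpha i) = {Alpha i, Beta i}" | "block_gens b = {b}"

definition blocks_product :: "('a, 'b) monoid_scheme \<Rightarrow> (F_gen \<Rightarrow> 'a) \<Rightarrow> F_gen list \<Rightarrow> 'a"
  where "blocks_product G y bs = list_mult G (map (block_value G y) bs)"

lemma distinct_relator_blocks: "distinct (relator_blocks g r k)"
  by (auto simp: relator_blocks_def distinct_map inj_on_def)

lemma F_relators_blocks:
  "F_relators G y g r ns = insert (blocks_product G y (relator_blocks g r (length ns)))
     {y (Delta l) [^]\<^bsub>G\<^esub> (ns ! l) | l. l < length ns}"
  by (simp add: F_relators_def blocks_product_def relator_blocks_def block_value_def o_def)

lemma block_gens_F_gens: "(\<Union>b\<in>set (relator_blocks g r (length ns)). block_gens b) = F_gens g r ns"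
  by (auto simp: relator_blocks_def F_gens_def)

lemma blocks_product_Nil [simp]: "blocks_product G y [] = \<one>\<^bsub>G\<^esub>"
  and blocks_product_Cons [simp]:
    "blocks_product G y (b # bs) = block_value G y b \<otimes>\<^bsub>G\<^esub> blocks_product G y bs"
  by (simp_all add: blocks_product_def list_mult_def)

context group
begin

lemma block_value_closed:
  "(\<And>i. i \<in> block_gens b \<Longrightarrow> y i \<in> carrier G) \<Longrightarrow> block_value G y b \<in> carrier G"
  by (cases b) (auto simp: block_value_def commutator_def)

lemma blocks_product_closed:
  "(\<And>i b. b \<in> set bs \<Longrightarrow> i \<in> block_gens b \<Longrightarrow> y i \<in> carrier G) \<Longrightarrow> blocks_product G y bs \<in> carrier G"
  by (induction bs) (auto intro: block_value_closed)

lemma blocks_product_append: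
  assumes "\<And>i b. b \<in> set (as @ bs) \<Longrightarrow> i \<in> block_gens b \<Longrightarrow> y i \<in> carrier G"
  shows "blocks_product G y (as @ bs) = blocks_product G y as \<otimes> blocks_product G y bs"
  using assms
proof (induction as)
  case Nil
  then show ?case by (simp add: blocks_product_closed)
next
  case (Cons a as)
  have "block_value G y a \<in> carrier G"
    by (rule block_value_closed) (use Cons.prems in auto)
  moreover have "blocks_product G y as \<in> carrier G" "blocks_product G y bs \<in> carrier G"
    by (rule blocks_product_closed, use Cons.prems in auto)+
  moreover have "blocks_product G y (as @ bs) = blocks_product G y as \<otimes> blocks_product G y bs"
    by (rule Cons.IH) (use Cons.prems in auto)
  ultimately show ?case by (simp add: m_assoc)
qed

end

lemma block_value_cong:
  "(\<And>i. i \<in> block_gens b \<Longrightarrow> y i = z i) \<Longrightarrow> block_value G y b = block_value G z b"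
  by (cases b) (auto simp: block_value_def)

lemma blocks_product_cong:
  assumes "\<And>i b. b \<in> set bs \<Longrightarrow> i \<in> block_gens b \<Longrightarrow> y i = z i"
  shows "blocks_product G y bs = blocks_product G z bs"
  using assms by (induction bs) (auto intro!: arg_cong2[of _ _ _ _ "mult G"] block_value_cong)

text \<open>The default clause of \<open>block_gens\<close> gives \<open>{Beta i}\<close> for
  \<open>Beta i\<close>, which meets \<open>block_gens (Alpha i)\<close>. No block of the relator is
  named by a \<open>Beta\<close>, hence the exclusion.\<close>

lemma block_gens_disjoint: "i \<in> block_gens b \<Longrightarrow> i \<in> block_gens b' \<Longrightarrow> b \<notin> range Beta \<Longrightarrow> b' \<notin> range Beta \<Longrightarrow> b = b'"
  by (cases b; cases b') auto

definition point_fun :: "'x \<Rightarrow> 'c::zero \<Rightarrow> 'x \<Rightarrow> 'c"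
  where "point_fun z c = (\<lambda>x. if x = z then c else 0)"

lemma point_fun_comp:
  assumes "\<sigma> permutes X"
  shows "point_fun z c (\<sigma> x) = point_fun (inv_into UNIV \<sigma> z) c x"
  using permutes_inverses[OF assms] by (auto simp: point_fun_def)

text \<open>Deforming a tuple changes the first components by \<open>B\<close>-valued functions, and the elements
  \<open>\<delta>\<^sub>l\<close> only by conjugation with such functions, so that their orders do not change.\<close>

definition deformation ::
  "'x set \<Rightarrow> 'c::ab_group_add set \<Rightarrow> (F_gen \<Rightarrow> ('x \<Rightarrow> 'c) \<times> ('x \<Rightarrow> 'x)) \<Rightarrow> (F_gen \<Rightarrow> ('x \<Rightarrow> 'c) \<times> ('x \<Rightarrow> 'x)) \<Rightarrow> bool"
  where "deformation X B y y' \<longleftrightarrow>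
    (\<forall>i. snd (y' i) = snd (y i) \<and> (\<lambda>x. fst (y' i) x - fst (y i) x) \<in> supported_funs X B) \<and>
    (\<forall>l. \<exists>b\<in>supported_funs X B. \<forall>x.
      fst (y' (Delta l)) x = fst (y (Delta l)) x + b (snd (y (Delta l)) x) - b x)"

lemma deformationD:
  assumes "deformation X B y y'"
  shows deformation_snd: "snd (y' i) = snd (y i)"
    and deformation_fst: "(\<lambda>x. fst (y' i) x - fst (y i) x) \<in> supported_funs X B"
    and deformation_Delta: "\<exists>b\<in>supported_funs X B. \<forall>x.
      fst (y' (Delta l)) x = fst (y (Delta l)) x + b (snd (y (Delta l)) x) - b x"
  using assms unfolding deformation_def by simp_all

text \<open>\<open>C\<close> contains the coefficients and \<open>B\<close> the admissible errors:
  \<open>B\<close> is smaller than \<open>C\<close> when characters are divided, and equal to it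
  when quotients are constructed. Transitivity speaks of forward-stable sets; on the finite set
  \<open>X\<close> these are stable under inverses too.\<close>

locale monomial_deformation = C: additive_subgroup_set C + B: additive_subgroup_set B
  for C B :: "'c::ab_group_add set" +
  fixes X :: "'x set" and x0 :: 'x and g r k :: nat and \<sigma> :: "F_gen \<Rightarrow> 'x \<Rightarrow> 'x"
  assumes B_subset: "B \<subseteq> C"
    and finite_X: "finite X"
    and x0: "x0 \<in> X"
    and perms: "b \<in> set (relator_blocks g r k) \<Longrightarrow> i \<in> block_gens b \<Longrightarrow> \<sigma> i permutes X"
    and transitive: "S \<subseteq> X \<Longrightarrow> x0 \<in> S \<Longrightarrow>
      (\<And>b i x. b \<in> set (relator_blocks g r k) \<Longrightarrow> i \<in> block_gens b \<Longrightarrow> x \<in> S \<Longrightarrow> \<sigma> i x \<in> S) \<Longrightarrow> S = X"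
begin

abbreviation M where "M \<equiv> monomial_group X C"
abbreviation bs where "bs \<equiv> relator_blocks g r k"

sublocale M: group M by (rule C.group_monomial_group)

definition lifts :: "(F_gen \<Rightarrow> ('x \<Rightarrow> 'c) \<times> ('x \<Rightarrow> 'x)) set"
  where "lifts = {y. \<forall>b\<in>set bs. \<forall>i\<in>block_gens b. y i \<in> carrier M \<and> snd (y i) = \<sigma> i}"

text \<open>Quantifying over all lifts makes the set independent of a starting tuple, so
  deformations can be performed one after the other and the set is closed under addition.\<close>

definition reachable :: "('x \<Rightarrow> 'c) set"
  where "reachable = {a \<in> supported_funs X B. \<forall>y\<in>lifts. \<exists>y'. deformation X B y y' \<and>
    blocks_product M y' bs = blocks_product M y bs \<otimes>\<^bsub>M\<^esub> (a, id)}"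

lemma supported_funs_B_C: "a \<in> supported_funs X B \<Longrightarrow> a \<in> supported_funs X C"
  using B_subset by (auto simp: supported_funs_def)

lemma deformation_refl: "deformation X B y y"
  unfolding deformation_def
proof (intro conjI allI)
  show "\<exists>b\<in>supported_funs X B. \<forall>x.
      fst (y (Delta l)) x = fst (y (Delta l)) x + b (snd (y (Delta l)) x) - b x" for l
    by (rule bexI[where x = "\<lambda>_. 0"]) simp_all
qed simp_all

lemma deformation_trans:
  assumes "deformation X B y y'" "deformation X B y' y''"
  shows "deformation X B y y''"
  unfolding deformation_def
proof (intro conjI allI)
  fix i
  show "snd (y'' i) = snd (y i)"
    by (simp add: deformation_snd[OF assms(1)] deformation_snd[OF assms(2)])
  show "(\<lambda>x. fst (y'' i) x - fst (y i) x) \<in> supported_funs X B"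
    using B.supported_funs_add[OF deformation_fst[OF assms(1), of i] deformation_fst[OF assms(2), of i]]
    by simp
next
  fix l
  let ?s = "snd (y (Delta l))"
  obtain b where b: "b \<in> supported_funs X B"
    "\<forall>x. fst (y' (Delta l)) x = fst (y (Delta l)) x + b (?s x) - b x"
    using deformation_Delta[OF assms(1)] by blast
  obtain b' where b': "b' \<in> supported_funs X B"
    "\<forall>x. fst (y'' (Delta l)) x = fst (y' (Delta l)) x + b' (?s x) - b' x"
    using deformation_Delta[OF assms(2), of l] unfolding deformation_snd[OF assms(1)] by blast
  show "\<exists>b\<in>supported_funs X B. \<forall>x. fst (y'' (Delta l)) x = fst (y (Delta l)) x + b (?s x) - b x"
  proof (rule bexI[where x = "\<lambda>x. b x + b' x"])
    show "\<forall>x. fst (y'' (Delta l)) x = fst (y (Delta l)) x + (b (?s x) + b' (?s x)) - (b x + b' x)"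
      using b(2) b'(2) by simp
  qed (rule B.supported_funs_add[OF b(1) b'(1)])
qed

lemma lifts_deformation:
  assumes "y \<in> lifts" "deformation X B y y'"
  shows "y' \<in> lifts"
proof -
  have "y' i \<in> carrier M \<and> snd (y' i) = \<sigma> i" if i: "b \<in> set bs" "i \<in> block_gens b" for b i
  proof -
    have "y i \<in> carrier M" and y: "snd (y i) = \<sigma> i"
      using assms(1) i unfolding lifts_def by blast+
    then have v: "fst (y i) \<in> supported_funs X C" by simp
    from y show ?thesis
      using deformation_snd[OF assms(2)] perms[OF i]
        C.supported_funs_add[OF v supported_funs_B_C[OF deformation_fst[OF assms(2), of i]]]
      by simp
  qed
  then show ?thesis unfolding lifts_def by blast
qed

lemma lifts_carrier: "y \<in> lifts \<Longrightarrow> b \<in> set bs \<Longrightarrow> i \<in> block_gens b \<Longrightarrow> y i \<in> carrier M"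
  unfolding lifts_def by blast

lemma reachable_zero: "(\<lambda>_. 0) \<in> reachable"
proof -
  have "\<exists>y'. deformation X B y y' \<and>
    blocks_product M y' bs = blocks_product M y bs \<otimes>\<^bsub>M\<^esub> ((\<lambda>_. 0), id)" for y
    by (rule exI[of _ y]) (simp add: deformation_refl prod_eq_iff)
  then show ?thesis by (simp add: reachable_def)
qed

lemma reachable_add:
  assumes "a \<in> reachable" "b \<in> reachable"
  shows "(\<lambda>x. a x + b x) \<in> reachable"
  unfolding reachable_def
proof safe
  show "(\<lambda>x. a x + b x) \<in> supported_funs X B"
    by (rule B.supported_funs_add) (use assms in \<open>simp_all add: reachable_def\<close>)
  fix y assume y: "y \<in> lifts"
  obtain y' where y': "deformation X B y y'"
    "blocks_product M y' bs = blocks_product M y bs \<otimes>\<^bsub>M\<^esub> (a, id)"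
    using assms(1) y unfolding reachable_def by blast
  have "y' \<in> lifts" by (rule lifts_deformation[OF y y'(1)])
  then obtain y'' where y'': "deformation X B y' y''"
    "blocks_product M y'' bs = blocks_product M y' bs \<otimes>\<^bsub>M\<^esub> (b, id)"
    using assms(2) unfolding reachable_def by blast
  show "\<exists>y'. deformation X B y y' \<and>
      blocks_product M y' bs = blocks_product M y bs \<otimes>\<^bsub>M\<^esub> (\<lambda>x. a x + b x, id)"
    by (rule exI[of _ y'']) (use deformation_trans[OF y'(1) y''(1)] y'(2) y''(2) in \<open>simp add: add.assoc\<close>)
qed

lemma reachable_sum:
  "finite I \<Longrightarrow> (\<And>i. i \<in> I \<Longrightarrow> f i \<in> reachable) \<Longrightarrow> (\<lambda>x. \<Sum>i\<in>I. f i x) \<in> reachable"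
  by (induction I rule: finite_induct) (simp_all add: reachable_zero reachable_add)

lemma blocks_not_Beta: "b \<in> set bs \<Longrightarrow> b \<notin> range Beta"
  by (auto simp: relator_blocks_def)

definition block_perm :: "F_gen \<Rightarrow> 'x \<Rightarrow> 'x"
  where "block_perm b = (case b of
    Alpha i \<Rightarrow> \<sigma> (Alpha i) \<circ> \<sigma> (Beta i) \<circ> inv_into UNIV (\<sigma> (Alpha i)) \<circ> inv_into UNIV (\<sigma> (Beta i)) | _ \<Rightarrow> \<sigma> b)"

definition blocks_perm :: "F_gen list \<Rightarrow> 'x \<Rightarrow> 'x"
  where "blocks_perm cs = foldr (\<lambda>b u. block_perm b \<circ> u) cs id"

lemma inv_M:
  assumes "p \<in> carrier M"
  shows "inv\<^bsub>M\<^esub> p = (\<lambda>x. - fst p (inv_into UNIV (snd p) x), inv_into UNIV (snd p))"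
  using C.inv_monomial_group[of "fst p" X "snd p"] assms by simp

lemma snd_block_value:
  assumes "y \<in> lifts" "b \<in> set bs"
  shows "snd (block_value M y b) = block_perm b"
proof (cases b)
  case (Alpha i)
  have "y (Alpha i) \<in> carrier M" "y (Beta i) \<in> carrier M"
    using lifts_carrier[OF assms] Alpha by auto
  note inv_M[OF this(1)] inv_M[OF this(2)]
  moreover have "snd (y (Alpha i)) = \<sigma> (Alpha i)" "snd (y (Beta i)) = \<sigma> (Beta i)"
    using assms Alpha by (auto simp: lifts_def)
  ultimately show ?thesis
    by (simp add: Alpha block_value_def block_perm_def commutator_def)
qed (use assms in \<open>auto simp: block_value_def block_perm_def lifts_def relator_blocks_def\<close>)

lemma snd_blocks_product:
  assumes "y \<in> lifts" "set cs \<subseteq> set bs"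
  shows "snd (blocks_product M y cs) = blocks_perm cs"
  using assms(2) by (induction cs) (auto simp: blocks_perm_def snd_block_value[OF assms(1)])

lemma block_perm_permutes:
  assumes "b \<in> set bs"
  shows "block_perm b permutes X"
proof (cases b)
  case (Alpha i)
  have "\<sigma> (Alpha i) permutes X" "\<sigma> (Beta i) permutes X" using perms[OF assms] Alpha by auto
  then show ?thesis
    unfolding block_perm_def Alpha by (auto intro!: permutes_compose permutes_inv)
qed (use perms[OF assms] in \<open>auto simp: block_perm_def relator_blocks_def\<close>)

lemma blocks_perm_permutes: "set cs \<subseteq> set bs \<Longrightarrow> blocks_perm cs permutes X"
  by (induction cs) (auto simp: blocks_perm_def permutes_id intro!: permutes_compose block_perm_permutes)

text \<open>A right translation of the value of one block by \<open>a\<close> is moved to the end of the product.\<close>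

lemma reachable_block:
  assumes bs: "bs = ps @ c # qs" and a: "a \<in> supported_funs X B"
    and deform: "\<And>y. y \<in> lifts \<Longrightarrow> \<exists>y'. deformation X B y y' \<and> (\<forall>i. i \<notin> block_gens c \<longrightarrow> y' i = y i) \<and>
      block_value M y' c = block_value M y c \<otimes>\<^bsub>M\<^esub> (a, id)"
  shows "(\<lambda>x. a (blocks_perm qs x)) \<in> reachable"
  unfolding reachable_def
proof safe
  let ?u = "blocks_perm qs"
  have u: "?u permutes X" by (rule blocks_perm_permutes) (auto simp: bs)
  show "(\<lambda>x. a (?u x)) \<in> supported_funs X B" by (rule B.supported_funs_comp[OF a u])
  fix y assume y: "y \<in> lifts"
  obtain y' where y': "deformation X B y y'" and eq: "\<And>i. i \<notin> block_gens c \<Longrightarrow> y' i = y i"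
    and c: "block_value M y' c = block_value M y c \<otimes>\<^bsub>M\<^esub> (a, id)"
    using deform[OF y] by blast
  have c_bs: "c \<in> set bs" by (simp add: bs)
  have y'_lifts: "y' \<in> lifts" by (rule lifts_deformation[OF y y'])
  have other: "blocks_product M y' cs = blocks_product M y cs" if "set cs \<subseteq> set bs" "c \<notin> set cs" for cs
  proof (rule blocks_product_cong)
    fix i b assume "b \<in> set cs" "i \<in> block_gens b"
    moreover have "b \<notin> range Beta" "c \<notin> range Beta"
      using blocks_not_Beta that(1) \<open>b \<in> set cs\<close> c_bs by blast+
    ultimately have "i \<notin> block_gens c" using that block_gens_disjoint by metis
    then show "y' i = y i" by (rule eq)
  qed
  have nc: "c \<notin> set ps" "c \<notin> set qs" using distinct_relator_blocks[of g r k] unfolding bs by auto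
  have split: "blocks_product M z bs = blocks_product M z ps \<otimes>\<^bsub>M\<^esub> (block_value M z c \<otimes>\<^bsub>M\<^esub> blocks_product M z qs)"
    if "z \<in> lifts" for z
  proof -
    have "blocks_product M z (ps @ c # qs) = blocks_product M z ps \<otimes>\<^bsub>M\<^esub> blocks_product M z (c # qs)"
      by (rule M.blocks_product_append) (rule lifts_carrier[OF that], simp_all only: bs)
    then show ?thesis unfolding bs blocks_product_Cons .
  qed
  have snd_qs: "snd (blocks_product M y qs) = ?u"
    by (rule snd_blocks_product[OF y]) (auto simp: bs)
  have "set ps \<subseteq> set bs" "set qs \<subseteq> set bs" by (auto simp: bs)
  note other = other[OF this(1) nc(1)] other[OF this(2) nc(2)]
  \<comment> \<open>The computation behind this: \<open>(a, id)\<close> times \<open>(w, u)\<close>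
    equals \<open>(w, u)\<close> times \<open>(\<lambda>x. a (u x), id)\<close>.\<close>
  have "blocks_product M y' bs = blocks_product M y bs \<otimes>\<^bsub>M\<^esub> (\<lambda>x. a (?u x), id)"
    unfolding split[OF y] split[OF y'_lifts] c other
    by (simp add: snd_qs ac_simps)
  with y' show "\<exists>y'. deformation X B y y' \<and>
      blocks_product M y' bs = blocks_product M y bs \<otimes>\<^bsub>M\<^esub> (\<lambda>x. a (?u x), id)"
    by blast
qed

text \<open>Differences of point functions span the functions with sum zero, so everything comes
  down to showing that this relation has a single class on \<open>X\<close>.\<close>

definition equivalent :: "'x \<Rightarrow> 'x \<Rightarrow> bool" (infix \<open>\<frown>\<close> 50)
  where "x \<frown> z \<longleftrightarrow> (\<forall>c\<in>B. (\<lambda>t. point_fun x c t - point_fun z c t) \<in> reachable)"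

lemma equivalent_refl: "x \<frown> x"
  by (simp add: equivalent_def reachable_zero)

lemma equivalent_sym:
  assumes "x \<frown> z"
  shows "z \<frown> x"
  unfolding equivalent_def
proof
  fix c assume "c \<in> B"
  then have "(\<lambda>t. point_fun x (- c) t - point_fun z (- c) t) \<in> reachable"
    using assms B.uminus_mem unfolding equivalent_def by blast
  moreover have "(\<lambda>t. point_fun x (- c) t - point_fun z (- c) t) = (\<lambda>t. point_fun z c t - point_fun x c t)"
    by (simp add: fun_eq_iff point_fun_def)
  ultimately show "(\<lambda>t. point_fun z c t - point_fun x c t) \<in> reachable" by simp
qed

lemma equivalent_trans:
  assumes "x \<frown> y" "y \<frown> z"
  shows "x \<frown> z"
  unfolding equivalent_def
proof
  fix c assume "c \<in> B"
  then show "(\<lambda>t. point_fun x c t - point_fun z c t) \<in> reachable"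
    using reachable_add[of "\<lambda>t. point_fun x c t - point_fun y c t" "\<lambda>t. point_fun y c t - point_fun z c t"]
      assms unfolding equivalent_def by simp
qed

text \<open>Take for \<open>b\<close> the point function at the common value of \<open>p x\<close>
  and \<open>q x'\<close>: pulled back along \<open>p\<close> it sits at \<open>x\<close>, along
  \<open>q\<close> at \<open>x'\<close>.\<close>

lemma equivalentI:
  assumes reach: "\<And>b. b \<in> supported_funs X B \<Longrightarrow> (\<lambda>x. b (p x) - b (q x)) \<in> reachable"
    and p: "p permutes X" and q: "q permutes X" and x: "x \<in> X" and eq: "p x = q x'"
  shows "x \<frown> x'"
  unfolding equivalent_def
proof
  fix c assume c: "c \<in> B"
  have "p x \<in> X" using x p by (simp add: permutes_in_image)
  then have "point_fun (p x) c \<in> supported_funs X B"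
    using c by (simp add: supported_funs_def point_fun_def)
  from reach[OF this] show "(\<lambda>t. point_fun x c t - point_fun x' c t) \<in> reachable"
    using permutes_inverses(2)[OF p, of x] permutes_inverses(2)[OF q, of x'] eq
    by (simp add: point_fun_comp[OF p] point_fun_comp[OF q])
qed

text \<open>Conjugating \<open>y c\<close> by the function \<open>b\<close> multiplies it on the
  right by the coboundary of \<open>b\<close>. Parabolic and elliptic generators are moved in the
  same way.\<close>

lemma reachable_single:
  assumes "bs = ps @ c # qs" "block_gens c = {c}" "b \<in> supported_funs X B"
  shows "(\<lambda>x. b (\<sigma> c (blocks_perm qs x)) - b (blocks_perm qs x)) \<in> reachable"
proof -
  have c: "c \<in> set bs" using assms(1) by auto
  have \<sigma>: "\<sigma> c permutes X" using perms[OF c] assms(2) by simp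
  let ?a = "\<lambda>x. b (\<sigma> c x) - b x"
  have a: "?a \<in> supported_funs X B"
    using B.supported_funs_diff[OF B.supported_funs_comp[OF assms(3) \<sigma>] assms(3)] .
  have value_eq: "block_value M z c = z c" for z
    using assms(2) by (cases c) (auto simp: block_value_def)
  show ?thesis
  proof (rule reachable_block[OF assms(1) a])
    fix y assume y: "y \<in> lifts"
    then have yc: "snd (y c) = \<sigma> c" using c assms(2) by (simp add: lifts_def)
    let ?y = "y(c := (\<lambda>x. fst (y c) x + ?a x, \<sigma> c))"
    have "deformation X B y ?y"
      unfolding deformation_def
    proof (intro conjI allI)
      fix l
      show "\<exists>b\<in>supported_funs X B. \<forall>x.
          fst (?y (Delta l)) x = fst (y (Delta l)) x + b (snd (y (Delta l)) x) - b x"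
      proof (cases "c = Delta l")
        case True
        then show ?thesis using assms(3) yc by (intro bexI[where x = b]) simp_all
      next
        case False
        then show ?thesis by (intro bexI[where x = "\<lambda>_. 0"]) simp_all
      qed
    qed (use a yc in simp_all)
    then show "\<exists>y'. deformation X B y y' \<and> (\<forall>i. i \<notin> block_gens c \<longrightarrow> y' i = y i) \<and>
        block_value M y' c = block_value M y c \<otimes>\<^bsub>M\<^esub> (?a, id)"
      using yc by (intro exI[where x = ?y]) (simp add: value_eq assms(2))
  qed
qed

lemma commutator_M:
  assumes "p \<in> carrier M" "q \<in> carrier M"
  shows "commutator M p q =
    (let \<alpha>' = inv_into UNIV (snd p); \<beta>' = inv_into UNIV (snd q) in
     (\<lambda>x. fst p (snd q (\<alpha>' (\<beta>' x))) + fst q (\<alpha>' (\<beta>' x)) - fst p (\<alpha>' (\<beta>' x)) - fst q (\<beta>' x),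
      snd p \<circ> snd q \<circ> \<alpha>' \<circ> \<beta>'))"
  using assms by (simp add: commutator_def inv_M Let_def fun_eq_iff)

text \<open>These are the Fox derivatives of the commutator, applied to \<open>b\<close>: the first
  results from adding \<open>b\<close> to the coefficients of \<alpha>, the second from adding it to
  those of \<beta>.\<close>

lemma reachable_commutator:
  assumes "bs = ps @ Alpha i # qs" and b: "b \<in> supported_funs X B"
  defines "\<alpha>' \<equiv> inv_into UNIV (\<sigma> (Alpha i))" and "\<beta>' \<equiv> inv_into UNIV (\<sigma> (Beta i))"
  shows "(\<lambda>x. b (\<sigma> (Beta i) (\<alpha>' (\<beta>' (blocks_perm qs x)))) - b (\<alpha>' (\<beta>' (blocks_perm qs x)))) \<in> reachable"
    and "(\<lambda>x. b (\<alpha>' (\<beta>' (blocks_perm qs x))) - b (\<beta>' (blocks_perm qs x))) \<in> reachable"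
proof -
  have c: "Alpha i \<in> set bs" using assms(1) by auto
  have \<alpha>: "\<sigma> (Alpha i) permutes X" and \<beta>: "\<sigma> (Beta i) permutes X" using perms[OF c] by auto
  have \<alpha>': "\<alpha>' permutes X" and \<beta>': "\<beta>' permutes X"
    unfolding \<alpha>'_def \<beta>'_def by (rule permutes_inv, fact)+
  have \<alpha>\<beta>': "(\<lambda>x. b (\<alpha>' (\<beta>' x))) \<in> supported_funs X B"
    by (rule B.supported_funs_comp[OF B.supported_funs_comp[OF b \<alpha>'] \<beta>'])
  have a1: "(\<lambda>x. b (\<sigma> (Beta i) (\<alpha>' (\<beta>' x))) - b (\<alpha>' (\<beta>' x))) \<in> supported_funs X B"
    by (rule B.supported_funs_diff[OF
          B.supported_funs_comp[OF B.supported_funs_comp[OF B.supported_funs_comp[OF b \<beta>] \<alpha>'] \<beta>'] \<alpha>\<beta>'])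
  have a2: "(\<lambda>x. b (\<alpha>' (\<beta>' x)) - b (\<beta>' x)) \<in> supported_funs X B"
    by (rule B.supported_funs_diff[OF \<alpha>\<beta>' B.supported_funs_comp[OF b \<beta>']])
  have deform: "deformation X B y (y(c := (\<lambda>x. fst (y c) x + b x, snd (y c))))" if "c \<notin> range Delta" for y c
    unfolding deformation_def
  proof (intro conjI allI)
    fix l
    have "c \<noteq> Delta l" using that by blast
    then show "\<exists>b'\<in>supported_funs X B. \<forall>x.
        fst ((y(c := (\<lambda>x. fst (y c) x + b x, snd (y c)))) (Delta l)) x
        = fst (y (Delta l)) x + b' (snd (y (Delta l)) x) - b' x"
      by (intro bexI[where x = "\<lambda>_. 0"]) simp_all
  qed (use b in simp_all)
  have y_gens: "y (Alpha i) \<in> carrier M" "y (Beta i) \<in> carrier M" "snd (y (Alpha i)) = \<sigma> (Alpha i)"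
    "snd (y (Beta i)) = \<sigma> (Beta i)" if "y \<in> lifts" for y
    using that c unfolding lifts_def by (auto simp del: monomial_group_simps)
  show "(\<lambda>x. b (\<sigma> (Beta i) (\<alpha>' (\<beta>' (blocks_perm qs x)))) - b (\<alpha>' (\<beta>' (blocks_perm qs x)))) \<in> reachable"
  proof (rule reachable_block[OF assms(1) a1])
    fix y assume y: "y \<in> lifts"
    let ?y = "y(Alpha i := (\<lambda>x. fst (y (Alpha i)) x + b x, snd (y (Alpha i))))"
    have d: "deformation X B y ?y" by (rule deform) auto
    have "block_value M ?y (Alpha i) =
        block_value M y (Alpha i) \<otimes>\<^bsub>M\<^esub> (\<lambda>x. b (\<sigma> (Beta i) (\<alpha>' (\<beta>' x))) - b (\<alpha>' (\<beta>' x)), id)"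
      using commutator_M[OF y_gens(1,2)[OF y]] commutator_M[OF y_gens(1,2)[OF lifts_deformation[OF y d]]]
      by (simp add: block_value_def y_gens[OF y] Let_def \<alpha>'_def \<beta>'_def fun_eq_iff)
    with d show "\<exists>y'. deformation X B y y' \<and> (\<forall>j. j \<notin> block_gens (Alpha i) \<longrightarrow> y' j = y j) \<and>
        block_value M y' (Alpha i) =
        block_value M y (Alpha i) \<otimes>\<^bsub>M\<^esub> (\<lambda>x. b (\<sigma> (Beta i) (\<alpha>' (\<beta>' x))) - b (\<alpha>' (\<beta>' x)), id)"
      by (intro exI[where x = ?y]) (simp del: monomial_group_simps)
  qed
  show "(\<lambda>x. b (\<alpha>' (\<beta>' (blocks_perm qs x))) - b (\<beta>' (blocks_perm qs x))) \<in> reachable"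
  proof (rule reachable_block[OF assms(1) a2])
    fix y assume y: "y \<in> lifts"
    let ?y = "y(Beta i := (\<lambda>x. fst (y (Beta i)) x + b x, snd (y (Beta i))))"
    have d: "deformation X B y ?y" by (rule deform) auto
    have "block_value M ?y (Alpha i) =
        block_value M y (Alpha i) \<otimes>\<^bsub>M\<^esub> (\<lambda>x. b (\<alpha>' (\<beta>' x)) - b (\<beta>' x), id)"
      using commutator_M[OF y_gens(1,2)[OF y]] commutator_M[OF y_gens(1,2)[OF lifts_deformation[OF y d]]]
      by (simp add: block_value_def y_gens[OF y] Let_def \<alpha>'_def \<beta>'_def fun_eq_iff)
    with d show "\<exists>y'. deformation X B y y' \<and> (\<forall>j. j \<notin> block_gens (Alpha i) \<longrightarrow> y' j = y j) \<and>
        block_value M y' (Alpha i) =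
        block_value M y (Alpha i) \<otimes>\<^bsub>M\<^esub> (\<lambda>x. b (\<alpha>' (\<beta>' x)) - b (\<beta>' x), id)"
      by (intro exI[where x = ?y]) (simp del: monomial_group_simps)
  qed
qed

text \<open>The permutations with this property form a group; the aim is to get all
  \<open>\<sigma> i\<close> into it.\<close>

definition class_preserving :: "('x \<Rightarrow> 'x) \<Rightarrow> bool"
  where "class_preserving \<rho> \<longleftrightarrow> (\<rho> permutes X \<and> (\<forall>x\<in>X. \<rho> x \<frown> x))"

lemma class_preserving_comp:
  assumes "class_preserving \<rho>" "class_preserving \<tau>"
  shows "class_preserving (\<rho> \<circ> \<tau>)"
proof -
  have "\<rho> (\<tau> x) \<frown> x" if "x \<in> X" for x
    using assms that equivalent_trans[of "\<rho> (\<tau> x)" "\<tau> x" x] unfolding class_preserving_def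
    by (simp add: permutes_in_image)
  then show ?thesis using assms by (simp add: class_preserving_def permutes_compose)
qed

lemma class_preserving_inv:
  assumes "class_preserving \<rho>"
  shows "class_preserving (inv_into UNIV \<rho>)"
proof -
  have \<rho>: "\<rho> permutes X" using assms by (simp add: class_preserving_def)
  have "inv_into UNIV \<rho> x \<frown> x" if "x \<in> X" for x
  proof -
    have "inv_into UNIV \<rho> x \<in> X" using permutes_in_image[OF permutes_inv[OF \<rho>]] that by blast
    then have "\<rho> (inv_into UNIV \<rho> x) \<frown> inv_into UNIV \<rho> x" using assms unfolding class_preserving_def by blast
    then show ?thesis using equivalent_sym permutes_inverses(1)[OF \<rho>] by simp
  qed
  then show ?thesis by (simp add: class_preserving_def permutes_inv[OF \<rho>])
qed

lemma class_preserving_single: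
  assumes bs: "bs = ps @ c # qs" "block_gens c = {c}" and u: "class_preserving (blocks_perm qs)"
  shows "class_preserving (\<sigma> c)"
proof -
  let ?u = "blocks_perm qs"
  let ?u' = "inv_into UNIV ?u"
  have c: "c \<in> set bs" using bs by auto
  have \<sigma>: "\<sigma> c permutes X" using perms[OF c] bs(2) by simp
  have u_perm: "?u permutes X" using u by (simp add: class_preserving_def)
  have u': "class_preserving ?u'" by (rule class_preserving_inv[OF u])
  have "\<sigma> c t \<frown> t" if t: "t \<in> X" for t
  proof -
    have st: "\<sigma> c t \<in> X" using t permutes_in_image[OF \<sigma>] by blast
    have "?u' t \<frown> ?u' (\<sigma> c t)"
    proof (rule equivalentI[OF reachable_single[OF bs]])
      show "(\<lambda>x. \<sigma> c (?u x)) permutes X" using permutes_compose[OF u_perm \<sigma>] by (simp add: o_def)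
      show "?u permutes X" by fact
      show "?u' t \<in> X" using t permutes_in_image[OF permutes_inv[OF u_perm]] by blast
      show "\<sigma> c (?u (?u' t)) = ?u (?u' (\<sigma> c t))" by (simp add: permutes_inverses[OF u_perm])
    qed
    moreover have "?u' t \<frown> t" "?u' (\<sigma> c t) \<frown> \<sigma> c t" using u' t st by (auto simp: class_preserving_def)
    ultimately show ?thesis by (meson equivalent_sym equivalent_trans)
  qed
  then show ?thesis using \<sigma> by (simp add: class_preserving_def)
qed

lemma class_preserving_commutator:
  assumes bs: "bs = ps @ Alpha i # qs" and u: "class_preserving (blocks_perm qs)"
  shows "class_preserving (\<sigma> (Alpha i))" "class_preserving (\<sigma> (Beta i))"
proof -
  let ?u = "blocks_perm qs"
  let ?u' = "inv_into UNIV ?u"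
  let ?\<alpha> = "\<sigma> (Alpha i)" and ?\<beta> = "\<sigma> (Beta i)"
  let ?\<alpha>' = "inv_into UNIV ?\<alpha>" and ?\<beta>' = "inv_into UNIV ?\<beta>"
  have c: "Alpha i \<in> set bs" using bs by auto
  have \<alpha>: "?\<alpha> permutes X" and \<beta>: "?\<beta> permutes X" using perms[OF c] by auto
  note \<alpha>' = permutes_inv[OF \<alpha>] and \<beta>' = permutes_inv[OF \<beta>]
  have u_perm: "?u permutes X" using u by (simp add: class_preserving_def)
  have u': "class_preserving ?u'" by (rule class_preserving_inv[OF u])
  note inX = permutes_in_image[OF \<alpha>] permutes_in_image[OF \<beta>] permutes_in_image[OF permutes_inv[OF u_perm]]
  have p2: "(\<lambda>x. ?\<beta>' (?u x)) permutes X"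
    using permutes_compose[OF u_perm \<beta>'] by (simp add: o_def)
  have p1: "(\<lambda>x. ?\<alpha>' (?\<beta>' (?u x))) permutes X"
    using permutes_compose[OF p2 \<alpha>'] by (simp add: o_def)
  have p0: "(\<lambda>x. ?\<beta> (?\<alpha>' (?\<beta>' (?u x)))) permutes X"
    using permutes_compose[OF p1 \<beta>] by (simp add: o_def)
  have drop: "x \<frown> z" if "?u' x \<frown> ?u' z" "x \<in> X" "z \<in> X" for x z
    using that u' unfolding class_preserving_def by (meson equivalent_sym equivalent_trans)
  \<comment> \<open>Both Fox derivatives are used at the point
    \<open>?u' (?\<beta> (?\<alpha> s))\<close>, where the inverses of \<alpha> and \<beta> in their
    formulas cancel.\<close>
  have *: "?\<beta> (?\<alpha> s) \<frown> ?\<beta> s" if s: "s \<in> X" for s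
  proof (rule drop)
    show "?u' (?\<beta> (?\<alpha> s)) \<frown> ?u' (?\<beta> s)"
      by (rule equivalentI[OF reachable_commutator(2)[OF bs] p1 p2])
        (simp_all add: inX s permutes_inverses[OF u_perm] permutes_inverses[OF \<alpha>] permutes_inverses[OF \<beta>])
  qed (simp_all add: inX s)
  have **: "?\<beta> (?\<alpha> s) \<frown> ?\<beta> (?\<alpha> (?\<beta> s))" if s: "s \<in> X" for s
  proof (rule drop)
    show "?u' (?\<beta> (?\<alpha> s)) \<frown> ?u' (?\<beta> (?\<alpha> (?\<beta> s)))"
      by (rule equivalentI[OF reachable_commutator(1)[OF bs] p0 p1])
        (simp_all add: inX s permutes_inverses[OF u_perm] permutes_inverses[OF \<alpha>] permutes_inverses[OF \<beta>])
  qed (simp_all add: inX s)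
  have \<beta>_good: "?\<beta> t \<frown> t" if t: "t \<in> X" for t
  proof -
    define s where "s = ?\<beta>' t"
    have s: "s \<in> X" "?\<beta> s = t"
      using t permutes_in_image[OF \<beta>'] permutes_inverses(1)[OF \<beta>] by (simp_all add: s_def)
    \<comment> \<open>The chain runs through \<open>\<beta> s\<close>,
      \<open>\<beta> (\<alpha> s)\<close>, \<open>\<beta> (\<alpha> (\<beta> s))\<close> and
      \<open>\<beta> (\<beta> s)\<close>; since \<beta> is onto, \<open>\<beta> s\<close> is an
      arbitrary point.\<close>
    have "?\<beta> (?\<beta> s) \<frown> ?\<beta> s"
      using *[OF s(1)] **[OF s(1)] *[of "?\<beta> s"] s(1) inX by (meson equivalent_sym equivalent_trans)
    then show ?thesis using s(2) by simp
  qed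
  then show "class_preserving ?\<beta>" using \<beta> by (simp add: class_preserving_def)
  have "?\<alpha> s \<frown> s" if s: "s \<in> X" for s
    using *[OF s] \<beta>_good[OF s] \<beta>_good[of "?\<alpha> s"] s inX by (meson equivalent_sym equivalent_trans)
  then show "class_preserving ?\<alpha>" using \<alpha> by (simp add: class_preserving_def)
qed

text \<open>The induction starts at the end of the relator, because the Fox derivative of a block
  involves, besides its own generators, only the permutation of the blocks behind it.\<close>

lemma class_preserving_suffix:
  assumes "bs = ps @ qs"
  shows "class_preserving (blocks_perm qs) \<and> (\<forall>b\<in>set qs. \<forall>i\<in>block_gens b. class_preserving (\<sigma> i))"
  using assms
proof (induction qs arbitrary: ps)
  case Nil
  have "class_preserving id" by (simp add: class_preserving_def permutes_id[unfolded id_def] equivalent_refl id_def)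
  then show ?case by (simp add: blocks_perm_def id_def)
next
  case (Cons c qs)
  have IH: "class_preserving (blocks_perm qs)" "\<forall>b\<in>set qs. \<forall>i\<in>block_gens b. class_preserving (\<sigma> i)"
    using Cons.IH[of "ps @ [c]"] Cons.prems by auto
  have c: "c \<in> set bs" using Cons.prems by auto
  have "(\<forall>i\<in>block_gens c. class_preserving (\<sigma> i)) \<and> class_preserving (block_perm c)"
  proof (cases c)
    case (Alpha i)
    then have "class_preserving (\<sigma> (Alpha i))" "class_preserving (\<sigma> (Beta i))"
      using class_preserving_commutator[of ps i qs] Cons.prems IH by auto
    then show ?thesis by (simp add: Alpha block_perm_def class_preserving_comp class_preserving_inv del: comp_apply)
  qed (use class_preserving_single[OF Cons.prems _ IH(1)] blocks_not_Beta[OF c] in \<open>auto simp: block_perm_def\<close>)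
  note c_good = this
  have "blocks_perm (c # qs) = block_perm c \<circ> blocks_perm qs"
    by (simp add: blocks_perm_def)
  moreover have "class_preserving (block_perm c \<circ> blocks_perm qs)" using class_preserving_comp IH(1) c_good by blast
  ultimately have "class_preserving (blocks_perm (c # qs))" by (simp only:)
  then show ?case using IH(2) c_good by simp
qed

lemma all_equivalent:
  assumes "x \<in> X"
  shows "x \<frown> x0"
proof -
  have "{x \<in> X. x \<frown> x0} = X"
  proof (rule transitive)
    fix b i x assume b: "b \<in> set bs" "i \<in> block_gens b" and x: "x \<in> {x \<in> X. x \<frown> x0}"
    have "class_preserving (\<sigma> i)" using class_preserving_suffix[of "[]" bs] b by simp
    then show "\<sigma> i x \<in> {x \<in> X. x \<frown> x0}"
      using x equivalent_trans[of "\<sigma> i x" x x0] by (auto simp: class_preserving_def permutes_in_image)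
  qed (use x0 equivalent_refl in auto)
  then show ?thesis using assms by blast
qed

text \<open>Write \<open>c\<close> as the sum of its point functions and move each of them to
  \<open>x0\<close>; there the values add up to zero.\<close>

lemma reachable_sum_zero:
  assumes c: "c \<in> supported_funs X B" and sum: "(\<Sum>x\<in>X. c x) = 0"
  shows "c \<in> reachable"
proof -
  have "(\<lambda>t. \<Sum>z\<in>X. (point_fun z (c z) t - point_fun x0 (c z) t)) \<in> reachable"
  proof (rule reachable_sum[OF finite_X])
    fix z assume "z \<in> X"
    moreover have "c z \<in> B" using c by (simp add: supported_funs_def)
    ultimately show "(\<lambda>t. point_fun z (c z) t - point_fun x0 (c z) t) \<in> reachable"
      using all_equivalent unfolding equivalent_def by blast
  qed
  moreover have "(\<Sum>z\<in>X. (point_fun z (c z) t - point_fun x0 (c z) t)) = c t" for t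
  proof -
    have "(\<Sum>z\<in>X. point_fun z (c z) t) = c t"
      using c finite_X by (simp add: point_fun_def supported_funs_def)
    moreover have "(\<Sum>z\<in>X. point_fun x0 (c z) t) = 0"
      using sum by (cases "t = x0") (simp_all add: point_fun_def)
    ultimately show ?thesis by (simp add: sum_subtractf)
  qed
  ultimately show ?thesis by simp
qed

theorem deform_to_relation:
  assumes y: "y \<in> lifts" and c: "blocks_product M y bs = (c, id)" "c \<in> supported_funs X B"
    and sum: "(\<Sum>x\<in>X. c x) = 0"
  shows "\<exists>y'\<in>lifts. deformation X B y y' \<and> blocks_product M y' bs = \<one>\<^bsub>M\<^esub>"
proof -
  have "(\<lambda>x. - c x) \<in> reachable"
    by (rule reachable_sum_zero) (simp_all add: B.supported_funs_uminus c(2) sum_negf sum)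
  then obtain y' where "deformation X B y y'"
    "blocks_product M y' bs = blocks_product M y bs \<otimes>\<^bsub>M\<^esub> (\<lambda>x. - c x, id)"
    using y unfolding reachable_def by blast
  then show ?thesis
    using lifts_deformation[OF y] c(1) by (intro bexI[where x = y']) simp_all
qed

end

section \<open>The group of rational numbers modulo the integers\<close>

\<comment> \<open>A divisible group in which every finite cyclic group embeds: coefficients can be
  divided pointwise, and coefficient groups of all orders live in one type.\<close>
quotient_type qz = rat / "\<lambda>x y :: rat. x - y \<in> \<int>"
proof (rule equivpI)
  show "reflp (\<lambda>x y :: rat. x - y \<in> \<int>)" by (simp add: reflp_def)
  show "symp (\<lambda>x y :: rat. x - y \<in> \<int>)"
  proof (rule sympI)
    fix x y :: rat assume "x - y \<in> \<int>"
    then show "y - x \<in> \<int>" using Ints_minus[of "x - y"] by simp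
  qed
  show "transp (\<lambda>x y :: rat. x - y \<in> \<int>)"
  proof (rule transpI)
    fix x y z :: rat assume "x - y \<in> \<int>" "y - z \<in> \<int>"
    then show "x - z \<in> \<int>" using Ints_add[of "x - y" "y - z"] by simp
  qed
qed

instantiation qz :: ab_group_add
begin

lift_definition zero_qz :: qz is 0 .

lift_definition plus_qz :: "qz \<Rightarrow> qz \<Rightarrow> qz" is "(+)"
proof -
  fix a b c d :: rat assume "a - b \<in> \<int>" "c - d \<in> \<int>"
  then show "a + c - (b + d) \<in> \<int>" using Ints_add[of "a - b" "c - d"] by (simp add: algebra_simps)
qed

lift_definition uminus_qz :: "qz \<Rightarrow> qz" is uminus
proof -
  fix a b :: rat assume "a - b \<in> \<int>"
  then show "- a - - b \<in> \<int>" using Ints_minus[of "a - b"] by simp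
qed

definition minus_qz :: "qz \<Rightarrow> qz \<Rightarrow> qz" where "minus_qz a b = a + - b"

instance
proof
  fix a b c :: qz
  show "a + b + c = a + (b + c)" by transfer (simp add: add.assoc)
  show "a + b = b + a" by transfer (simp add: add.commute)
  show "0 + a = a" by transfer simp
  show "- a + a = 0" by transfer simp
  show "a - b = a + - b" by (rule minus_qz_def)
qed

end

lift_definition qz_of :: "rat \<Rightarrow> qz" is "\<lambda>x. x" .

lemma qz_of_add: "qz_of (a + b) = qz_of a + qz_of b"
  by transfer simp

lemma qz_of_0 [simp]: "qz_of 0 = 0"
  by transfer simp

lemma qz_of_eq_0_iff: "qz_of a = 0 \<longleftrightarrow> a \<in> \<int>"
  by transfer simp

lemma qz_of_surj: obtains a where "x = qz_of a"
  by transfer (metis Ints_0 diff_self)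

definition nat_mult :: "nat \<Rightarrow> 'a::comm_monoid_add \<Rightarrow> 'a"
  where "nat_mult n x = (\<Sum>i<n. x)"

lemma nat_mult_0 [simp]: "nat_mult 0 x = 0"
  and nat_mult_Suc: "nat_mult (Suc n) x = x + nat_mult n x"
  by (simp_all add: nat_mult_def add.commute)

lemma nat_mult_1 [simp]: "nat_mult (Suc 0) x = x"
  by (simp add: nat_mult_def)

lemma nat_mult_zero [simp]: "nat_mult n 0 = 0"
  by (simp add: nat_mult_def)

lemma nat_mult_add: "nat_mult n (x + y) = nat_mult n x + nat_mult n y"
  by (simp add: nat_mult_def sum.distrib)

lemma nat_mult_uminus: "nat_mult n (- x) = - nat_mult n (x :: 'a::ab_group_add)"
  by (simp add: nat_mult_def sum_negf)

lemma nat_mult_diff: "nat_mult n (x - y) = nat_mult n x - nat_mult n (y :: 'a::ab_group_add)"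
  by (simp add: nat_mult_def sum_subtractf)

lemma nat_mult_sum: "nat_mult n (\<Sum>i\<in>I. f i) = (\<Sum>i\<in>I. nat_mult n (f i))"
  unfolding nat_mult_def by (rule sum.swap)

lemma nat_mult_add_left: "nat_mult (m + n) x = nat_mult m x + nat_mult n x"
  by (induction m) (simp_all add: nat_mult_Suc add.assoc)

lemma nat_mult_mult: "nat_mult (m * n) x = nat_mult m (nat_mult n x)"
  by (induction m) (simp_all add: nat_mult_Suc nat_mult_add_left)

lemma nat_mult_qz_of: "nat_mult n (qz_of a) = qz_of (of_nat n * a)"
  by (induction n) (simp_all add: nat_mult_Suc ring_distribs qz_of_add)

text \<open>For positive \<open>n\<close> this is the cyclic group of order \<open>n\<close>
  generated by \<open>unit_qz n\<close>.\<close>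

definition torsion_qz :: "nat \<Rightarrow> qz set"
  where "torsion_qz n = {x. nat_mult n x = 0}"

definition unit_qz :: "nat \<Rightarrow> qz"
  where "unit_qz n = qz_of (1 / of_nat n)"

lemma additive_torsion_qz: "additive_subgroup_set (torsion_qz n)"
  by standard (simp_all add: torsion_qz_def nat_mult_add nat_mult_uminus)

lemma nat_mult_unit_qz_eq_0_iff:
  assumes "n > 0"
  shows "nat_mult k (unit_qz n) = 0 \<longleftrightarrow> n dvd k"
proof -
  have "nat_mult k (unit_qz n) = 0 \<longleftrightarrow> (of_nat k / of_nat n :: rat) \<in> \<int>"
    by (simp add: unit_qz_def nat_mult_qz_of qz_of_eq_0_iff)
  also have "\<dots> \<longleftrightarrow> n dvd k"
  proof
    assume "(of_nat k / of_nat n :: rat) \<in> \<int>"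
    then obtain z where "(of_nat k / of_nat n :: rat) = of_int z" by (elim Ints_cases)
    then have "(of_nat k :: rat) = of_int z * of_nat n" using assms by (simp add: field_simps)
    then have "int k = z * int n" by (metis of_int_eq_iff of_int_mult of_int_of_nat_eq)
    then show "n dvd k" by (metis dvd_triv_right int_dvd_int_iff)
  next
    assume "n dvd k"
    then show "(of_nat k / of_nat n :: rat) \<in> \<int>" using assms by (auto elim!: dvdE)
  qed
  finally show ?thesis .
qed

lemma unit_qz_mem_torsion: "unit_qz n \<in> torsion_qz n"
  using nat_mult_unit_qz_eq_0_iff[of n n] by (cases "n = 0") (simp_all add: torsion_qz_def)

lemma torsion_qz_eq_multiples:
  assumes "n > 0" "x \<in> torsion_qz n"
  shows "\<exists>k<n. x = nat_mult k (unit_qz n)"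
proof -
  obtain a where a: "x = qz_of a" by (rule qz_of_surj)
  then have "of_nat n * a \<in> \<int>" using assms(2) by (simp add: torsion_qz_def nat_mult_qz_of qz_of_eq_0_iff)
  then obtain z where z: "of_nat n * a = of_int z" by (elim Ints_cases)
  let ?k = "nat (z mod int n)"
  have k: "int ?k = z mod int n" using assms(1) by simp
  have "z = int n * (z div int n) + int ?k" unfolding k by simp
  then have "of_int z = (of_nat n * of_int (z div int n) + of_nat ?k :: rat)"
    by (metis of_int_add of_int_mult of_int_of_nat_eq)
  then have "a = of_int (z div int n) + of_nat ?k / of_nat n"
    using z assms(1) by (simp add: field_simps)
  then have "x = qz_of (of_int (z div int n)) + nat_mult ?k (unit_qz n)"
    by (simp add: a qz_of_add unit_qz_def nat_mult_qz_of)
  moreover have "qz_of (of_int (z div int n)) = 0" by (simp add: qz_of_eq_0_iff)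
  ultimately have "x = nat_mult ?k (unit_qz n)" by simp
  moreover have "?k < n" using assms(1) by (simp add: nat_less_iff)
  ultimately show ?thesis by blast
qed

lemma finite_torsion_qz:
  assumes "n > 0"
  shows "finite (torsion_qz n)"
proof (rule finite_subset)
  show "torsion_qz n \<subseteq> (\<lambda>k. nat_mult k (unit_qz n)) ` {..<n}"
    using torsion_qz_eq_multiples[OF assms] by blast
qed simp

lemma qz_divisible:
  fixes x :: qz
  assumes "n > 0"
  shows "\<exists>z. nat_mult n z = x"
proof -
  obtain a where "x = qz_of a" by (rule qz_of_surj)
  then have "nat_mult n (qz_of (a / of_nat n)) = x" using assms by (simp add: nat_mult_qz_of)
  then show ?thesis by blast
qed

lemma torsion_qz_mono:
  assumes "m dvd n"
  shows "torsion_qz m \<subseteq> torsion_qz n"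
  using assms by (auto simp: torsion_qz_def mult.commute[of m] nat_mult_mult elim!: dvdE)

lemma nat_mult_mem_torsion_qz: "nat_mult n z \<in> torsion_qz m \<longleftrightarrow> z \<in> torsion_qz (m * n)"
  by (simp add: torsion_qz_def nat_mult_mult)

section \<open>Free groups\<close>

lemma inv_letter_inv_letter [simp]: "inv_letter (inv_letter a) = a"
  by (simp add: inv_letter_def prod_eq_iff)

lemma fst_inv_letter [simp]: "fst (inv_letter a) = fst a"
  by (simp add: inv_letter_def)

lemma reduced_word_Nil [simp]: "reduced_word []"
  by (simp add: reduced_word_def)

lemma reduced_word_Cons:
  "reduced_word (a # w) \<longleftrightarrow> reduced_word w \<and> (w \<noteq> [] \<longrightarrow> hd w \<noteq> inv_letter a)"
proof
  assume r: "reduced_word (a # w)"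
  have "w ! Suc i \<noteq> inv_letter (w ! i)" if "Suc i < length w" for i
    using r[unfolded reduced_word_def, rule_format, of "Suc i"] that by simp
  moreover have "hd w \<noteq> inv_letter a" if "w \<noteq> []"
    using r[unfolded reduced_word_def, rule_format, of 0] that by (simp add: hd_conv_nth)
  ultimately show "reduced_word w \<and> (w \<noteq> [] \<longrightarrow> hd w \<noteq> inv_letter a)"
    by (simp add: reduced_word_def)
next
  assume r: "reduced_word w \<and> (w \<noteq> [] \<longrightarrow> hd w \<noteq> inv_letter a)"
  have "(a # w) ! Suc i \<noteq> inv_letter ((a # w) ! i)" if "Suc i < length (a # w)" for i
  proof (cases i)
    case 0
    then have "w \<noteq> []" using that by auto
    then show ?thesis using r 0 by (simp add: hd_conv_nth)
  next
    case (Suc j)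
    then show ?thesis using r that by (simp add: reduced_word_def)
  qed
  then show "reduced_word (a # w)" by (simp add: reduced_word_def)
qed

lemma reduced_word_push: "reduced_word w \<Longrightarrow> reduced_word (push a w)"
  by (cases w) (auto simp: push_def reduced_word_Cons)

lemma push_Cons_reduced: "reduced_word (a # w) \<Longrightarrow> push a w = a # w"
  by (auto simp: push_def reduced_word_Cons)

lemma push_push_inv:
  assumes "reduced_word w"
  shows "push a (push (inv_letter a) w) = w"
  using assms by (cases w) (auto simp: push_def reduced_word_Cons)

lemma letters_push: "set (push a w) \<subseteq> insert a (set w)"
  by (auto simp: push_def dest: list.set_sel(2))

lemma letters_foldr_push: "set (foldr push v w) \<subseteq> set v \<union> set w"
proof (induction v)
  case (Cons a v)
  then show ?case using letters_push[of a "foldr push v w"] by auto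
qed simp

lemma fst_letters_foldr_push: "fst ` set (foldr push v w) \<subseteq> fst ` set v \<union> fst ` set w"
  using image_mono[OF letters_foldr_push, of fst v w] by (simp add: image_Un)

lemma reduced_word_foldr_push: "reduced_word w \<Longrightarrow> reduced_word (foldr push v w)"
  by (induction v) (simp_all add: reduced_word_push)

text \<open>On reduced words \<open>push a\<close> and \<open>push (inv_letter a)\<close> are
  inverse to each other, so a word acts on reduced words through its reduction. This is van der
  Waerden's way to associativity.\<close>

lemma foldr_push_push:
  assumes "reduced_word w"
  shows "foldr push (push a u) w = push a (foldr push u w)"
proof (cases "u \<noteq> [] \<and> hd u = inv_letter a")
  case True
  then obtain v where "u = inv_letter a # v" by (cases u) auto
  then show ?thesis using push_push_inv[OF reduced_word_foldr_push[OF assms]]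
    by (simp add: push_def[of a "inv_letter a # v"])
next
  case False
  then have "push a u = a # u" by (auto simp: push_def)
  then show ?thesis by simp
qed

lemma foldr_push_assoc:
  "reduced_word w \<Longrightarrow> foldr push (foldr push u v) w = foldr push u (foldr push v w)"
  by (induction u) (simp_all add: foldr_push_push)

lemma foldr_push_Nil: "reduced_word w \<Longrightarrow> foldr push w [] = w"
proof (induction w)
  case (Cons a w)
  then show ?case using push_Cons_reduced[of a w] by (simp add: reduced_word_Cons)
qed simp

lemma foldr_push_rev_inv:
  "reduced_word u \<Longrightarrow> foldr push (rev (map inv_letter w)) (foldr push w u) = u"
proof (induction w arbitrary: u)
  case (Cons a w)
  have "push (inv_letter a) (push a (foldr push w u)) = foldr push w u"
    using push_push_inv[of "foldr push w u" "inv_letter a"] Cons.prems by (simp add: reduced_word_foldr_push)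
  then show ?case using Cons by simp
qed simp

lemma free_group_simps [simp]:
  "w \<in> carrier (free_group X) \<longleftrightarrow> reduced_word w \<and> fst ` set w \<subseteq> X"
  "mult (free_group X) = foldr push"
  "one (free_group X) = []"
  by (simp_all add: free_group_def)

lemma group_free_group: "group (free_group X)"
proof (rule groupI)
  fix v w assume "v \<in> carrier (free_group X)" "w \<in> carrier (free_group X)"
  then show "v \<otimes>\<^bsub>free_group X\<^esub> w \<in> carrier (free_group X)"
    using order_trans[OF fst_letters_foldr_push[of v w], of X] by (simp add: reduced_word_foldr_push)
next
  fix w assume w: "w \<in> carrier (free_group X)"
  let ?v = "foldr push (rev (map inv_letter w)) []"
  have "?v \<in> carrier (free_group X)"
    using w fst_letters_foldr_push[of "rev (map inv_letter w)" "[]"]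
    by (simp add: reduced_word_foldr_push image_image) blast
  moreover have "?v \<otimes>\<^bsub>free_group X\<^esub> w = \<one>\<^bsub>free_group X\<^esub>"
    using w foldr_push_assoc[of w "rev (map inv_letter w)" "[]"] foldr_push_rev_inv[of "[]" w]
    by (simp add: foldr_push_Nil)
  ultimately show "\<exists>v\<in>carrier (free_group X). v \<otimes>\<^bsub>free_group X\<^esub> w = \<one>\<^bsub>free_group X\<^esub>" by blast
qed (auto simp: foldr_push_assoc)

definition eval_word :: "('a, 'b) monoid_scheme \<Rightarrow> ('x \<Rightarrow> 'a) \<Rightarrow> 'x word \<Rightarrow> 'a"
  where "eval_word G q w =
    foldr (\<lambda>a z. (if snd a then q (fst a) else inv\<^bsub>G\<^esub> q (fst a)) \<otimes>\<^bsub>G\<^esub> z) w \<one>\<^bsub>G\<^esub>"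

context group
begin

lemma eval_word_closed:
  assumes "q \<in> X \<rightarrow> carrier G" "fst ` set w \<subseteq> X"
  shows "eval_word G q w \<in> carrier G"
  using assms(2) by (induction w) (use assms(1) in \<open>auto simp: eval_word_def Pi_iff\<close>)

lemma eval_word_push:
  assumes q: "q \<in> X \<rightarrow> carrier G" and "fst a \<in> X" "fst ` set w \<subseteq> X"
  shows "eval_word G q (push a w) = (if snd a then q (fst a) else inv q (fst a)) \<otimes> eval_word G q w"
proof (cases "w \<noteq> [] \<and> hd w = inv_letter a")
  case True
  then obtain v where v: "w = inv_letter a # v" by (cases w) auto
  have "eval_word G q v \<in> carrier G" using eval_word_closed[OF q] assms(3) v by simp
  moreover have "q (fst a) \<in> carrier G" using q assms(2) by auto
  moreover have "push a w = v" by (simp add: push_def v)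
  ultimately show ?thesis
    by (simp add: v eval_word_def inv_letter_def m_assoc[symmetric])
next
  case False
  then have "push a w = a # w" by (auto simp: push_def)
  then show ?thesis by (simp add: eval_word_def)
qed

lemma eval_word_hom:
  assumes q: "q \<in> X \<rightarrow> carrier G"
  shows "eval_word G q \<in> hom (free_group X) G"
proof (rule homI)
  show "eval_word G q w \<in> carrier G" if "w \<in> carrier (free_group X)" for w
    using that eval_word_closed[OF q] by simp
  show "eval_word G q (v \<otimes>\<^bsub>free_group X\<^esub> w) = eval_word G q v \<otimes> eval_word G q w"
    if "v \<in> carrier (free_group X)" and w: "w \<in> carrier (free_group X)" for v w
  proof -
    have "fst ` set v \<subseteq> X" using that by simp
    then show ?thesis
    proof (induction v)
      case Nil
      then show ?case using w eval_word_closed[OF q] by (simp add: eval_word_def[of G q "[]"])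
    next
      case (Cons a v)
      have X: "fst ` set (foldr push v w) \<subseteq> X"
        by (rule order_trans[OF fst_letters_foldr_push]) (use Cons.prems w in simp)
      have a: "(if snd a then q (fst a) else inv q (fst a)) \<in> carrier G" using q Cons.prems by auto
      have "eval_word G q ((a # v) \<otimes>\<^bsub>free_group X\<^esub> w)
          = (if snd a then q (fst a) else inv q (fst a)) \<otimes> eval_word G q (foldr push v w)"
        using eval_word_push[OF q _ X] Cons.prems by simp
      also have "\<dots> = (if snd a then q (fst a) else inv q (fst a)) \<otimes> (eval_word G q v \<otimes> eval_word G q w)"
        using Cons by simp
      also have "\<dots> = eval_word G q (a # v) \<otimes> eval_word G q w"
        using a eval_word_closed[OF q] Cons.prems w by (simp add: eval_word_def m_assoc)
      finally show ?case .
    qed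
  qed
qed

lemma eval_word_letter:
  assumes "q x \<in> carrier G"
  shows "eval_word G q [(x, True)] = q x"
  using assms by (simp add: eval_word_def)

lemma finite_index_normal_Int:
  assumes "N \<in> finite_index_normal G" "M \<in> finite_index_normal G"
  shows "N \<inter> M \<in> finite_index_normal G"
proof -
  have N: "N \<lhd> G" and M: "M \<lhd> G" and fin: "finite (rcosets N)" "finite (rcosets M)"
    using assms by (auto simp: finite_index_normal_def FactGroup_def)
  have sub: "N \<subseteq> carrier G" "M \<subseteq> carrier G"
    using N M by (auto simp: normal_def subgroup.subset)
  have NM: "N \<inter> M \<lhd> G"
    using N M subgroups_Inter_pair unfolding normal_inv_iff by auto
  have "rcosets (N \<inter> M) \<subseteq> (\<lambda>(A, B). A \<inter> B) ` ((rcosets N) \<times> (rcosets M))"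
  proof
    fix A assume "A \<in> rcosets (N \<inter> M)"
    then obtain x where x: "x \<in> carrier G" "A = (N \<inter> M) #> x" by (auto simp: RCOSETS_def)
    have "(N \<inter> M) #> x = (N #> x) \<inter> (M #> x)"
      using x(1) sub by (auto simp: r_coset_def subset_iff)
    then show "A \<in> (\<lambda>(A, B). A \<inter> B) ` ((rcosets N) \<times> (rcosets M))"
      using x by (auto simp: RCOSETS_def)
  qed
  then have "finite (rcosets (N \<inter> M))"
    using fin by (meson finite_SigmaI finite_imageI finite_subset)
  then show ?thesis using NM by (simp add: finite_index_normal_def FactGroup_def)
qed

lemma carrier_finite_index_normal: "carrier G \<in> finite_index_normal G"
proof -
  have n: "carrier G \<lhd> G"
    unfolding normal_inv_iff by (auto simp: subgroup_self)
  have "rcosets (carrier G) \<subseteq> {carrier G}"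
    using subgroup.subset[OF subgroup_self] coset_join2[OF _ subgroup_self] by (auto simp: RCOSETS_def)
  then have "finite (rcosets (carrier G))" by (rule finite_subset) simp
  then show ?thesis using n by (simp add: finite_index_normal_def FactGroup_def)
qed

text \<open>Directedness of the index set of the completion; it lets one coordinate control the
  finitely many coordinates that a basic open set restricts.\<close>

lemma finite_index_normal_INT:
  assumes "finite J" "\<And>j. j \<in> J \<Longrightarrow> f j \<in> finite_index_normal G"
  shows "\<exists>N\<in>finite_index_normal G. \<forall>j\<in>J. N \<subseteq> f j"
  using assms
proof (induction J rule: finite_induct)
  case empty
  then show ?case using carrier_finite_index_normal by blast
next
  case (insert j J)
  then obtain N where "N \<in> finite_index_normal G" "\<forall>j\<in>J. N \<subseteq> f j" by blast
  then show ?case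
    using insert finite_index_normal_Int[of N "f j"] by (intro bexI[of _ "N \<inter> f j"]) auto
qed

end

section \<open>Profinite completions\<close>

lemma openin_preimage_discrete:
  "continuous_map X (discrete_topology U) f \<Longrightarrow> openin X {x \<in> topspace X. f x \<in> V}"
proof -
  assume f: "continuous_map X (discrete_topology U) f"
  have "openin X {x \<in> topspace X. f x \<in> U \<inter> V}"
    using openin_continuous_map_preimage[OF f, of "U \<inter> V"] by simp
  moreover have "{x \<in> topspace X. f x \<in> U \<inter> V} = {x \<in> topspace X. f x \<in> V}"
    using continuous_map_image_subset_topspace[OF f] by auto
  ultimately show "openin X {x \<in> topspace X. f x \<in> V}" by simp
qed

locale completed_group = group
begin

abbreviation (input) I where "I \<equiv> finite_index_normal G"
abbreviation (input) P where "P \<equiv> profinite_completion G"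
abbreviation (input) PT where "PT \<equiv> profinite_completion_topology G"

lemma I_normal: "N \<in> I \<Longrightarrow> N \<lhd> G"
  by (simp add: finite_index_normal_def)

lemma group_Mod: "N \<in> I \<Longrightarrow> group (G Mod N)"
  by (simp add: I_normal normal.factorgroup_is_group)

lemma carrier_P: "c \<in> carrier P \<longleftrightarrow> c \<in> (\<Pi>\<^sub>E N\<in>I. carrier (G Mod N)) \<and>
    (\<forall>N\<in>I. \<forall>M\<in>I. N \<subseteq> M \<longrightarrow> c N \<subseteq> c M)"
  by (simp add: profinite_completion_def)

lemma P_coord: "c \<in> carrier P \<Longrightarrow> N \<in> I \<Longrightarrow> c N \<in> carrier (G Mod N)"
  by (auto simp: carrier_P PiE_iff)

lemma P_mono: "c \<in> carrier P \<Longrightarrow> N \<in> I \<Longrightarrow> M \<in> I \<Longrightarrow> N \<subseteq> M \<Longrightarrow> c N \<subseteq> c M"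
  by (simp add: carrier_P)

lemma mult_P: "c \<otimes>\<^bsub>P\<^esub> d = (\<lambda>N\<in>I. c N \<otimes>\<^bsub>G Mod N\<^esub> d N)"
  and one_P: "\<one>\<^bsub>P\<^esub> = (\<lambda>N\<in>I. \<one>\<^bsub>G Mod N\<^esub>)"
  by (simp_all add: profinite_completion_def)

lemma P_eqI:
  assumes "c \<in> carrier P" "d \<in> carrier P" "\<And>N. N \<in> I \<Longrightarrow> c N = d N"
  shows "c = d"
  using assms by (intro PiE_ext[of c I _ d]) (auto simp: carrier_P)

lemma mult_P_closed:
  assumes "c \<in> carrier P" "d \<in> carrier P"
  shows "c \<otimes>\<^bsub>P\<^esub> d \<in> carrier P"
proof -
  have "c N <#> d N \<in> carrier (G Mod N)" if "N \<in> I" for N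
    using monoid.m_closed[OF group.is_monoid[OF group_Mod[OF that]]] P_coord assms that by fastforce
  moreover have "c N <#> d N \<subseteq> c M <#> d M" if "N \<in> I" "M \<in> I" "N \<subseteq> M" for N M
    by (rule mono_set_mult) (use assms that P_mono in auto)
  ultimately show ?thesis by (simp add: carrier_P mult_P)
qed

lemma one_P_closed: "\<one>\<^bsub>P\<^esub> \<in> carrier P"
  using monoid.one_closed[OF group.is_monoid[OF group_Mod]] by (simp add: carrier_P one_P)

definition inv_P where "inv_P c = (\<lambda>N\<in>I. inv\<^bsub>G Mod N\<^esub> c N)"

lemma inv_P_closed:
  assumes "c \<in> carrier P"
  shows "inv_P c \<in> carrier P"
proof -
  have "inv\<^bsub>G Mod N\<^esub> c N \<in> carrier (G Mod N)" if "N \<in> I" for N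
    using group.inv_closed[OF group_Mod[OF that]] P_coord assms that by blast
  moreover have "inv\<^bsub>G Mod N\<^esub> c N \<subseteq> inv\<^bsub>G Mod M\<^esub> c M" if "N \<in> I" "M \<in> I" "N \<subseteq> M" for N M
    using P_mono[OF assms that] normal.inv_FactGroup[OF I_normal P_coord[OF assms]] that
    by (auto simp: SET_INV_def)
  ultimately show ?thesis by (simp add: carrier_P inv_P_def)
qed

lemma inv_P_mult:
  assumes "c \<in> carrier P"
  shows "inv_P c \<otimes>\<^bsub>P\<^esub> c = \<one>\<^bsub>P\<^esub>"
proof -
  have "inv\<^bsub>G Mod N\<^esub> c N \<otimes>\<^bsub>G Mod N\<^esub> c N = \<one>\<^bsub>G Mod N\<^esub>" if "N \<in> I" for N
    using group.l_inv[OF group_Mod[OF that]] P_coord assms that by blast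
  then show ?thesis unfolding mult_P one_P inv_P_def by (intro restrict_ext) simp
qed

lemma group_P: "group P"
proof (rule groupI)
  fix c d e assume c: "c \<in> carrier P" "d \<in> carrier P" "e \<in> carrier P"
  show "c \<otimes>\<^bsub>P\<^esub> d \<otimes>\<^bsub>P\<^esub> e = c \<otimes>\<^bsub>P\<^esub> (d \<otimes>\<^bsub>P\<^esub> e)"
    using monoid.m_assoc[OF group.is_monoid[OF group_Mod] P_coord[OF c(1)] P_coord[OF c(2)] P_coord[OF c(3)]]
    unfolding mult_P by (intro restrict_ext) simp
next
  fix c assume c: "c \<in> carrier P"
  have "\<one>\<^bsub>P\<^esub> \<otimes>\<^bsub>P\<^esub> c \<in> carrier P" using mult_P_closed one_P_closed c by blast
  then show "\<one>\<^bsub>P\<^esub> \<otimes>\<^bsub>P\<^esub> c = c"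
  proof (rule P_eqI[OF _ c])
    show "(\<one>\<^bsub>P\<^esub> \<otimes>\<^bsub>P\<^esub> c) N = c N" if "N \<in> I" for N
      using monoid.l_one[OF group.is_monoid[OF group_Mod[OF that]] P_coord[OF c that]] that
      by (simp add: mult_P one_P)
  qed
  show "\<exists>d\<in>carrier P. d \<otimes>\<^bsub>P\<^esub> c = \<one>\<^bsub>P\<^esub>" using inv_P_closed inv_P_mult c by blast
qed (use mult_P_closed one_P_closed in auto)

lemma inv_P_eq:
  assumes "c \<in> carrier P"
  shows "inv\<^bsub>P\<^esub> c = inv_P c"
  using group.inv_equality[OF group_P inv_P_mult[OF assms] assms inv_P_closed[OF assms]] .

lemma topspace_PT [simp]: "topspace PT = carrier P"
proof -
  have "carrier P \<subseteq> (\<Pi>\<^sub>E N\<in>I. carrier (G Mod N))" 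
  proof
    fix c assume "c \<in> carrier P"
    then show "c \<in> (\<Pi>\<^sub>E N\<in>I. carrier (G Mod N))" by (rule carrier_P[THEN iffD1, THEN conjunct1])
  qed
  moreover have "topspace (product_topology (\<lambda>N. discrete_topology (carrier (G Mod N))) I) =
      (\<Pi>\<^sub>E N\<in>I. carrier (G Mod N))" by simp
  ultimately show ?thesis
    unfolding profinite_completion_topology_def topspace_subtopology by (simp only: inf_absorb2)
qed

lemma continuous_coord:
  "N \<in> I \<Longrightarrow> continuous_map PT (discrete_topology (carrier (G Mod N))) (\<lambda>c. c N)"
  unfolding profinite_completion_topology_def
  by (rule continuous_map_from_subtopology)
    (rule continuous_map_product_projection[of N I "\<lambda>N. discrete_topology (carrier (G Mod N))"])

lemma continuous_into_P:
  assumes "f \<in> topspace X \<rightarrow> carrier P"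
    and "\<And>N. N \<in> I \<Longrightarrow> continuous_map X (discrete_topology (carrier (G Mod N))) (\<lambda>x. f x N)"
  shows "continuous_map X PT f"
  unfolding profinite_completion_topology_def continuous_map_in_subtopology continuous_map_componentwise
  using assms by (auto simp: carrier_P PiE_def)

lemma topological_group_P: "topological_group P PT"
proof -
  interpret P: group P by (rule group_P)
  show ?thesis
  proof
    show "topspace PT = carrier P" by simp
    show "continuous_map (prod_topology PT PT) PT (\<lambda>(x, y). x \<otimes>\<^bsub>P\<^esub> y)"
    proof (rule continuous_into_P)
      show "(\<lambda>(x, y). x \<otimes>\<^bsub>P\<^esub> y) \<in> topspace (prod_topology PT PT) \<rightarrow> carrier P"
        using mult_P_closed by (simp add: Pi_iff)
      fix N assume N: "N \<in> I"
      let ?D = "discrete_topology (carrier (G Mod N))"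
      interpret Q: group "G Mod N" by (rule group_Mod[OF N])
      have "continuous_map (prod_topology PT PT) (prod_topology ?D ?D) (\<lambda>z. (fst z N, snd z N))"
        using continuous_map_compose[OF continuous_map_fst continuous_coord[OF N], of PT]
          continuous_map_compose[OF continuous_map_snd continuous_coord[OF N], of PT]
        by (intro continuous_map_pairedI) (simp_all add: o_def)
      moreover have "continuous_map (prod_topology ?D ?D) ?D (\<lambda>(x, y). x \<otimes>\<^bsub>G Mod N\<^esub> y)"
        unfolding prod_topology_discrete_topology[symmetric] continuous_map_from_discrete_topology
        using Q.m_closed by (auto simp del: mult_FactGroup)
      ultimately have "continuous_map (prod_topology PT PT) ?D
          ((\<lambda>(x, y). x \<otimes>\<^bsub>G Mod N\<^esub> y) \<circ> (\<lambda>z. (fst z N, snd z N)))"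
        by (rule continuous_map_compose)
      then show "continuous_map (prod_topology PT PT) ?D (\<lambda>z. (case z of (x, y) \<Rightarrow> x \<otimes>\<^bsub>P\<^esub> y) N)"
        by (rule continuous_map_eq) (simp add: mult_P N case_prod_beta)
    qed
    show "continuous_map PT PT (\<lambda>x. inv\<^bsub>P\<^esub> x)"
    proof (rule continuous_into_P)
      fix N assume N: "N \<in> I"
      let ?D = "discrete_topology (carrier (G Mod N))"
      interpret Q: group "G Mod N" by (rule group_Mod[OF N])
      have "continuous_map ?D ?D (m_inv (G Mod N))"
        unfolding continuous_map_from_discrete_topology using Q.inv_closed by simp
      then have "continuous_map PT ?D (m_inv (G Mod N) \<circ> (\<lambda>c. c N))"
        by (rule continuous_map_compose[OF continuous_coord[OF N]])
      then show "continuous_map PT ?D (\<lambda>x. (inv\<^bsub>P\<^esub> x) N)"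
        by (rule continuous_map_eq) (simp add: inv_P_eq inv_P_def N)
    qed simp
  qed
qed

lemma completion_map_hom: "completion_map G \<in> hom G P"
proof (rule homI)
  fix x assume x: "x \<in> carrier G"
  show "completion_map G x \<in> carrier P"
    using x by (auto simp: carrier_P completion_map_def FactGroup_def RCOSETS_def r_coset_def)
  fix y assume y: "y \<in> carrier G"
  show "completion_map G (x \<otimes> y) = completion_map G x \<otimes>\<^bsub>P\<^esub> completion_map G y"
    using normal.rcos_sum[OF I_normal x y] unfolding completion_map_def mult_P
    by (intro restrict_ext) simp
qed

text \<open>A basic open set restricts finitely many coordinates, and all of these are determined by
  the coordinate at one smaller \<open>N\<close>. A representative of that coset lies in the
  set.\<close>

lemma dense_completion:
  assumes "openin PT U" "U \<noteq> {}"
  shows "\<exists>x\<in>carrier G. completion_map G x \<in> U"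
proof -
  let ?D = "\<lambda>N. discrete_topology (carrier (G Mod N))"
  obtain V where V: "openin (product_topology ?D I) V" "U = V \<inter> carrier P"
    using assms(1) unfolding profinite_completion_topology_def openin_subtopology by blast
  obtain c where c: "c \<in> V" "c \<in> carrier P" using assms(2) V(2) by blast
  obtain B where B: "finite {N \<in> I. B N \<noteq> topspace (?D N)}" "\<forall>N\<in>I. openin (?D N) (B N)"
    "c \<in> Pi\<^sub>E I B" "Pi\<^sub>E I B \<subseteq> V"
    using V(1)[unfolded openin_product_topology_alt, rule_format, OF c(1)]
    by (elim exE conjE) (rule that)
  have "\<exists>N\<in>I. \<forall>M\<in>{N \<in> I. B N \<noteq> topspace (?D N)}. N \<subseteq> M"
    by (rule finite_index_normal_INT[OF B(1)]) simp
  then obtain N where N: "N \<in> I" "\<forall>M\<in>{N \<in> I. B N \<noteq> topspace (?D N)}. N \<subseteq> M" ..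
  obtain x where x: "x \<in> carrier G" "c N = N #> x"
    using P_coord[OF c(2) N(1)] by (auto simp: FactGroup_def RCOSETS_def)
  have cx: "completion_map G x \<in> carrier P" using completion_map_hom x(1) by (auto simp: hom_def)
  have "completion_map G x M \<in> B M" if M: "M \<in> I" for M
  proof (cases "B M = topspace (?D M)")
    case True
    then show ?thesis using P_coord[OF cx M] by simp
  next
    case False
    then have "N \<subseteq> M" using N(2) M by blast
    then have "N #> x \<subseteq> c M" using P_mono[OF c(2) N(1) M] x(2) by simp
    moreover have "x \<in> N #> x"
      using rcos_self[OF x(1)] I_normal[OF N(1)] by (simp add: normal_def)
    ultimately have "x \<in> c M" by (rule subsetD)
    moreover obtain z where z: "z \<in> carrier G" "c M = M #> z"
      using P_coord[OF c(2) M] by (auto simp: FactGroup_def RCOSETS_def)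
    moreover have "subgroup M G" using I_normal[OF M] by (simp add: normal_def)
    ultimately have "c M = M #> x" using repr_independence[of x M z] by simp
    moreover have "c M \<in> B M" using PiE_mem[OF B(3) M] .
    ultimately show ?thesis using M by (simp add: completion_map_def)
  qed
  then have "completion_map G x \<in> Pi\<^sub>E I B" by (simp add: PiE_iff completion_map_def)
  then have "completion_map G x \<in> U" using B(4) V(2) cx by blast
  then show ?thesis using x(1) by blast
qed

text \<open>The extension reads the single coordinate at the kernel of \<open>h\<close> and applies
  the induced injection of that quotient into \<open>Q\<close>; a single coordinate is continuous,
  which makes the kernel open.\<close>

lemma completion_hom_extension:
  assumes Q: "group Q" "finite (carrier Q)" and h: "h \<in> hom G Q"
  obtains \<psi> where "\<psi> \<in> hom P Q" "\<And>x. x \<in> carrier G \<Longrightarrow> \<psi> (completion_map G x) = h x"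
    "openin PT (kernel P Q \<psi>)"
proof -
  interpret h: group_hom G Q h
    using h Q(1) by (simp add: group_hom_def group_hom_axioms_def group_axioms)
  let ?K = "kernel G Q h"
  let ?t = "\<lambda>X. the_elem (h ` X)"
  interpret K: normal ?K G by (rule h.normal_kernel)
  have "?t ` carrier (G Mod ?K) \<subseteq> carrier Q"
    using hom_in_carrier[OF h.FactGroup_hom] by (rule image_subsetI)
  then have "finite (?t ` carrier (G Mod ?K))" using Q(2) by (rule finite_subset)
  then have "finite (carrier (G Mod ?K))" by (rule finite_imageD[OF _ h.FactGroup_inj_on])
  then have K: "?K \<in> I" using h.normal_kernel by (simp add: finite_index_normal_def)
  define \<psi> where "\<psi> c = ?t (c ?K)" for c :: "'a set \<Rightarrow> 'a set"
  have hom: "\<psi> \<in> hom P Q"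
  proof (rule homI)
    fix c assume c: "c \<in> carrier P"
    show "\<psi> c \<in> carrier Q" 
      unfolding \<psi>_def by (rule hom_in_carrier[OF h.FactGroup_hom P_coord[OF c K]])
    fix d assume d: "d \<in> carrier P"
    show "\<psi> (c \<otimes>\<^bsub>P\<^esub> d) = \<psi> c \<otimes>\<^bsub>Q\<^esub> \<psi> d"
      using hom_mult[OF h.FactGroup_hom P_coord[OF c K] P_coord[OF d K]] K by (simp add: \<psi>_def mult_P)
  qed
  moreover have "\<psi> (completion_map G x) = h x" if x: "x \<in> carrier G" for x
  proof -
    have 1: "h z = h x" if z: "z \<in> ?K #> x" for z
    proof -
      obtain k where k: "k \<in> ?K" "z = k \<otimes> x" using z by (auto simp: r_coset_def)
      then have "k \<in> carrier G" "h k = \<one>\<^bsub>Q\<^esub>" unfolding kernel_def by blast+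
      then show ?thesis using k(2) x by simp
    qed
    have "x \<in> ?K #> x" by (rule rcos_self[OF x K.subgroup_axioms])
    then have "?K #> x \<noteq> {}" by blast
    then have t: "?t (?K #> x) = h x"
      by (rule the_elem_image_unique[of "?K #> x" h "h x"]) (rule 1)
    have m: "completion_map G x ?K = ?K #> x"
      unfolding completion_map_def by (rule restrict_apply'[OF K])
    have "\<psi> (completion_map G x) = ?t (completion_map G x ?K)" by (rule \<psi>_def)
    also have "\<dots> = h x" unfolding m by (rule t)
    finally show ?thesis .
  qed
  moreover have "openin PT (kernel P Q \<psi>)"
  proof -
    have "kernel P Q \<psi> = {c \<in> topspace PT. c ?K \<in> {A. ?t A = \<one>\<^bsub>Q\<^esub>}}"
      unfolding kernel_def[of P Q \<psi>] topspace_PT mem_Collect_eq \<psi>_def by (rule refl)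
    then show ?thesis
      by (rule ssubst) (rule openin_preimage_discrete[OF continuous_coord[OF K]])
  qed
  ultimately show ?thesis by (rule that[of \<psi>])
qed

end

section \<open>Profinite presentations\<close>

lemma group_free_profinite: "group (free_profinite X)"
  and topological_group_free_profinite: "topological_group (free_profinite X) (free_profinite_topology X)"
proof -
  interpret completed_group "free_group X"
    by (simp add: completed_group_def group_free_group)
  show "group (free_profinite X)" unfolding free_profinite_def by (rule group_P)
  show "topological_group (free_profinite X) (free_profinite_topology X)"
    unfolding free_profinite_def free_profinite_topology_def by (rule topological_group_P)
qed

lemma free_gen_closed: "x \<in> X \<Longrightarrow> free_gen X x \<in> carrier (free_profinite X)"
proof -
  assume x: "x \<in> X"
  interpret completed_group "free_group X"
    by (simp add: completed_group_def group_free_group)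
  show ?thesis
    unfolding free_gen_def free_profinite_def
    by (rule hom_in_carrier[OF completion_map_hom]) (use x in \<open>simp add: reduced_word_Cons\<close>)
qed

lemma free_profinite_hom:
  assumes "group Q" "finite (carrier Q)" "q \<in> X \<rightarrow> carrier Q"
  obtains \<psi> where "\<psi> \<in> hom (free_profinite X) Q" "\<forall>x\<in>X. \<psi> (free_gen X x) = q x"
    "openin (free_profinite_topology X) (kernel (free_profinite X) Q \<psi>)"
proof -
  interpret completed_group "free_group X"
    by (simp add: completed_group_def group_free_group)
  interpret Q: group Q by fact
  obtain \<psi> where \<psi>: "\<psi> \<in> hom (free_profinite X) Q"
    "\<And>w. w \<in> carrier (free_group X) \<Longrightarrow> \<psi> (completion_map (free_group X) w) = eval_word Q q w"
    "openin (free_profinite_topology X) (kernel (free_profinite X) Q \<psi>)"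
    using completion_hom_extension[OF assms(1,2) Q.eval_word_hom[OF assms(3)]]
    unfolding free_profinite_def free_profinite_topology_def by blast
  have "\<psi> (free_gen X x) = q x" if "x \<in> X" for x
  proof -
    have "[(x, True)] \<in> carrier (free_group X)" using that by (simp add: reduced_word_Cons)
    then show ?thesis
      using \<psi>(2) Q.eval_word_letter[of q x] assms(3) that by (auto simp: free_gen_def)
  qed
  then have "\<forall>x\<in>X. \<psi> (free_gen X x) = q x" by (rule ballI)
  then show ?thesis by (rule that[OF \<psi>(1) _ \<psi>(3)])
qed

lemma (in group) normal_Inter:
  assumes "\<N> \<noteq> {}" "\<And>N. N \<in> \<N> \<Longrightarrow> N \<lhd> G"
  shows "\<Inter>\<N> \<lhd> G"
proof -
  have "subgroup (\<Inter>\<N>) G"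
    by (rule subgroups_Inter) (use assms in \<open>auto simp: normal_inv_iff\<close>)
  then show ?thesis
    unfolding normal_inv_iff using assms by (auto simp: normal_inv_iff)
qed

lemma (in topological_group) normal_closed_normal_closure:
  assumes "R \<subseteq> carrier G"
  shows "closed_normal_closure G T R \<lhd> G"
proof -
  have "carrier G \<lhd> G" by (auto simp: normal_inv_iff subgroup_self)
  moreover have "closedin T (carrier G)" using topspace_eq by (metis closedin_topspace)
  ultimately have "\<Inter>{N. N \<lhd> G \<and> closedin T N \<and> R \<subseteq> N} \<lhd> G"
    using assms by (intro normal_Inter) auto
  then show ?thesis unfolding closed_normal_closure_def .
qed

lemma (in topological_group) openin_translate:
  assumes "openin T U" "a \<in> carrier G"
  shows "openin T {x \<in> carrier G. a \<otimes> x \<in> U}" "openin T {x \<in> carrier G. x \<otimes> a \<in> U}"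
proof -
  have a: "continuous_map T T (\<lambda>x. a)" using assms(2) topspace_eq by simp
  have id: "continuous_map T T (\<lambda>x. x)" by (rule continuous_map_id[unfolded id_def])
  have "continuous_map T T ((\<lambda>(x, y). x \<otimes> y) \<circ> (\<lambda>x. (a, x)))"
    by (rule continuous_map_compose[OF continuous_map_pairedI[OF a id] continuous_mult])
  from openin_continuous_map_preimage[OF this assms(1)]
  show "openin T {x \<in> carrier G. a \<otimes> x \<in> U}" by (simp add: topspace_eq)
  have "continuous_map T T ((\<lambda>(x, y). x \<otimes> y) \<circ> (\<lambda>x. (x, a)))"
    by (rule continuous_map_compose[OF continuous_map_pairedI[OF id a] continuous_mult])
  from openin_continuous_map_preimage[OF this assms(1)]
  show "openin T {x \<in> carrier G. x \<otimes> a \<in> U}" by (simp add: topspace_eq)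
qed

lemma (in topological_group) openin_supergroup:
  assumes "\<one> \<in> U" "openin T U" "subgroup H G" "U \<subseteq> H"
  shows "openin T H"
proof (subst openin_subopen, intro ballI)
  fix h assume h: "h \<in> H"
  have hG: "h \<in> carrier G" using h assms(3) subgroup.subset by blast
  let ?V = "{x \<in> carrier G. inv h \<otimes> x \<in> U}"
  have "openin T ?V" using openin_translate(1)[OF assms(2)] hG by simp
  moreover have "h \<in> ?V" using hG assms(1) by simp
  moreover have "x \<in> H" if "x \<in> carrier G" "inv h \<otimes> x \<in> U" for x
  proof -
    have "h \<otimes> (inv h \<otimes> x) \<in> H"
      by (rule subgroup.m_closed[OF assms(3) h]) (use that(2) assms(4) in blast)
    then show ?thesis using that hG by (simp add: m_assoc[symmetric])
  qed
  ultimately show "\<exists>V. openin T V \<and> h \<in> V \<and> V \<subseteq> H" by blast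
qed

lemma (in topological_group) closedin_open_subgroup:
  assumes "subgroup U G" "openin T U"
  shows "closedin T U"
proof -
  have "openin T (carrier G - U)"
  proof (subst openin_subopen, intro ballI)
    fix x assume x: "x \<in> carrier G - U"
    let ?V = "{z \<in> carrier G. inv x \<otimes> z \<in> U}"
    have "openin T ?V" using openin_translate(1)[OF assms(2)] x by simp
    moreover have "x \<in> ?V" using x subgroup.one_closed[OF assms(1)] by simp
    moreover have "z \<notin> U" if "z \<in> carrier G" "inv x \<otimes> z \<in> U" for z
    proof
      assume "z \<in> U"
      then have "z \<otimes> inv (inv x \<otimes> z) \<in> U"
        using that assms(1) by (simp add: subgroup.m_closed subgroup.m_inv_closed)
      then show False using x that(1) by (simp add: inv_mult_group m_assoc[symmetric])
    qed
    ultimately show "\<exists>V. openin T V \<and> x \<in> V \<and> V \<subseteq> carrier G - U" by blast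
  qed
  then show ?thesis
    using subgroup.subset[OF assms(1)] by (simp add: closedin_def topspace_eq)
qed

lemma image_Collect_vimage: "f ` A = B \<Longrightarrow> V \<subseteq> B \<Longrightarrow> f ` {a \<in> A. f a \<in> V} = V"
  by auto

locale profinite_presentation = profinite_group G T for G (structure) and T +
  fixes X :: "'x set" and R :: "'x profinite_word set" and \<phi>
  assumes iso: "\<phi> \<in> top_iso (free_profinite X Mod closed_normal_closure (free_profinite X) (free_profinite_topology X) R)
      (quotient_topology (free_profinite X) (free_profinite_topology X)
        (closed_normal_closure (free_profinite X) (free_profinite_topology X) R)) G T"
    and R_closed: "R \<subseteq> carrier (free_profinite X)"
begin

abbreviation (input) F where "F \<equiv> free_profinite X"
abbreviation (input) S where "S \<equiv> free_profinite_topology X"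
abbreviation (input) K where "K \<equiv> closed_normal_closure F S R"

sublocale F: topological_group F S by (rule topological_group_free_profinite)

sublocale K: normal K F
  by (rule F.normal_closed_normal_closure[OF R_closed])

definition pr where "pr c = \<phi> (K #>\<^bsub>F\<^esub> c)"

definition gen where "gen x = pr (free_gen X x)"

lemma \<phi>_iso: "\<phi> \<in> iso (F Mod K) G" and \<phi>_homeo: "homeomorphic_map (quotient_topology F S K) T \<phi>"
  using iso by (auto simp: top_iso_def)

lemma pr_hom: "pr \<in> hom F G"
proof -
  have "\<phi> \<circ> (\<lambda>c. K #>\<^bsub>F\<^esub> c) \<in> hom F G"
    by (rule Group.hom_compose[OF K.r_coset_hom_Mod]) (use \<phi>_iso in \<open>simp add: iso_def\<close>)
  then show ?thesis by (simp add: pr_def[abs_def] o_def)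
qed

lemma pr_closed: "c \<in> carrier F \<Longrightarrow> pr c \<in> carrier G"
  by (rule hom_in_carrier[OF pr_hom])

lemma gen_closed: "x \<in> X \<Longrightarrow> gen x \<in> carrier G"
  unfolding gen_def by (rule pr_closed[OF free_gen_closed])

text \<open>\<open>pr\<close> is a quotient map, so openness in \<open>G\<close> can be tested in
  the free profinite group.\<close>

lemma openin_pr:
  assumes "V \<subseteq> carrier G"
  shows "openin T V \<longleftrightarrow> openin S {c \<in> carrier F. pr c \<in> V}"
proof -
  let ?Q = "quotient_topology F S K"
  have Q: "openin ?Q U \<longleftrightarrow> U \<subseteq> carrier (F Mod K) \<and> openin S (\<Union>U)" for U
    by (rule F.openin_quotient_topology[OF K.normal_axioms])
  have un: "\<Union>(carrier (F Mod K)) = carrier F"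
    using F.rcosets_part_G[OF K.subgroup_axioms] by (simp add: FactGroup_def)
  have "openin ?Q (carrier (F Mod K))"
    unfolding Q un using F.topspace_eq by (metis openin_topspace subset_refl)
  then have top: "topspace ?Q = carrier (F Mod K)"
    using Q openin_subset openin_topspace by (metis subset_antisym)
  define W where "W = {A \<in> carrier (F Mod K). \<phi> A \<in> V}"
  have "\<phi> ` carrier (F Mod K) = carrier G" using \<phi>_iso by (auto simp: iso_def bij_betw_def)
  from image_Collect_vimage[OF this assms] have W: "\<phi> ` W = V" unfolding W_def .
  have sub: "W \<subseteq> carrier (F Mod K)" unfolding W_def by blast
  have "openin T V \<longleftrightarrow> openin ?Q W"
    unfolding homeomorphic_map_openness_eq[OF \<phi>_homeo, of W] W top using sub by simp
  also have "\<dots> \<longleftrightarrow> openin S (\<Union>W)" unfolding Q using sub by simp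
  also have "\<Union>W = {c \<in> carrier F. pr c \<in> V}"
  proof
    show "\<Union>W \<subseteq> {c \<in> carrier F. pr c \<in> V}"
    proof
      fix c assume "c \<in> \<Union>W"
      then obtain A where A: "A \<in> carrier (F Mod K)" "\<phi> A \<in> V" "c \<in> A" unfolding W_def by blast
      then obtain a where a: "a \<in> carrier F" "A = K #>\<^bsub>F\<^esub> a"
        unfolding FactGroup_def RCOSETS_def by auto
      have c: "c \<in> carrier F" using A(1,3) un by blast
      have "A = K #>\<^bsub>F\<^esub> c"
        unfolding a(2) by (rule F.repr_independence[OF _ a(1) K.subgroup_axioms]) (use A(3) a(2) in simp)
      then show "c \<in> {c \<in> carrier F. pr c \<in> V}" using c A(2) by (simp add: pr_def)
    qed
    show "{c \<in> carrier F. pr c \<in> V} \<subseteq> \<Union>W"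
    proof
      fix c assume c: "c \<in> {c \<in> carrier F. pr c \<in> V}"
      then have "K #>\<^bsub>F\<^esub> c \<in> W" unfolding W_def FactGroup_def RCOSETS_def pr_def by auto
      moreover have "c \<in> K #>\<^bsub>F\<^esub> c" using c by (intro F.rcos_self[OF _ K.subgroup_axioms]) simp
      ultimately show "c \<in> \<Union>W" by (rule UnionI)
    qed
  qed
  finally show ?thesis .
qed

lemma pr_surj:
  assumes "d \<in> carrier G"
  obtains c where "c \<in> carrier F" "pr c = d"
proof -
  have "\<phi> ` carrier (F Mod K) = carrier G" using \<phi>_iso by (auto simp: iso_def bij_betw_def)
  with assms have "d \<in> \<phi> ` carrier (F Mod K)" by (simp only:)
  then obtain A where A: "d = \<phi> A" "A \<in> carrier (F Mod K)" by (rule imageE)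
  then obtain c where c: "c \<in> carrier F" "A = K #>\<^bsub>F\<^esub> c"
    unfolding FactGroup_def RCOSETS_def by auto
  show ?thesis by (rule that[OF c(1)]) (simp only: A(1) c(2) pr_def)
qed

lemma pr_relator:
  assumes "c \<in> R"
  shows "pr c = \<one>"
proof -
  interpret pr: group_hom F G pr
    using pr_hom by (simp add: group_hom_def group_hom_axioms_def F.group_axioms group_axioms)
  have "c \<in> K" using assms by (auto simp: closed_normal_closure_def)
  then have "K #>\<^bsub>F\<^esub> c = K #>\<^bsub>F\<^esub> \<one>\<^bsub>F\<^esub>"
    using F.coset_join2[OF K.mem_carrier K.subgroup_axioms] F.coset_mult_one[OF K.subset] by simp
  then have "pr c = pr \<one>\<^bsub>F\<^esub>" by (simp add: pr_def)
  then show ?thesis by simp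
qed

text \<open>The extension to the free profinite group is known only to exist, so \<open>rel\<close>
  speaks of every \<open>f\<close> with the prescribed values. Its kernel is open, hence closed, and
  contains the closed normal closure once it contains \<open>R\<close>.\<close>

lemma hom_extension:
  assumes Q: "group Q" "finite (carrier Q)" "q \<in> X \<rightarrow> carrier Q"
    and rel: "\<And>f c. f \<in> hom F Q \<Longrightarrow> \<forall>x\<in>X. f (free_gen X x) = q x \<Longrightarrow> c \<in> R \<Longrightarrow> f c = \<one>\<^bsub>Q\<^esub>"
  obtains \<Psi> where "\<Psi> \<in> hom G Q" "\<forall>x\<in>X. \<Psi> (gen x) = q x" "openin T (kernel G Q \<Psi>)"
proof -
  interpret Q: group Q by fact
  obtain \<psi> where \<psi>: "\<psi> \<in> hom F Q" "\<forall>x\<in>X. \<psi> (free_gen X x) = q x"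
    "openin S (kernel F Q \<psi>)"
    by (rule free_profinite_hom[OF Q]) (rule that)
  interpret \<psi>: group_hom F Q \<psi>
    using \<psi>(1) by (simp add: group_hom_def group_hom_axioms_def F.group_axioms Q.group_axioms)
  have ker_closed: "closedin S (kernel F Q \<psi>)"
    by (rule F.closedin_open_subgroup[OF \<psi>.subgroup_kernel \<psi>(3)])
  have R_ker: "R \<subseteq> kernel F Q \<psi>"
  proof
    fix c assume "c \<in> R"
    with rel[OF \<psi>(1,2) this] R_closed show "c \<in> kernel F Q \<psi>" unfolding kernel_def by blast
  qed
  have "K \<subseteq> kernel F Q \<psi>"
    unfolding closed_normal_closure_def
    by (rule Inter_lower) (simp only: mem_Collect_eq R_ker ker_closed \<psi>.normal_kernel simp_thms)
  then obtain g where g: "g \<in> hom (F Mod K) Q" "\<And>c. c \<in> carrier F \<Longrightarrow> \<psi> c = g (K #>\<^bsub>F\<^esub> c)"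
    using \<psi>.FactGroup_universal_kernel[OF K.normal_axioms] by metis
  let ?i = "inv_into (carrier (F Mod K)) \<phi>"
  have "?i \<in> hom G (F Mod K)"
    using group.iso_set_sym[OF K.factorgroup_is_group \<phi>_iso] by (simp add: iso_def)
  then have \<Psi>: "g \<circ> ?i \<in> hom G Q" using g(1) by (rule Group.hom_compose)
  have pr: "(g \<circ> ?i) (pr c) = \<psi> c" if c: "c \<in> carrier F" for c
  proof -
    have "K #>\<^bsub>F\<^esub> c \<in> carrier (F Mod K)" using c unfolding FactGroup_def RCOSETS_def by auto
    moreover have "inj_on \<phi> (carrier (F Mod K))" using \<phi>_iso by (auto simp: iso_def bij_betw_def)
    ultimately have "?i (pr c) = K #>\<^bsub>F\<^esub> c" by (simp add: pr_def)
    then show ?thesis using g(2)[OF c] by simp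
  qed
  have "kernel G Q (g \<circ> ?i) \<subseteq> carrier G" by (auto simp: kernel_def)
  moreover have "{c \<in> carrier F. pr c \<in> kernel G Q (g \<circ> ?i)} = kernel F Q \<psi>"
    using pr pr_closed unfolding kernel_def by auto
  ultimately have "openin T (kernel G Q (g \<circ> ?i))" using openin_pr[of "kernel G Q (g \<circ> ?i)"] \<psi>(3) by simp
  moreover have "\<forall>x\<in>X. (g \<circ> ?i) (gen x) = q x"
    using pr[OF free_gen_closed] \<psi>(2) by (simp add: gen_def)
  ultimately show ?thesis using \<Psi> by (intro that[of "g \<circ> ?i"])
qed

text \<open>Words are dense in the free profinite group, and \<open>pr\<close> maps a word to a
  product of generators and inverses of generators.\<close>

lemma dense_generate:
  assumes "openin T V" "V \<noteq> {}"
  shows "\<exists>z\<in>generate G (gen ` X). z \<in> V"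
proof -
  interpret C: completed_group "free_group X"
    by (simp add: completed_group_def group_free_group)
  have V: "V \<subseteq> carrier G" using openin_subset[OF assms(1)] topspace_eq by simp
  let ?U = "{c \<in> carrier F. pr c \<in> V}"
  have U: "openin S ?U" using openin_pr[OF V] assms(1) by simp
  obtain v where v: "v \<in> V" using assms(2) by blast
  obtain c where "c \<in> carrier F" "pr c = v" by (rule pr_surj[of v]) (use v V in auto)
  then have "?U \<noteq> {}" using v by blast
  then obtain w where w: "w \<in> carrier (free_group X)" "completion_map (free_group X) w \<in> ?U"
    using C.dense_completion[of ?U] U unfolding free_profinite_topology_def by blast
  let ?h = "\<lambda>w. pr (completion_map (free_group X) w)"
  have h: "?h \<in> hom (free_group X) G"
    using Group.hom_compose[OF C.completion_map_hom pr_hom[unfolded free_profinite_def]]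
    by (simp add: o_def)
  interpret h: group_hom "free_group X" G ?h
    using h by (simp add: group_hom_def group_hom_axioms_def group_axioms C.group_axioms)
  have "?h w \<in> generate G (gen ` X)" using w(1)
  proof (induction w)
    case Nil
    then show ?case using h.hom_one generate.one[of G] by simp
  next
    case (Cons a w)
    have a: "[a] \<in> carrier (free_group X)" and w: "w \<in> carrier (free_group X)"
      using Cons.prems by (simp_all add: reduced_word_Cons)
    have "a # w = [a] \<otimes>\<^bsub>free_group X\<^esub> w"
      using Cons.prems push_Cons_reduced[of a w] by simp
    then have "?h (a # w) = ?h [a] \<otimes> ?h w" using h.hom_mult[OF a w] by (simp only:)
    moreover have "?h [a] \<in> generate G (gen ` X)"
    proof -
      obtain x b where x: "a = (x, b)" "x \<in> X" using a by (cases a) auto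
      have xT: "[(x, True)] \<in> carrier (free_group X)" using x by (simp add: reduced_word_Cons)
      have "?h [(x, True)] = gen x" by (simp add: gen_def free_gen_def)
      moreover have "[(x, False)] = inv\<^bsub>free_group X\<^esub> [(x, True)]"
        by (rule C.inv_equality[symmetric]) (use x in \<open>auto simp: reduced_word_Cons push_def inv_letter_def\<close>)
      ultimately have "?h [a] = gen x \<or> ?h [a] = inv (gen x)"
        using h.hom_inv[OF xT] x(1) by (cases b) auto
      moreover have "gen x \<in> gen ` X" using x(2) by (rule imageI)
      note generate.incl[OF this, of G] generate.inv[OF this, of G]
      ultimately show ?thesis by (elim disjE) (simp_all only:)
    qed
    ultimately show ?case using generate.eng[OF _ Cons.IH[OF w]] by (simp only:)
  qed
  then show ?thesis using w(2) by blast
qed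

text \<open>This takes the place of continuity arguments later on: a property that cuts out an open
  subgroup holds everywhere as soon as it holds for the generators.\<close>

lemma open_subgroup_eq_carrier:
  assumes "subgroup H G" "openin T H" "gen ` X \<subseteq> H"
  shows "H = carrier G"
proof
  show "H \<subseteq> carrier G" using assms(1) by (rule subgroup.subset)
  show "carrier G \<subseteq> H"
  proof
    fix x assume x: "x \<in> carrier G"
    have "openin T {z \<in> carrier G. inv x \<otimes> z \<in> H}" using openin_translate(1)[OF assms(2)] x by simp
    moreover have "x \<in> {z \<in> carrier G. inv x \<otimes> z \<in> H}"
      using x subgroup.one_closed[OF assms(1)] by simp
    ultimately obtain z where z: "z \<in> generate G (gen ` X)" "inv x \<otimes> z \<in> H" "z \<in> carrier G"
      using dense_generate by blast
    have "z \<in> H" using z(1) generate_subgroup_incl[OF assms(3,1)] by (rule subsetD[rotated])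
    then have "z \<otimes> inv (inv x \<otimes> z) \<in> H"
      using z(2) assms(1) by (simp add: subgroup.m_closed subgroup.m_inv_closed)
    moreover have "z \<otimes> inv (inv x \<otimes> z) = x" using x z(3) by (simp add: inv_mult_group m_assoc[symmetric])
    ultimately show "x \<in> H" by simp
  qed
qed

end

section \<open>Profinite groups\<close>

lemma (in group) mult_inv_cancel:
  assumes "a \<in> carrier G" "x \<in> carrier G"
  shows "a \<otimes> (inv a \<otimes> x) = x" "inv a \<otimes> (a \<otimes> x) = x"
  using assms by (simp_all add: m_assoc[symmetric])

context topological_group
begin

lemma openin_conjugate:
  assumes "openin T U" "a \<in> carrier G"
  shows "openin T {z \<in> carrier G. inv a \<otimes> z \<otimes> a \<in> U}"
proof -
  have "openin T {z \<in> carrier G. inv a \<otimes> z \<in> {w \<in> carrier G. w \<otimes> a \<in> U}}"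
    using openin_translate(1)[OF openin_translate(2)[OF assms]] assms(2) by simp
  moreover have "{z \<in> carrier G. inv a \<otimes> z \<in> {w \<in> carrier G. w \<otimes> a \<in> U}}
      = {z \<in> carrier G. inv a \<otimes> z \<otimes> a \<in> U}"
    using assms(2) by auto
  ultimately show ?thesis by simp
qed

lemma openin_finite_INT:
  assumes "finite I" "\<And>i. i \<in> I \<Longrightarrow> openin T (U i)"
  shows "openin T (carrier G \<inter> (\<Inter>i\<in>I. U i))"
  using assms
proof (induction I rule: finite_induct)
  case empty
  then show ?case using topspace_eq openin_topspace[of T] by simp
next
  case (insert i I)
  have "openin T (U i \<inter> (carrier G \<inter> (\<Inter>i\<in>I. U i)))"
    by (rule openin_Int) (use insert in auto)
  moreover have "U i \<inter> (carrier G \<inter> (\<Inter>i\<in>I. U i)) = carrier G \<inter> (\<Inter>i\<in>insert i I. U i)" by auto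
  ultimately show ?case by (simp only:)
qed

end

lemma (in group) subgroup_conjugate:
  assumes "subgroup U G" "a \<in> carrier G"
  shows "subgroup {z \<in> carrier G. inv a \<otimes> z \<otimes> a \<in> U} G"
proof (rule subgroupI)
  show "{z \<in> carrier G. inv a \<otimes> z \<otimes> a \<in> U} \<noteq> {}"
    using subgroup.one_closed[OF assms(1)] assms(2) by (auto intro!: exI[of _ \<one>])
next
  fix z assume z: "z \<in> {z \<in> carrier G. inv a \<otimes> z \<otimes> a \<in> U}"
  then have "inv (inv a \<otimes> z \<otimes> a) \<in> U" using subgroup.m_inv_closed[OF assms(1)] by simp
  moreover have "inv (inv a \<otimes> z \<otimes> a) = inv a \<otimes> inv z \<otimes> a"
    using z assms(2) by (simp add: inv_mult_group m_assoc)
  ultimately show "inv z \<in> {z \<in> carrier G. inv a \<otimes> z \<otimes> a \<in> U}" using z by simp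
  fix w assume w: "w \<in> {z \<in> carrier G. inv a \<otimes> z \<otimes> a \<in> U}"
  have "(inv a \<otimes> z \<otimes> a) \<otimes> (inv a \<otimes> w \<otimes> a) \<in> U"
    by (rule subgroup.m_closed[OF assms(1)]) (use z w in auto)
  moreover have "(inv a \<otimes> z \<otimes> a) \<otimes> (inv a \<otimes> w \<otimes> a) = inv a \<otimes> (z \<otimes> w) \<otimes> a"
    using z w assms(2) by (simp add: m_assoc mult_inv_cancel)
  ultimately show "z \<otimes> w \<in> {z \<in> carrier G. inv a \<otimes> z \<otimes> a \<in> U}" using z w by simp
qed auto

context profinite_group
begin

text \<open>For a clopen set \<open>C\<close>, the elements \<open>g\<close> with \<open>C g \<subseteq> C\<close> form an open set because
  the projection along the compact set \<open>C\<close> is closed.\<close>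

lemma openin_right_stabilizer:
  assumes "closedin T C" "openin T C"
  shows "openin T {g \<in> carrier G. \<forall>c\<in>C. c \<otimes> g \<in> C}"
proof -
  have C: "C \<subseteq> carrier G" using closedin_subset[OF assms(1)] topspace_eq by simp
  define W where "W = {z \<in> topspace (prod_topology T T). (case z of (x, y) \<Rightarrow> x \<otimes> y) \<in> carrier G - C}"
  have "openin T (carrier G)" using topspace_eq openin_topspace[of T] by simp
  then have "closedin T (carrier G - C)" using assms(2) topspace_eq by (simp add: closedin_def double_diff C)
  then have "closedin (prod_topology T T) W"
    unfolding W_def by (rule closedin_continuous_map_preimage[OF continuous_mult])
  moreover have "closedin (prod_topology T T) (C \<times> carrier G)"
    using assms(1) topspace_eq closedin_topspace[of T] by (simp add: closedin_prod_Times_iff)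
  ultimately have "closedin (prod_topology T T) (W \<inter> C \<times> carrier G)" by (rule closedin_Int)
  then have "closedin T (snd ` (W \<inter> C \<times> carrier G))"
    using closed_map_snd[OF compact, of T] unfolding closed_map_def by blast
  then have "openin T (topspace T - snd ` (W \<inter> C \<times> carrier G))" by (rule openin_diff[OF openin_topspace])
  moreover have "topspace T - snd ` (W \<inter> C \<times> carrier G) = {g \<in> carrier G. \<forall>c\<in>C. c \<otimes> g \<in> C}"
  proof -
    have "g \<in> snd ` (W \<inter> C \<times> carrier G) \<longleftrightarrow> (\<exists>c\<in>C. c \<otimes> g \<notin> C)" if g: "g \<in> carrier G" for g
    proof
      assume "g \<in> snd ` (W \<inter> C \<times> carrier G)"
      then show "\<exists>c\<in>C. c \<otimes> g \<notin> C" by (auto simp: W_def)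
    next
      assume "\<exists>c\<in>C. c \<otimes> g \<notin> C"
      then obtain c where c: "c \<in> C" "c \<otimes> g \<notin> C" by blast
      then have "(c, g) \<in> W \<inter> C \<times> carrier G" using g C by (auto simp: W_def topspace_eq)
      then show "g \<in> snd ` (W \<inter> C \<times> carrier G)" by (intro image_eqI[of _ _ "(c, g)"]) simp_all
    qed
    then show ?thesis by (auto simp: topspace_eq)
  qed
  ultimately show ?thesis by simp
qed

text \<open>In a compact Hausdorff space quasi-components are components, here points, so some
  clopen \<open>C\<close> separates \<one> from \<open>x\<close>. The elements that, together with
  their inverses, map \<open>C\<close> into itself by right multiplication form a subgroup inside
  \<open>C\<close>.\<close>

lemma open_subgroup_avoiding:
  assumes x: "x \<in> carrier G" "x \<noteq> \<one>"
  obtains U where "subgroup U G" "openin T U" "x \<notin> U"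
proof -
  have "\<not> connected_component_of T \<one> x"
  proof
    assume "connected_component_of T \<one> x"
    then obtain S where S: "connectedin T S" "\<one> \<in> S" "x \<in> S" by (auto simp: connected_component_of_def)
    obtain a where "S \<subseteq> {a}" using totally_disconnected[OF S(1)] by blast
    then show False using S(2,3) x(2) by blast
  qed
  moreover have "quasi_component_of T \<one> = connected_component_of T \<one>"
    by (rule quasi_eq_connected_component_of) (use compact Hausdorff in blast)
  ultimately have "\<not> quasi_component_of T \<one> x" by simp
  then obtain C where C: "\<one> \<in> C" "closedin T C" "openin T C" "x \<notin> C"
    using x(1) topspace_eq by (auto simp: quasi_component_of)
  have CG: "C \<subseteq> carrier G" using closedin_subset[OF C(2)] topspace_eq by simp
  define V where "V = {g \<in> carrier G. \<forall>c\<in>C. c \<otimes> g \<in> C}"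
  have V: "openin T V" unfolding V_def by (rule openin_right_stabilizer[OF C(2,3)])
  have V': "openin T {g \<in> carrier G. inv g \<in> V}"
    using openin_continuous_map_preimage[OF continuous_inv V] topspace_eq by simp
  define U where "U = V \<inter> {g \<in> carrier G. inv g \<in> V}"
  have "subgroup U G"
  proof (rule subgroupI)
    have "\<one> \<in> V" using CG by (auto simp: V_def)
    then show "U \<noteq> {}" by (auto simp: U_def)
    show "U \<subseteq> carrier G" by (auto simp: U_def)
    fix g assume g: "g \<in> U"
    then show "inv g \<in> U" by (auto simp: U_def V_def)
    fix h assume h: "h \<in> U"
    have VV: "a \<otimes> b \<in> V" if "a \<in> V" "b \<in> V" for a b
    proof -
      have "c \<otimes> (a \<otimes> b) \<in> C" if c: "c \<in> C" for c
      proof -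
        have "(c \<otimes> a) \<otimes> b \<in> C" using \<open>a \<in> V\<close> \<open>b \<in> V\<close> c unfolding V_def by blast
        moreover have "c \<in> carrier G" "a \<in> carrier G" "b \<in> carrier G"
          using \<open>a \<in> V\<close> \<open>b \<in> V\<close> c CG unfolding V_def by blast+
        ultimately show ?thesis by (simp add: m_assoc)
      qed
      then show ?thesis using that by (simp add: V_def)
    qed
    have g': "g \<in> carrier G" "g \<in> V" "inv g \<in> V" and h': "h \<in> carrier G" "h \<in> V" "inv h \<in> V"
      using g h by (auto simp: U_def)
    show "g \<otimes> h \<in> U"
      using VV[OF g'(2) h'(2)] VV[OF h'(3) g'(3)] g'(1) h'(1) by (simp add: U_def inv_mult_group)
  qed
  moreover have "openin T U" unfolding U_def by (rule openin_Int[OF V V'])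
  moreover have "x \<notin> U"
  proof
    assume "x \<in> U"
    then have "\<one> \<otimes> x \<in> C" using C(1) by (auto simp: U_def V_def)
    then show False using C(4) x(1) by simp
  qed
  ultimately show ?thesis by (rule that)
qed

lemma finite_left_transversal:
  assumes U: "subgroup U G" "openin T U"
  obtains A where "finite A" "A \<subseteq> carrier G" "\<And>g. g \<in> carrier G \<Longrightarrow> \<exists>a\<in>A. inv a \<otimes> g \<in> U"
proof -
  let ?V = "\<lambda>a. {z \<in> carrier G. inv a \<otimes> z \<in> U}"
  have "openin T (?V a)" if "a \<in> carrier G" for a using openin_translate(1)[OF U(2)] that by simp
  moreover have "topspace T \<subseteq> \<Union>(?V ` carrier G)"
  proof
    fix g assume "g \<in> topspace T"
    then have "g \<in> carrier G" "g \<in> ?V g" using topspace_eq subgroup.one_closed[OF U(1)] by auto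
    then show "g \<in> \<Union>(?V ` carrier G)" by blast
  qed
  ultimately obtain \<F> where \<F>: "finite \<F>" "\<F> \<subseteq> ?V ` carrier G" "topspace T \<subseteq> \<Union>\<F>"
    using compact unfolding compact_space_alt by (metis (no_types, lifting) imageE)
  obtain A where A: "A \<subseteq> carrier G" "finite A" "\<F> = ?V ` A"
    using finite_subset_image[OF \<F>(1,2)] by blast
  have "\<exists>a\<in>A. inv a \<otimes> g \<in> U" if "g \<in> carrier G" for g
  proof -
    have "g \<in> \<Union>(?V ` A)" using \<F>(3) A(3) that topspace_eq by auto
    then show ?thesis by blast
  qed
  then show ?thesis using that A(1,2) by blast
qed

end

section \<open>Homomorphisms of profinite F-groups\<close>

lemma (in group_hom) hom_commutator:
  "x \<in> carrier G \<Longrightarrow> y \<in> carrier G \<Longrightarrow> h (commutator G x y) = commutator H (h x) (h y)"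
  by (simp add: commutator_def)

lemma (in group_hom) hom_blocks_product:
  assumes "\<And>b i. b \<in> set bs \<Longrightarrow> i \<in> block_gens b \<Longrightarrow> y i \<in> carrier G"
  shows "h (blocks_product G y bs) = blocks_product H (\<lambda>i. h (y i)) bs"
  using assms
proof (induction bs)
  case Nil
  then show ?case by simp
next
  case (Cons b bs)
  have b: "\<And>i. i \<in> block_gens b \<Longrightarrow> y i \<in> carrier G"
    and bs: "\<And>b i. b \<in> set bs \<Longrightarrow> i \<in> block_gens b \<Longrightarrow> y i \<in> carrier G"
    using Cons.prems by auto
  have "h (block_value G y b) = block_value H (\<lambda>i. h (y i)) b"
    using b by (cases b) (simp_all add: block_value_def hom_commutator)
  moreover have "block_value G y b \<in> carrier G" using b by (rule G.block_value_closed)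
  moreover have "blocks_product G y bs \<in> carrier G" using bs by (rule G.blocks_product_closed)
  ultimately show ?case using Cons.IH[OF bs] by simp
qed

lemma F_gens_blocks:
  "i \<in> F_gens g r ns \<longleftrightarrow> (\<exists>b\<in>set (relator_blocks g r (length ns)). i \<in> block_gens b)"
  using block_gens_F_gens[of g r ns] by blast

lemma (in group) F_relators_closed:
  assumes "\<And>i. i \<in> F_gens g r ns \<Longrightarrow> y i \<in> carrier G"
  shows "F_relators G y g r ns \<subseteq> carrier G"
proof -
  have "y i \<in> carrier G" if "b \<in> set (relator_blocks g r (length ns))" "i \<in> block_gens b" for b i
    by (rule assms) (use that F_gens_blocks in blast)
  then have "blocks_product G y (relator_blocks g r (length ns)) \<in> carrier G"
    by (intro blocks_product_closed)
  moreover have "y (Delta l) \<in> carrier G" if "l < length ns" for l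
    by (rule assms) (use that in \<open>simp add: F_gens_def\<close>)
  ultimately show ?thesis unfolding F_relators_blocks by auto
qed

locale F_group = group G for G (structure) +
  fixes T :: "'a topology" and g r :: nat and ns :: "nat list" and
    \<phi> :: "(F_gen word set \<Rightarrow> F_gen word set) set \<Rightarrow> 'a"
  assumes presentation: "profinite_presentation G T (F_gens g r ns)
      (F_relators (free_profinite (F_gens g r ns)) (free_gen (F_gens g r ns)) g r ns) \<phi>"
    and periods: "n \<in> set ns \<Longrightarrow> n > 0"
begin

abbreviation (input) Gens where "Gens \<equiv> F_gens g r ns"
abbreviation (input) blocks where "blocks \<equiv> relator_blocks g r (length ns)"

sublocale profinite_presentation G T Gens "F_relators (free_profinite Gens) (free_gen Gens) g r ns" \<phi>
  by (rule presentation)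

lemma period_pos: "l < length ns \<Longrightarrow> ns ! l > 0"
  using periods by simp

lemma Delta_Gens: "l < length ns \<Longrightarrow> Delta l \<in> Gens"
  by (simp add: F_gens_def)

lemma finite_Gens: "finite Gens"
  by (simp add: F_gens_def)

lemma block_gens_Gens: "b \<in> set blocks \<Longrightarrow> i \<in> block_gens b \<Longrightarrow> i \<in> Gens"
  using F_gens_blocks by blast

lemma hom_relators:
  assumes f: "f \<in> hom F Q" and Q: "group Q"
  shows "f (blocks_product F (free_gen Gens) blocks) = blocks_product Q (\<lambda>i. f (free_gen Gens i)) blocks"
    and "l < length ns \<Longrightarrow>
      f (free_gen Gens (Delta l) [^]\<^bsub>F\<^esub> (ns ! l)) = f (free_gen Gens (Delta l)) [^]\<^bsub>Q\<^esub> (ns ! l)"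
proof -
  interpret f: group_hom F Q f
    using f Q by (simp add: group_hom_def group_hom_axioms_def F.group_axioms)
  show "f (blocks_product F (free_gen Gens) blocks) = blocks_product Q (\<lambda>i. f (free_gen Gens i)) blocks"
    by (rule f.hom_blocks_product) (rule free_gen_closed, rule block_gens_Gens)
  show "f (free_gen Gens (Delta l) [^]\<^bsub>F\<^esub> (ns ! l)) = f (free_gen Gens (Delta l)) [^]\<^bsub>Q\<^esub> (ns ! l)"
    if "l < length ns"
    by (rule f.hom_nat_pow) (rule free_gen_closed, rule Delta_Gens[OF that])
qed

lemma relation_blocks: "blocks_product G gen blocks = \<one>"
  and relation_Delta: "l < length ns \<Longrightarrow> gen (Delta l) [^] (ns ! l) = \<one>"
proof -
  have gen: "(\<lambda>i. pr (free_gen Gens i)) = gen" by (simp add: gen_def[abs_def])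
  have "pr (blocks_product F (free_gen Gens) blocks) = \<one>"
    by (rule pr_relator) (simp add: F_relators_blocks)
  then show "blocks_product G gen blocks = \<one>"
    using hom_relators(1)[OF pr_hom group_axioms] unfolding gen by (simp only:)
  assume l: "l < length ns"
  have "pr (free_gen Gens (Delta l) [^]\<^bsub>F\<^esub> (ns ! l)) = \<one>"
    by (rule pr_relator) (use l in \<open>auto simp: F_relators_blocks\<close>)
  then show "gen (Delta l) [^] (ns ! l) = \<one>"
    using hom_relators(2)[OF pr_hom group_axioms l] by (simp only: gen_def)
qed

lemma F_hom_extension:
  assumes Q: "group Q" "finite (carrier Q)" and q: "\<And>i. i \<in> Gens \<Longrightarrow> q i \<in> carrier Q"
    and rel: "blocks_product Q q blocks = \<one>\<^bsub>Q\<^esub>" "\<And>l. l < length ns \<Longrightarrow> q (Delta l) [^]\<^bsub>Q\<^esub> (ns ! l) = \<one>\<^bsub>Q\<^esub>"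
  obtains \<Psi> where "\<Psi> \<in> hom G Q" "\<forall>i\<in>Gens. \<Psi> (gen i) = q i" "openin T (kernel G Q \<Psi>)"
proof (rule hom_extension[OF Q, of q])
  show "q \<in> Gens \<rightarrow> carrier Q" using q by (rule Pi_I)
next
  fix f c
  assume f: "f \<in> hom F Q" and gens: "\<forall>x\<in>Gens. f (free_gen Gens x) = q x"
    and c: "c \<in> F_relators F (free_gen Gens) g r ns"
  have "blocks_product Q (\<lambda>i. f (free_gen Gens i)) blocks = blocks_product Q q blocks"
    by (rule blocks_product_cong) (use gens block_gens_Gens in blast)
  then have 1: "f (blocks_product F (free_gen Gens) blocks) = \<one>\<^bsub>Q\<^esub>"
    using hom_relators(1)[OF f Q(1)] rel(1) by (simp only:)
  have 2: "f (free_gen Gens (Delta l) [^]\<^bsub>F\<^esub> (ns ! l)) = \<one>\<^bsub>Q\<^esub>" if l: "l < length ns" for l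
    using hom_relators(2)[OF f Q(1) l] rel(2)[OF l] gens[rule_format, OF Delta_Gens[OF l]] by (simp only:)
  show "f c = \<one>\<^bsub>Q\<^esub>"
    using c unfolding F_relators_blocks by (elim insertE CollectE exE conjE) (simp_all only: 1 2)
qed (rule that)

text \<open>The equalizer is a subgroup containing the intersection of the two open kernels, hence
  open.\<close>

lemma hom_eqI:
  assumes "group Q" "\<Psi> \<in> hom G Q" "\<Psi>' \<in> hom G Q"
    and ker: "openin T (kernel G Q \<Psi>)" "openin T (kernel G Q \<Psi>')"
    and eq: "\<And>i. i \<in> Gens \<Longrightarrow> \<Psi> (gen i) = \<Psi>' (gen i)" and x: "x \<in> carrier G"
  shows "\<Psi> x = \<Psi>' x"
proof -
  interpret A: group_hom G Q \<Psi>
    using assms by (simp add: group_hom_def group_hom_axioms_def group_axioms)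
  interpret B: group_hom G Q \<Psi>'
    using assms by (simp add: group_hom_def group_hom_axioms_def group_axioms)
  let ?E = "{x \<in> carrier G. \<Psi> x = \<Psi>' x}"
  have E: "subgroup ?E G"
    by (rule subgroupI) auto
  have K: "subgroup (kernel G Q \<Psi> \<inter> kernel G Q \<Psi>') G"
    by (rule subgroups_Inter_pair[OF A.subgroup_kernel B.subgroup_kernel])
  have "openin T ?E"
    by (rule openin_supergroup[OF subgroup.one_closed[OF K] openin_Int[OF ker] E]) (auto simp: kernel_def)
  then have "?E = carrier G"
    by (rule open_subgroup_eq_carrier[OF E]) (use eq gen_closed in auto)
  then show ?thesis using x by blast
qed

definition auts where "auts = top_iso G T G T"

lemma auts_hom: "\<theta> \<in> auts \<Longrightarrow> \<theta> \<in> hom G G"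
  by (simp add: auts_def top_iso_def iso_def)

lemma auts_closed: "\<theta> \<in> auts \<Longrightarrow> x \<in> carrier G \<Longrightarrow> \<theta> x \<in> carrier G"
  by (rule hom_in_carrier[OF auts_hom])

lemma auts_id: "id \<in> auts"
  by (simp add: auts_def top_iso_def iso_set_refl[unfolded id_def[symmetric]] homeomorphic_map_id iso_refl)

lemma auts_comp: "\<theta> \<in> auts \<Longrightarrow> \<eta> \<in> auts \<Longrightarrow> \<eta> \<circ> \<theta> \<in> auts"
  unfolding auts_def top_iso_def using iso_set_trans homeomorphic_map_compose by blast

lemma auts_inv:
  assumes "\<theta> \<in> auts"
  obtains \<eta> where "\<eta> \<in> auts" "\<And>x. x \<in> carrier G \<Longrightarrow> \<theta> (\<eta> x) = x"
proof -
  have \<theta>: "\<theta> \<in> iso G G" "homeomorphic_map T T \<theta>" using assms by (simp_all add: auts_def top_iso_def)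
  let ?\<eta> = "inv_into (carrier G) \<theta>"
  have iso: "?\<eta> \<in> iso G G" by (rule iso_set_sym[OF \<theta>(1)])
  have bij: "bij_betw \<theta> (carrier G) (carrier G)" using \<theta>(1) by (simp add: iso_def)
  obtain k where k: "homeomorphic_maps T T \<theta> k" using \<theta>(2) homeomorphic_map_maps by blast
  have k_inv: "\<theta> (k x) = x" "k x \<in> carrier G" if "x \<in> carrier G" for x
    using k that topspace_eq continuous_map_image_subset_topspace[of T T k]
    unfolding homeomorphic_maps_def by auto
  have eq: "k x = ?\<eta> x" if "x \<in> topspace T" for x
    using inv_into_f_f[OF bij_betw_imp_inj_on[OF bij] k_inv(2)] k_inv(1) that topspace_eq by simp
  have "homeomorphic_map T T k"
    using k homeomorphic_maps_imp_map homeomorphic_maps_sym by blast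
  then have "homeomorphic_map T T ?\<eta>" using eq by (rule homeomorphic_map_eq)
  then have "?\<eta> \<in> auts" using iso by (simp add: auts_def top_iso_def)
  moreover have "\<theta> (?\<eta> x) = x" if "x \<in> carrier G" for x
    using bij that by (rule bij_betw_inv_into_right)
  ultimately show ?thesis using that by blast
qed

text \<open>The largest subset of \<open>U\<close> in the group that is stable under all topological
  automorphisms, written with preimages because these inherit openness directly.\<close>

definition char_core :: "'a set \<Rightarrow> 'a set"
  where "char_core U = carrier G \<inter> (\<Inter>\<theta>\<in>auts. {x \<in> carrier G. \<theta> x \<in> U})"

text \<open>An automorphism pulls an open normal subgroup \<open>U\<close> back to the kernel of a homomorphism to
  the finite group \<open>G Mod U\<close>, and such a homomorphism is determined by the images of the generators.\<close>

lemma open_char_core: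
  assumes U: "U \<lhd> G" "openin T U"
  shows "openin T (char_core U)"
proof -
  interpret U: normal U G by fact
  interpret Q: group "G Mod U" by (rule U.factorgroup_is_group)
  let ?p = "\<lambda>\<theta> x. U #> \<theta> x"
  let ?pre = "\<lambda>\<theta>. {x \<in> carrier G. \<theta> x \<in> U}"
  have pre_open: "openin T (?pre \<theta>)" if "\<theta> \<in> auts" for \<theta>
  proof -
    have "continuous_map T T \<theta>"
      using that by (auto simp: auts_def top_iso_def homeomorphic_imp_continuous_map)
    from openin_continuous_map_preimage[OF this U(2)] show ?thesis unfolding topspace_eq .
  qed
  have hom: "?p \<theta> \<in> hom G (G Mod U)" if "\<theta> \<in> auts" for \<theta>
    using Group.hom_compose[OF auts_hom[OF that] U.r_coset_hom_Mod] by (simp add: o_def)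
  have ker: "kernel G (G Mod U) (?p \<theta>) = ?pre \<theta>" if "\<theta> \<in> auts" for \<theta>
    using auts_closed[OF that] coset_join1[OF _ _ U.subgroup_axioms] coset_join2[OF _ U.subgroup_axioms]
    unfolding kernel_def by auto
  obtain A where A: "finite A" "A \<subseteq> carrier G" "\<And>x. x \<in> carrier G \<Longrightarrow> \<exists>a\<in>A. inv a \<otimes> x \<in> U"
    by (rule finite_left_transversal[OF U.subgroup_axioms U(2)]) blast
  have "rcosets U \<subseteq> (\<lambda>a. U #> a) ` A"
  proof
    fix B assume "B \<in> rcosets U"
    then obtain x where x: "x \<in> carrier G" "B = U #> x" by (auto simp: RCOSETS_def)
    obtain a where a: "a \<in> A" "inv a \<otimes> x \<in> U" using A(3)[OF x(1)] by blast
    have "x \<in> U #> a"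
    proof -
      have aG: "a \<in> carrier G" using a(1) A(2) by blast
      have "a \<otimes> (inv a \<otimes> x) \<otimes> inv a \<in> U" by (rule U.inv_op_closed2[OF aG a(2)])
      then have "x \<otimes> inv a \<in> U" using aG x(1) by (simp add: mult_inv_cancel)
      moreover have "x = x \<otimes> inv a \<otimes> a" using aG x(1) by (simp add: m_assoc)
      ultimately show ?thesis unfolding r_coset_def by blast
    qed
    then have "U #> a = U #> x"
      by (rule repr_independence) (use a(1) A(2) U.subgroup_axioms in auto)
    then show "B \<in> (\<lambda>a. U #> a) ` A" using a(1) x(2) by blast
  qed
  then have fin: "finite (rcosets U)" using A(1) by (meson finite_imageI finite_subset)
  \<comment> \<open>The images of the generators modulo \<open>U\<close>. There are finitely many
    such tuples, and the preimage of \<open>U\<close> under an automorphism depends only on its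
    tuple.\<close>
  define v where "v \<theta> = (\<lambda>i\<in>Gens. ?p \<theta> (gen i))" for \<theta>
  have v: "v ` auts \<subseteq> (\<Pi>\<^sub>E i\<in>Gens. rcosets U)"
    using rcosetsI[OF U.subset auts_closed[OF _ gen_closed]] by (auto simp: v_def)
  have "?pre \<theta> = ?pre \<eta>" if "\<theta> \<in> auts" "\<eta> \<in> auts" "v \<theta> = v \<eta>" for \<theta> \<eta>
  proof -
    have "?p \<theta> (gen i) = ?p \<eta> (gen i)" if "i \<in> Gens" for i
      using fun_cong[OF \<open>v \<theta> = v \<eta>\<close>, of i] that by (simp add: v_def)
    note gens = this
    have "?p \<theta> x = ?p \<eta> x" if x: "x \<in> carrier G" for x
      by (rule hom_eqI[OF Q.group_axioms hom[OF \<open>\<theta> \<in> auts\<close>] hom[OF \<open>\<eta> \<in> auts\<close>] _ _ gens x])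
        (simp_all only: ker pre_open \<open>\<theta> \<in> auts\<close> \<open>\<eta> \<in> auts\<close>)
    then have "kernel G (G Mod U) (?p \<theta>) = kernel G (G Mod U) (?p \<eta>)" unfolding kernel_def by auto
    then show ?thesis unfolding ker[OF that(1)] ker[OF that(2)] .
  qed
  then have "?pre \<theta> = ?pre (inv_into auts v (v \<theta>))" if "\<theta> \<in> auts" for \<theta>
    using that inv_into_into[of "v \<theta>" v auts] f_inv_into_f[of "v \<theta>" v auts] by blast
  then have "?pre ` auts \<subseteq> (\<lambda>w. ?pre (inv_into auts v w)) ` (\<Pi>\<^sub>E i\<in>Gens. rcosets U)"
    using v by blast
  moreover have "finite (\<Pi>\<^sub>E i\<in>Gens. rcosets U)" using fin finite_Gens by (simp add: finite_PiE)
  ultimately have "finite (?pre ` auts)" by (meson finite_imageI finite_subset)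
  then have "openin T (carrier G \<inter> (\<Inter>W\<in>?pre ` auts. W))"
    by (rule openin_finite_INT) (use pre_open in auto)
  then show ?thesis by (simp add: char_core_def)
qed

lemma char_core_subset:
  assumes "U \<subseteq> carrier G"
  shows "char_core U \<subseteq> U"
proof
  fix x assume "x \<in> char_core U"
  then have "id x \<in> U" using auts_id unfolding char_core_def by blast
  then show "x \<in> U" by simp
qed

lemma normal_char_core:
  assumes "U \<lhd> G"
  shows "char_core U \<lhd> G"
proof -
  interpret U: normal U G by fact
  have "{x \<in> carrier G. \<theta> x \<in> U} \<lhd> G" if \<theta>: "\<theta> \<in> auts" for \<theta>
  proof -
    interpret \<theta>: group_hom G G \<theta>
      using auts_hom[OF \<theta>] by (simp add: group_hom_def group_hom_axioms_def group_axioms)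
    show ?thesis
    proof (rule normal_invI)
      show "subgroup {x \<in> carrier G. \<theta> x \<in> U} G"
        by (rule subgroupI) (auto intro!: exI[of _ \<one>])
      show "x \<otimes> h \<otimes> inv x \<in> {x \<in> carrier G. \<theta> x \<in> U}"
        if "x \<in> carrier G" "h \<in> {x \<in> carrier G. \<theta> x \<in> U}" for x h
        using that U.inv_op_closed2[of "\<theta> x" "\<theta> h"] by simp
    qed
  qed
  moreover have "(\<Inter>\<theta>\<in>auts. {x \<in> carrier G. \<theta> x \<in> U}) = char_core U"
    using auts_id unfolding char_core_def by blast
  ultimately show ?thesis
    using normal_Inter[of "(\<lambda>\<theta>. {x \<in> carrier G. \<theta> x \<in> U}) ` auts"] auts_id by auto
qed

lemma characteristic_char_core:
  assumes "U \<lhd> G"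
  shows "characteristic_subgroup (char_core U) G T"
proof -
  have sub: "\<theta> ` char_core U \<subseteq> char_core U" if \<theta>: "\<theta> \<in> auts" for \<theta>
  proof
    fix y assume "y \<in> \<theta> ` char_core U"
    then obtain x where x: "y = \<theta> x" "x \<in> char_core U" by blast
    have "\<eta> (\<theta> x) \<in> U" if "\<eta> \<in> auts" for \<eta>
      using x(2) auts_comp[OF \<theta> that] unfolding char_core_def by auto
    moreover have "\<theta> x \<in> carrier G" using x(2) auts_closed[OF \<theta>] by (simp add: char_core_def)
    ultimately show "y \<in> char_core U" using x(1) by (simp add: char_core_def)
  qed
  have "\<theta> ` char_core U = char_core U" if \<theta>: "\<theta> \<in> auts" for \<theta>
  proof
    obtain \<eta> where \<eta>: "\<eta> \<in> auts" "\<And>x. x \<in> carrier G \<Longrightarrow> \<theta> (\<eta> x) = x" by (rule auts_inv[OF \<theta>]) blast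
    show "char_core U \<subseteq> \<theta> ` char_core U"
    proof
      fix x assume x: "x \<in> char_core U"
      then have "\<eta> x \<in> char_core U" using sub[OF \<eta>(1)] by blast
      moreover have "x = \<theta> (\<eta> x)" using \<eta>(2) x by (simp add: char_core_def)
      ultimately show "x \<in> \<theta> ` char_core U" by blast
    qed
  qed (rule sub[OF \<theta>])
  moreover have "subgroup (char_core U) G"
    using normal_char_core[OF assms] by (simp add: normal_def)
  ultimately show ?thesis by (simp add: characteristic_subgroup_def auts_def)
qed

text \<open>Derived subgroups are fully invariant, so passing to the core does not weaken the bound
  on the derived length.\<close>

lemma derived_subset_char_core:
  assumes "(derived G ^^ d) (carrier G) \<subseteq> U"
  shows "(derived G ^^ d) (carrier G) \<subseteq> char_core U"
proof -
  let ?D = "(derived G ^^ d) (carrier G)"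
  have "\<theta> ` ?D \<subseteq> U" if \<theta>: "\<theta> \<in> auts" for \<theta>
  proof -
    interpret \<theta>: group_hom G G \<theta>
      using auts_hom[OF \<theta>] by (simp add: group_hom_def group_hom_axioms_def group_axioms)
    have "\<theta> ` ?D = (derived G ^^ d) (\<theta> ` carrier G)" using \<theta>.exp_of_derived_img[of "carrier G" d] by simp
    also have "\<dots> \<subseteq> ?D" by (rule mono_exp_of_derived) auto
    finally show ?thesis using assms by blast
  qed
  moreover have "?D \<subseteq> carrier G" by (rule exp_of_derived_in_carrier) simp
  ultimately show ?thesis unfolding char_core_def by blast
qed

end

section \<open>Cocycles\<close>

text \<open>The additive analogue of the determinant of a monomial matrix, up to the sign of the
  permutation.\<close>

definition total :: "'x set \<Rightarrow> ('x \<Rightarrow> 'c::ab_group_add) \<times> ('x \<Rightarrow> 'x) \<Rightarrow> 'c"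
  where "total X p = (\<Sum>x\<in>X. fst p x)"

context additive_subgroup_set
begin

lemma monomial_group_pow:
  assumes "p \<in> carrier (monomial_group X C)"
  shows "p [^]\<^bsub>monomial_group X C\<^esub> (k::nat) = (\<lambda>x. \<Sum>i<k. fst p ((snd p ^^ i) x), snd p ^^ k)"
proof (induction k)
  case 0
  then show ?case by (simp add: id_def)
next
  case (Suc k)
  have "(\<Sum>i<Suc k. fst p ((snd p ^^ i) x)) = (\<Sum>i<k. fst p ((snd p ^^ i) (snd p x))) + fst p x" for x
    by (subst sum.lessThan_Suc_shift) (simp add: funpow_swap1 add.commute)
  moreover have "snd p ^^ Suc k = (snd p ^^ k) \<circ> snd p" by (rule funpow_Suc_right)
  ultimately show ?case using Suc.IH by (simp add: fun_eq_iff)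
qed

lemma total_mult:
  assumes "q \<in> carrier (monomial_group X C)"
  shows "total X (p \<otimes>\<^bsub>monomial_group X C\<^esub> q) = total X p + total X q"
proof -
  have q: "snd q permutes X" using assms by simp
  have "(\<Sum>x\<in>X. fst p (snd q x)) = (\<Sum>x\<in>X. fst p x)"
    using sum.permute[OF q, of "fst p"] by (simp add: o_def)
  then show ?thesis by (simp add: total_def sum.distrib)
qed

lemma total_commutator:
  assumes p: "p \<in> carrier (monomial_group X C)" and q: "q \<in> carrier (monomial_group X C)"
  shows "total X (commutator (monomial_group X C) p q) = 0"
proof -
  interpret M: group "monomial_group X C" by (rule group_monomial_group)
  have inv: "total X (inv\<^bsub>monomial_group X C\<^esub> z) = - total X z" if z: "z \<in> carrier (monomial_group X C)" for z
  proof -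
    have "total X (inv\<^bsub>monomial_group X C\<^esub> z) + total X z = total X \<one>\<^bsub>monomial_group X C\<^esub>"
      using total_mult[OF z, of "inv\<^bsub>monomial_group X C\<^esub> z"] M.l_inv[OF z] by (simp only:)
    also have "\<dots> = 0" by (simp add: total_def)
    finally show ?thesis by (simp add: eq_neg_iff_add_eq_0)
  qed
  show ?thesis
    unfolding commutator_def
    by (simp only: total_mult inv p q M.inv_closed) simp
qed

lemma total_blocks_product:
  assumes "\<And>b i. b \<in> set bs \<Longrightarrow> i \<in> block_gens b \<Longrightarrow> y i \<in> carrier (monomial_group X C)"
  shows "total X (blocks_product (monomial_group X C) y bs) =
    (\<Sum>b\<leftarrow>bs. if b \<in> range Alpha then 0 else total X (y b))"
  using assms
proof (induction bs)
  case Nil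
  then show ?case by (simp add: total_def)
next
  case (Cons b bs)
  interpret M: group "monomial_group X C" by (rule group_monomial_group)
  have bs: "\<And>b i. b \<in> set bs \<Longrightarrow> i \<in> block_gens b \<Longrightarrow> y i \<in> carrier (monomial_group X C)"
    using Cons.prems by (metis list.set_intros(2))
  have "blocks_product (monomial_group X C) y bs \<in> carrier (monomial_group X C)"
    using bs by (rule M.blocks_product_closed)
  note total_mult[OF this, of "block_value (monomial_group X C) y b"]
  moreover have "total X (block_value (monomial_group X C) y b) =
      (if b \<in> range Alpha then 0 else total X (y b))"
  proof (cases b)
    case (Alpha i)
    have "y (Alpha i) \<in> carrier (monomial_group X C)" "y (Beta i) \<in> carrier (monomial_group X C)"
      by (rule Cons.prems[of b], simp, simp add: Alpha)+
    from total_commutator[OF this] show ?thesis by (simp add: block_value_def Alpha)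
  qed (auto simp: block_value_def)
  ultimately show ?case using Cons.IH[OF bs] unfolding blocks_product_Cons by simp
qed

text \<open>Commutators have total zero, so the obstruction only sees the cusps and the
  periods.\<close>

lemma total_relator:
  assumes "\<And>b i. b \<in> set (relator_blocks g r k) \<Longrightarrow> i \<in> block_gens b \<Longrightarrow> y i \<in> carrier (monomial_group X C)"
  shows "total X (blocks_product (monomial_group X C) y (relator_blocks g r k)) =
    (\<Sum>j<r. total X (y (Gamma j))) + (\<Sum>l<k. total X (y (Delta l)))"
proof -
  have "Gamma j \<notin> range Alpha" "Delta j \<notin> range Alpha" for j by auto
  moreover have "total X (blocks_product (monomial_group X C) y (relator_blocks g r k)) =
      (\<Sum>b\<leftarrow>relator_blocks g r k. if b \<in> range Alpha then 0 else total X (y b))"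
    using assms by (rule total_blocks_product)
  ultimately show ?thesis
    by (simp add: relator_blocks_def o_def interv_sum_list_conv_sum_set_nat atLeast0LessThan)
qed

end

text \<open>\<open>(coboundary h \<sigma>, \<sigma>)\<close> is the conjugate of the pure
  permutation \<open>(\<lambda>_. 0, \<sigma>)\<close> by \<open>(h, id)\<close>. It therefore has
  the order of \<sigma>.\<close>

definition coboundary :: "('x \<Rightarrow> 'c::ab_group_add) \<Rightarrow> ('x \<Rightarrow> 'x) \<Rightarrow> ('x \<Rightarrow> 'c)"
  where "coboundary h \<sigma> = (\<lambda>x. h (\<sigma> x) - h x)"

lemma sum_coboundary: "(\<Sum>i<k. coboundary h \<sigma> ((\<sigma> ^^ i) x)) = h ((\<sigma> ^^ k) x) - h x"
  by (induction k) (simp_all add: coboundary_def)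

lemma (in additive_subgroup_set) total_coboundary:
  assumes "\<sigma> permutes X"
  shows "total X (coboundary h \<sigma>, \<tau>) = 0"
  using sum.permute[OF assms, of h] by (simp add: total_def coboundary_def o_def sum_subtractf)

lemma (in additive_subgroup_set) pow_coboundary:
  assumes "(coboundary h \<sigma>, \<sigma>) \<in> carrier (monomial_group X C)" "\<sigma> ^^ k = id"
  shows "(coboundary h \<sigma>, \<sigma>) [^]\<^bsub>monomial_group X C\<^esub> k = \<one>\<^bsub>monomial_group X C\<^esub>"
  by (subst monomial_group_pow[OF assms(1)]) (simp add: sum_coboundary assms(2))

text \<open>Choose a point in every orbit and sum up the cocycle along the orbit.\<close>

lemma (in additive_subgroup_set) free_cocycle_is_coboundary:
  assumes \<sigma>: "\<And>x. x \<in> X \<Longrightarrow> \<sigma> x \<in> X" and m: "m > 0" "\<And>x. x \<in> X \<Longrightarrow> (\<sigma> ^^ m) x = x"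
    and free: "\<And>x k. x \<in> X \<Longrightarrow> (\<sigma> ^^ k) x = x \<Longrightarrow> m dvd k"
    and f: "\<And>x. f x \<in> C" and cocycle: "\<And>x. x \<in> X \<Longrightarrow> (\<Sum>i<m. f ((\<sigma> ^^ i) x)) = 0"
  obtains h where "\<forall>x. h x \<in> C" "\<forall>x\<in>X. f x = h (\<sigma> x) - h x"
proof -
  define F where "F k x = (\<Sum>i<k. f ((\<sigma> ^^ i) x))" for k x
  define orb where "orb x = {y. \<exists>k. y = (\<sigma> ^^ k) x}" for x
  \<comment> \<open>The choice is made from the orbit as a set, so it is the same for all points of
    an orbit.\<close>
  define rp where "rp x = (SOME y. y \<in> orb x)" for x
  define K where "K x = (SOME k. (\<sigma> ^^ k) (rp x) = x)" for x
  define h where "h x = F (K x) (rp x)" for x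
  have pow: "(\<sigma> ^^ k) x \<in> X" if "x \<in> X" for x k using that by (induction k) (simp_all add: \<sigma>)
  have pow_mult: "(\<sigma> ^^ (j * m)) x = x" if "x \<in> X" for x j
    using that by (induction j) (simp_all add: funpow_add m(2))
  have F_add: "F (j + k) x = F k x + F j ((\<sigma> ^^ k) x)" for j k x
    by (induction j) (simp_all add: F_def funpow_add add.assoc)
  have F_mult: "F (j * m) x = 0" if "x \<in> X" for x j
  proof (induction j)
    case (Suc j)
    have "F m x = 0" using cocycle[OF that] by (simp add: F_def)
    then show ?case using Suc F_add[of m "j * m" x] pow_mult[OF that, of j] by simp
  qed (simp add: F_def)
  have rp: "rp x \<in> orb x" for x
    unfolding rp_def by (rule someI[of _ "(\<sigma> ^^ 0) x"]) (unfold orb_def, blast)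
  have oX: "rp x \<in> X" if "x \<in> X" for x using rp[of x] pow[OF that] by (auto simp: orb_def)
  have K: "(\<sigma> ^^ K x) (rp x) = x" if x: "x \<in> X" for x
  proof -
    obtain k where k: "rp x = (\<sigma> ^^ k) x" using rp[of x] by (auto simp: orb_def)
    have "k \<le> k * m" using m(1) by simp
    then have "k * m - k + k = k * m" by simp
    then have "(\<sigma> ^^ (k * m - k)) (rp x) = x"
      unfolding k using pow_mult[OF x, of k] funpow_add[of "k * m - k" k \<sigma>]
      by (simp only: comp_apply)
    then show ?thesis unfolding K_def by (rule someI)
  qed
  \<comment> \<open>The partial sum does not depend on the exponent: by freeness two exponents
    leading to the same point differ by a multiple of \<open>m\<close>, and full cycles contribute
    zero.\<close>
  have F_eq: "F j y = F k y" if y: "y \<in> X" and jk: "(\<sigma> ^^ j) y = (\<sigma> ^^ k) y" and le: "j \<le> k" for j k y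
  proof -
    have split: "(\<sigma> ^^ (k - j)) ((\<sigma> ^^ j) y) = (\<sigma> ^^ j) y"
      using jk le funpow_add[of "k - j" j \<sigma>] by simp
    have "m dvd k - j" by (rule free[OF pow[OF y] split])
    then obtain i where "k - j = i * m" by (metis dvdE mult.commute)
    then have "k = i * m + j" using le by simp
    then show ?thesis using F_add F_mult[OF pow[OF y]] by simp
  qed
  have h: "h x = F k (rp x)" if x: "x \<in> X" and k: "(\<sigma> ^^ k) (rp x) = x" for x k
  proof -
    have eq: "(\<sigma> ^^ k) (rp x) = (\<sigma> ^^ K x) (rp x)" using K[OF x] k by (simp only:)
    show ?thesis
    proof (cases "k \<le> K x")
      case True
      then show ?thesis unfolding h_def by (rule F_eq[OF oX[OF x] eq, symmetric])
    next
      case False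
      then have "K x \<le> k" by simp
      then show ?thesis unfolding h_def by (rule F_eq[OF oX[OF x] eq[symmetric]])
    qed
  qed
  have "orb (\<sigma> x) = orb x" if x: "x \<in> X" for x
  proof
    show "orb (\<sigma> x) \<subseteq> orb x"
    proof
      fix y assume "y \<in> orb (\<sigma> x)"
      then obtain k where "y = (\<sigma> ^^ k) (\<sigma> x)" by (auto simp: orb_def)
      then have "y = (\<sigma> ^^ Suc k) x" by (simp add: funpow_swap1)
      then show "y \<in> orb x" unfolding orb_def by blast
    qed
    show "orb x \<subseteq> orb (\<sigma> x)"
    proof
      fix y assume "y \<in> orb x"
      then obtain k where k: "y = (\<sigma> ^^ k) x" by (auto simp: orb_def)
      \<comment> \<open>A full cycle is added so that one step can be split off even if
        \<open>k\<close> is zero.\<close>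
      have "y = (\<sigma> ^^ (k + m)) x" using m(2)[OF x] by (simp add: k funpow_add)
      also have "k + m = Suc (k + (m - 1))" using m(1) by simp
      finally have "y = (\<sigma> ^^ (k + (m - 1))) (\<sigma> x)" by (simp add: funpow_swap1)
      then show "y \<in> orb (\<sigma> x)" unfolding orb_def by blast
    qed
  qed
  then have rp_\<sigma>: "rp (\<sigma> x) = rp x" if "x \<in> X" for x using that by (simp add: rp_def)
  have "f x = h (\<sigma> x) - h x" if x: "x \<in> X" for x
  proof -
    have "h (\<sigma> x) = F (Suc (K x)) (rp x)"
      by (rule h[OF \<sigma>[OF x], of "Suc (K x)", unfolded rp_\<sigma>[OF x]]) (simp add: K[OF x])
    also have "\<dots> = h x + f x" by (simp add: F_def h_def K[OF x])
    finally show ?thesis by simp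
  qed
  moreover have "h x \<in> C" for x unfolding h_def F_def by (rule sum_mem) (rule f)
  ultimately show ?thesis by (intro that[of h] ballI allI)
qed

definition scale :: "nat \<Rightarrow> ('x \<Rightarrow> qz) \<times> ('x \<Rightarrow> 'x) \<Rightarrow> ('x \<Rightarrow> qz) \<times> ('x \<Rightarrow> 'x)"
  where "scale n p = (\<lambda>x. nat_mult n (fst p x), snd p)"

lemma scale_hom: "scale n \<in> hom (monomial_group X (torsion_qz (m * n))) (monomial_group X (torsion_qz m))"
proof (rule homI)
  fix p assume "p \<in> carrier (monomial_group X (torsion_qz (m * n)))"
  then show "scale n p \<in> carrier (monomial_group X (torsion_qz m))"
    by (simp add: scale_def supported_funs_def nat_mult_mem_torsion_qz)
qed (simp add: scale_def nat_mult_add)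

section \<open>Divisibility of characters\<close>

text \<open>\<xi> is a continuous character of the open subgroup \<open>H\<close>; continuity is
  expressed by vanishing on the neighbourhood \<open>U\<close>. The number \<open>n\<close> kills
  the values of \<xi> and is also the number by which \<xi> will be divided.\<close>

locale character_lifting = F_group +
  fixes H U N :: "'a set" and \<xi> :: "'a \<Rightarrow> qz" and n :: nat
  assumes H: "subgroup H G" "openin T H"
    and U: "\<one> \<in> U" "openin T U" "U \<subseteq> H" "\<And>u. u \<in> U \<Longrightarrow> \<xi> u = 0"
    and N: "N \<lhd> G" "H \<subseteq> N"
    and n: "n > 0"
    and \<xi>_torsion: "s \<in> H \<Longrightarrow> \<xi> s \<in> torsion_qz n"
    and \<xi>_mult: "s \<in> H \<Longrightarrow> s' \<in> H \<Longrightarrow> \<xi> (s \<otimes> s') = \<xi> s + \<xi> s'"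
    and order: "l < length ns \<Longrightarrow> gen (Delta l) [^] (j::nat) \<in> N \<Longrightarrow> ns ! l dvd j"
begin

lemma H_carrier: "s \<in> H \<Longrightarrow> s \<in> carrier G"
  using subgroup.mem_carrier[OF H(1)] .

text \<open>A section of the projection to the left cosets of \<open>H\<close>. Its value at \<one>
  is only known to lie in \<open>H\<close>, which is why \<open>base\<close> appears below instead
  of \<one>.\<close>

definition rep :: "'a \<Rightarrow> 'a"
  where "rep w = (SOME a. a \<in> carrier G \<and> inv a \<otimes> w \<in> H)"

lemma rep:
  assumes "w \<in> carrier G"
  shows "rep w \<in> carrier G" "inv (rep w) \<otimes> w \<in> H"
proof -
  have "w \<in> carrier G \<and> inv w \<otimes> w \<in> H" using assms subgroup.one_closed[OF H(1)] by simp
  then have "rep w \<in> carrier G \<and> inv (rep w) \<otimes> w \<in> H" unfolding rep_def by (rule someI)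
  then show "rep w \<in> carrier G" "inv (rep w) \<otimes> w \<in> H" by auto
qed

lemma rep_eq:
  assumes w: "w \<in> carrier G" and h: "h \<in> carrier G" and gh: "inv w \<otimes> h \<in> H"
  shows "rep w = rep h"
proof -
  have "inv a \<otimes> w \<in> H \<longleftrightarrow> inv a \<otimes> h \<in> H" if a: "a \<in> carrier G" for a
  proof
    assume "inv a \<otimes> w \<in> H"
    then have "(inv a \<otimes> w) \<otimes> (inv w \<otimes> h) \<in> H" using gh by (rule subgroup.m_closed[OF H(1)])
    then show "inv a \<otimes> h \<in> H" using a w h by (simp add: m_assoc mult_inv_cancel)
  next
    assume "inv a \<otimes> h \<in> H"
    then have "(inv a \<otimes> h) \<otimes> inv (inv w \<otimes> h) \<in> H"
      using subgroup.m_inv_closed[OF H(1) gh] by (rule subgroup.m_closed[OF H(1)])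
    then show "inv a \<otimes> w \<in> H" using a w h by (simp add: m_assoc mult_inv_cancel inv_mult_group)
  qed
  then have "(\<lambda>a. a \<in> carrier G \<and> inv a \<otimes> w \<in> H) = (\<lambda>a. a \<in> carrier G \<and> inv a \<otimes> h \<in> H)" by blast
  then show ?thesis unfolding rep_def by (simp only:)
qed

definition X where "X = rep ` carrier G"

lemma X_carrier: "x \<in> X \<Longrightarrow> x \<in> carrier G"
  using rep(1) by (auto simp: X_def)

lemma rep_X: "x \<in> X \<Longrightarrow> rep x = x"
  using rep_eq[OF rep(1) _ rep(2)] by (auto simp: X_def)

lemma rep_mem: "w \<in> carrier G \<Longrightarrow> rep w \<in> X"
  by (simp add: X_def)

lemma finite_X: "finite X"
proof -
  obtain A where A: "finite A" "A \<subseteq> carrier G" "\<And>x. x \<in> carrier G \<Longrightarrow> \<exists>a\<in>A. inv a \<otimes> x \<in> H"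
    by (rule finite_left_transversal[OF H]) blast
  have "X \<subseteq> rep ` A"
  proof
    fix x assume "x \<in> X"
    then obtain w where w: "w \<in> carrier G" "x = rep w" by (auto simp: X_def)
    then obtain a where a: "a \<in> A" "inv a \<otimes> w \<in> H" using A(3) by blast
    then have "rep a = rep w" using rep_eq[of a w] A(2) w(1) by blast
    then show "x \<in> rep ` A" using a(1) w(2) by (intro image_eqI[of _ _ a]) simp_all
  qed
  then show ?thesis using A(1) by (meson finite_imageI finite_subset)
qed

definition act where "act d x = (if x \<in> X then rep (d \<otimes> x) else x)"

text \<open>The formula of an induced monomial representation: \<open>d\<close> moves the coset of
  \<open>x\<close> to that of \<open>rep (d \<otimes> x)\<close>, and \<xi> is evaluated at the
  factor in \<open>H\<close> that arises.\<close>

definition cocycle where "cocycle d x = (if x \<in> X then \<xi> (inv (rep (d \<otimes> x)) \<otimes> (d \<otimes> x)) else 0)"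

lemma act_X: "d \<in> carrier G \<Longrightarrow> x \<in> X \<Longrightarrow> act d x \<in> X"
  by (simp add: act_def rep_mem X_carrier)

lemma rep_mult:
  assumes "d \<in> carrier G" "w \<in> carrier G"
  shows "rep (d \<otimes> rep w) = rep (d \<otimes> w)"
  by (rule rep_eq) (use assms rep[OF assms(2)] in \<open>simp_all add: inv_mult_group m_assoc mult_inv_cancel\<close>)

lemma act_mult:
  assumes "d \<in> carrier G" "e \<in> carrier G"
  shows "act (d \<otimes> e) x = act d (act e x)"
proof (cases "x \<in> X")
  case True
  then show ?thesis
    using act_X[OF assms(2) True] rep_mult[of d "e \<otimes> x"] assms X_carrier[OF True]
    by (simp add: act_def m_assoc)
qed (simp add: act_def)

lemma act_one: "act \<one> x = x"
  by (simp add: act_def X_carrier rep_X)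

lemma act_permutes:
  assumes "d \<in> carrier G"
  shows "act d permutes X"
proof (rule bij_imp_permutes)
  have "act (inv d) (act d x) = x" "act d (act (inv d) x) = x" for x
    using act_mult[of "inv d" d x] act_mult[of d "inv d" x] assms by (simp_all add: act_one)
  then show "bij_betw (act d) X X"
    using act_X assms by (intro bij_betw_byWitness[where f' = "act (inv d)"]) auto
  show "act d x = x" if "x \<notin> X" for x using that by (simp add: act_def)
qed

lemma cocycle_mult:
  assumes d: "d \<in> carrier G" and e: "e \<in> carrier G"
  shows "cocycle (d \<otimes> e) x = cocycle d (act e x) + cocycle e x"
proof (cases "x \<in> X")
  case True
  let ?y = "rep (e \<otimes> x)"
  have x: "x \<in> carrier G" by (rule X_carrier[OF True])
  have y: "?y \<in> carrier G" "inv ?y \<otimes> (e \<otimes> x) \<in> H" using rep[of "e \<otimes> x"] e x by auto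
  have z: "rep (d \<otimes> ?y) \<in> carrier G" "inv (rep (d \<otimes> ?y)) \<otimes> (d \<otimes> ?y) \<in> H"
    using rep[of "d \<otimes> ?y"] d y(1) by auto
  have "inv (rep (d \<otimes> ?y)) \<otimes> (d \<otimes> ?y) \<otimes> (inv ?y \<otimes> (e \<otimes> x)) = inv (rep (d \<otimes> ?y)) \<otimes> (d \<otimes> e \<otimes> x)"
    using d e x y(1) z(1) by (simp add: m_assoc mult_inv_cancel)
  moreover have "rep (d \<otimes> ?y) = rep (d \<otimes> e \<otimes> x)"
    using rep_mult[of d "e \<otimes> x"] d e x by (simp add: m_assoc)
  moreover have "?y \<in> X" using e x by (simp add: rep_mem)
  ultimately show ?thesis
    using \<xi>_mult[OF z(2) y(2)] True by (simp add: cocycle_def act_def)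
qed (simp add: cocycle_def act_def)

lemma cocycle_torsion:
  assumes "d \<in> carrier G"
  shows "cocycle d x \<in> torsion_qz n"
proof (cases "x \<in> X")
  case True
  then show ?thesis using rep(2)[of "d \<otimes> x"] assms X_carrier \<xi>_torsion by (simp add: cocycle_def)
qed (simp add: cocycle_def torsion_qz_def)

abbreviation M :: "nat \<Rightarrow> (('a \<Rightarrow> qz) \<times> ('a \<Rightarrow> 'a)) monoid"
  where "M k \<equiv> monomial_group X (torsion_qz k)"

lemma group_M: "group (M k)"
  by (rule additive_subgroup_set.group_monomial_group[OF additive_torsion_qz])

definition induced where "induced d = (cocycle d, act d)"

lemma induced_hom: "induced \<in> hom G (M n)"
proof (rule homI)
  fix d assume "d \<in> carrier G"
  then show "induced d \<in> carrier (M n)"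
    by (simp add: induced_def supported_funs_def cocycle_torsion act_permutes) (simp add: cocycle_def)
next
  fix d e assume "d \<in> carrier G" "e \<in> carrier G"
  then show "induced (d \<otimes> e) = induced d \<otimes>\<^bsub>M n\<^esub> induced e"
    by (simp add: induced_def act_mult cocycle_mult fun_eq_iff)
qed

lemma act_fixed:
  assumes "x \<in> X" "d \<in> carrier G"
  shows "act d x = x \<longleftrightarrow> inv x \<otimes> d \<otimes> x \<in> H"
proof
  have x: "x \<in> carrier G" by (rule X_carrier[OF assms(1)])
  assume "act d x = x"
  then show "inv x \<otimes> d \<otimes> x \<in> H"
    using rep(2)[of "d \<otimes> x"] assms x by (simp add: act_def m_assoc)
next
  have x: "x \<in> carrier G" by (rule X_carrier[OF assms(1)])
  assume "inv x \<otimes> d \<otimes> x \<in> H"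
  then have "rep x = rep (d \<otimes> x)" using assms x by (intro rep_eq) (simp_all add: m_assoc)
  then show "act d x = x" using assms(1) by (simp add: act_def rep_X)
qed

text \<open>The conjugates of \<open>U\<close> by the finitely many representatives intersect in an
  open set that fixes every coset and on which the cocycle vanishes.\<close>

lemma induced_open: "openin T (kernel G (M n) induced)"
proof -
  interpret h: group_hom G "M n" induced
    using induced_hom group_M by (simp add: group_hom_def group_hom_axioms_def group_axioms)
  let ?W = "carrier G \<inter> (\<Inter>x\<in>X. {d \<in> carrier G. inv x \<otimes> d \<otimes> x \<in> U})"
  have W: "openin T ?W"
    by (rule openin_finite_INT[OF finite_X]) (rule openin_conjugate[OF U(2) X_carrier])
  have "\<one> \<in> ?W" using U(1) X_carrier by simp
  then show ?thesis
  proof (rule openin_supergroup[OF _ W h.subgroup_kernel], intro subsetI)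
    fix d assume d: "d \<in> ?W"
    then have dG: "d \<in> carrier G" by blast
    have "act d x = x" for x
    proof (cases "x \<in> X")
      case True
      then have "inv x \<otimes> d \<otimes> x \<in> H" using d U(3) by blast
      then show ?thesis using act_fixed[OF True dG] by simp
    qed (simp add: act_def)
    note act = this
    have "cocycle d x = 0" for x
    proof (cases "x \<in> X")
      case True
      then have "rep (d \<otimes> x) = x" using act[of x] by (simp add: act_def)
      moreover have "\<xi> (inv x \<otimes> d \<otimes> x) = 0" using d True U(4) by blast
      ultimately show ?thesis using True X_carrier[OF True] dG by (simp add: cocycle_def m_assoc)
    qed (simp add: cocycle_def)
    with act have "induced d = (\<lambda>_. 0, id)" by (simp add: induced_def fun_eq_iff)
    then show "d \<in> kernel G (M n) induced" using dG by (simp add: kernel_def)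
  qed
qed

lemma act_pow: "d \<in> carrier G \<Longrightarrow> act (d [^] (k::nat)) x = (act d ^^ k) x"
proof (induction k arbitrary: x)
  case (Suc k)
  have "act (d [^] Suc k) x = act (d [^] k) (act d x)"
    using Suc.prems by (simp add: act_mult)
  also have "\<dots> = (act d ^^ Suc k) x" using Suc by (simp add: funpow_swap1)
  finally show ?case .
qed (simp add: act_one)

text \<open>Every \<open>\<delta>\<^sub>l\<close> acts freely modulo its period, because the stabilizers are conjugate to
  subgroups of \<open>N\<close>.\<close>

lemma cocycle_Delta:
  assumes l: "l < length ns"
  obtains h where "h \<in> supported_funs X (torsion_qz n)"
    "cocycle (gen (Delta l)) = coboundary h (act (gen (Delta l)))"
proof -
  let ?d = "gen (Delta l)" and ?m = "ns ! l"
  have d: "?d \<in> carrier G" by (rule gen_closed[OF Delta_Gens[OF l]])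
  interpret C: additive_subgroup_set "torsion_qz n" by (rule additive_torsion_qz)
  interpret h: group_hom G "M n" induced
    using induced_hom group_M by (simp add: group_hom_def group_hom_axioms_def group_axioms)
  have "induced ?d [^]\<^bsub>M n\<^esub> ?m = \<one>\<^bsub>M n\<^esub>"
    using h.hom_nat_pow[OF d, of ?m] relation_Delta[OF l] h.hom_one by (simp only:)
  then have sum: "(\<Sum>i<?m. cocycle ?d ((act ?d ^^ i) x)) = 0" if "x \<in> X" for x
    using C.monomial_group_pow[OF h.hom_closed[OF d], of ?m] by (simp add: induced_def fun_eq_iff)
  have period: "(act ?d ^^ ?m) x = x" if "x \<in> X" for x
    using act_pow[OF d, of ?m x] relation_Delta[OF l] by (simp add: act_one)
  have free: "?m dvd k" if x: "x \<in> X" and fixed: "(act ?d ^^ k) x = x" for x k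
  proof -
    have xG: "x \<in> carrier G" by (rule X_carrier[OF x])
    have "act (?d [^] k) x = x" using act_pow[OF d] fixed by simp
    then have "inv x \<otimes> ?d [^] k \<otimes> x \<in> N" using act_fixed[OF x, of "?d [^] k"] d N(2) by auto
    then have "x \<otimes> (inv x \<otimes> ?d [^] k \<otimes> x) \<otimes> inv x \<in> N" by (rule normal.inv_op_closed2[OF N(1) xG])
    then have "?d [^] k \<in> N" using xG d by (simp add: m_assoc mult_inv_cancel)
    then show ?thesis by (rule order[OF l])
  qed
  obtain h where h: "\<forall>x. h x \<in> torsion_qz n" "\<forall>x\<in>X. cocycle ?d x = h (act ?d x) - h x"
    by (rule C.free_cocycle_is_coboundary[of X "act ?d" ?m "cocycle ?d",
          OF act_X[OF d] period_pos[OF l] period free cocycle_torsion[OF d] sum])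
  define h' where "h' x = (if x \<in> X then h x else 0)" for x
  have "cocycle ?d = coboundary h' (act ?d)"
    using h(2) act_X[OF d] by (auto simp: fun_eq_iff coboundary_def h'_def cocycle_def act_def)
  moreover have "h' \<in> supported_funs X (torsion_qz n)"
    using h(1) by (simp add: supported_funs_def h'_def torsion_qz_def)
  ultimately show ?thesis using that by blast
qed

end

context character_lifting
begin

text \<open>The value at 0 is prescribed so that division keeps a function supported on
  \<open>X\<close>.\<close>

definition divide_n :: "qz \<Rightarrow> qz"
  where "divide_n c = (if c = 0 then 0 else SOME z. nat_mult n z = c)"

lemma nat_mult_divide_n: "nat_mult n (divide_n c) = c"
  using someI_ex[OF qz_divisible[OF n, of c]] by (simp add: divide_n_def)

lemma divide_n_torsion: "c \<in> torsion_qz n \<Longrightarrow> divide_n c \<in> torsion_qz (n * n)"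
  by (simp add: nat_mult_mem_torsion_qz[symmetric] nat_mult_divide_n)

definition hom_Delta :: "nat \<Rightarrow> 'a \<Rightarrow> qz" where
  "hom_Delta l = (SOME h. h \<in> supported_funs X (torsion_qz n) \<and>
    cocycle (gen (Delta l)) = coboundary h (act (gen (Delta l))))"

lemma hom_Delta:
  assumes "l < length ns"
  shows "hom_Delta l \<in> supported_funs X (torsion_qz n)"
    "cocycle (gen (Delta l)) = coboundary (hom_Delta l) (act (gen (Delta l)))"
proof -
  have "\<exists>h. h \<in> supported_funs X (torsion_qz n) \<and> cocycle (gen (Delta l)) = coboundary h (act (gen (Delta l)))"
    using cocycle_Delta[OF assms] by blast
  from someI_ex[OF this] show "hom_Delta l \<in> supported_funs X (torsion_qz n)"
    "cocycle (gen (Delta l)) = coboundary (hom_Delta l) (act (gen (Delta l)))"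
    unfolding hom_Delta_def by blast+
qed

text \<open>For a \<delta> the potential \<open>hom_Delta\<close> is divided, not the cocycle
  itself: the result is again a coboundary, so it respects the period and has total zero. An
  arbitrary division of the cocycle guarantees neither.\<close>

definition lift0 :: "F_gen \<Rightarrow> ('a \<Rightarrow> qz) \<times> ('a \<Rightarrow> 'a)" where
  "lift0 i = (case i of
      Delta l \<Rightarrow> (coboundary (\<lambda>x. divide_n (hom_Delta l x)) (act (gen i)), act (gen i))
    | _ \<Rightarrow> (\<lambda>x. divide_n (cocycle (gen i) x), act (gen i)))"

definition excess :: qz where "excess = (\<Sum>j<r. \<Sum>x\<in>X. fst (lift0 (Gamma j)) x)"

definition base where "base = rep \<one>"

lemma base: "base \<in> X" "base \<in> H"
proof -
  show "base \<in> X" by (simp add: base_def rep_mem)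
  have "inv (inv (rep \<one>) \<otimes> \<one>) \<in> H" using rep(2)[of \<one>] subgroup.m_inv_closed[OF H(1)] by blast
  then show "base \<in> H" using rep(1)[of \<one>] by (simp add: base_def)
qed

text \<open>The lift of one parabolic generator is corrected so that the sum of all coordinates of
  the product relator vanishes. Without parabolic generators this is automatic.\<close>

definition lift1 :: "F_gen \<Rightarrow> ('a \<Rightarrow> qz) \<times> ('a \<Rightarrow> 'a)" where
  "lift1 i = (if i = Gamma 0 then (\<lambda>x. fst (lift0 i) x - point_fun base excess x, snd (lift0 i)) else lift0 i)"

lemma lift0:
  assumes i: "i \<in> Gens"
  shows "lift0 i \<in> carrier (M (n * n))" "scale n (lift0 i) = induced (gen i)"
proof -
  have gi: "gen i \<in> carrier G" by (rule gen_closed[OF i])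
  have p: "act (gen i) permutes X" by (rule act_permutes[OF gi])
  have 0: "divide_n 0 = 0" by (simp add: divide_n_def)
  have "lift0 i \<in> carrier (M (n * n)) \<and> scale n (lift0 i) = induced (gen i)"
  proof (cases "\<exists>l. i = Delta l")
    case True
    then obtain l where l: "i = Delta l" "l < length ns" using i by (auto simp: F_gens_def)
    interpret C: additive_subgroup_set "torsion_qz (n * n)" by (rule additive_torsion_qz)
    have h: "hom_Delta l x \<in> torsion_qz n" "x \<notin> X \<Longrightarrow> hom_Delta l x = 0" for x
      using hom_Delta(1)[OF l(2)] unfolding supported_funs_def by auto
    have "coboundary (\<lambda>x. divide_n (hom_Delta l x)) (act (gen i)) \<in> supported_funs X (torsion_qz (n * n))"
      using C.diff_mem[OF divide_n_torsion[OF h(1)] divide_n_torsion[OF h(1)]]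
      by (simp add: supported_funs_def coboundary_def act_def)
    moreover have "nat_mult n (coboundary (\<lambda>x. divide_n (hom_Delta l x)) (act (gen i)) x)
        = coboundary (hom_Delta l) (act (gen i)) x" for x
      by (simp add: coboundary_def nat_mult_diff nat_mult_divide_n)
    ultimately show ?thesis
      using p hom_Delta(2)[OF l(2)] l(1) by (simp add: lift0_def scale_def induced_def)
  next
    case False
    then have eq: "lift0 i = (\<lambda>x. divide_n (cocycle (gen i) x), act (gen i))"
      by (cases i) (simp_all add: lift0_def)
    have "(\<lambda>x. divide_n (cocycle (gen i) x)) \<in> supported_funs X (torsion_qz (n * n))"
      using divide_n_torsion[OF cocycle_torsion[OF gi]]
      by (simp add: supported_funs_def) (simp add: cocycle_def 0)
    then show ?thesis
      using p by (simp add: eq scale_def induced_def nat_mult_divide_n)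
  qed
  then show "lift0 i \<in> carrier (M (n * n))" "scale n (lift0 i) = induced (gen i)" by blast+
qed

lemma induced_blocks: "blocks_product (M n) (\<lambda>i. induced (gen i)) blocks = \<one>\<^bsub>M n\<^esub>"
proof -
  interpret h: group_hom G "M n" induced
    using induced_hom group_M by (simp add: group_hom_def group_hom_axioms_def group_axioms)
  have "induced (blocks_product G gen blocks) = blocks_product (M n) (\<lambda>i. induced (gen i)) blocks"
    by (rule h.hom_blocks_product) (rule gen_closed, rule block_gens_Gens)
  then show ?thesis using relation_blocks h.hom_one by (simp only:)
qed

lemma induced_gen_closed: "b \<in> set blocks \<Longrightarrow> i \<in> block_gens b \<Longrightarrow> induced (gen i) \<in> carrier (M n)"
  by (rule hom_in_carrier[OF induced_hom gen_closed[OF block_gens_Gens]])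

lemma Gamma_Gens: "j < r \<Longrightarrow> Gamma j \<in> Gens"
  by (simp add: F_gens_def)

text \<open>Multiplied by \<open>n\<close>, the excess becomes the total of the images of the
  parabolic generators under \<open>induced\<close>. The long relation makes that zero, as the
  \<delta>s contribute nothing. So the correction disappears under \<open>scale n\<close>.\<close>

lemma excess_torsion: "excess \<in> torsion_qz n"
proof -
  interpret C: additive_subgroup_set "torsion_qz n" by (rule additive_torsion_qz)
  have "total X (induced (gen (Delta l))) = 0" if l: "l < length ns" for l
    using C.total_coboundary[OF act_permutes[OF gen_closed[OF Delta_Gens[OF l]]]] hom_Delta(2)[OF l]
    by (simp only: induced_def)
  then have "(\<Sum>l<length ns. total X (induced (gen (Delta l)))) = 0" by simp
  moreover have "total X \<one>\<^bsub>M n\<^esub> = 0" by (simp add: total_def)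
  moreover have "total X (blocks_product (M n) (\<lambda>i. induced (gen i)) blocks) =
      (\<Sum>j<r. total X (induced (gen (Gamma j)))) + (\<Sum>l<length ns. total X (induced (gen (Delta l))))"
    using induced_gen_closed by (rule C.total_relator)
  ultimately have "(\<Sum>j<r. total X (induced (gen (Gamma j)))) = 0"
    unfolding induced_blocks by simp
  moreover have "nat_mult n excess = (\<Sum>j<r. \<Sum>x\<in>X. nat_mult n (fst (lift0 (Gamma j)) x))"
    by (simp add: excess_def nat_mult_sum)
  moreover have "(\<Sum>x\<in>X. nat_mult n (fst (lift0 (Gamma j)) x)) = total X (induced (gen (Gamma j)))"
    if "j < r" for j
    using lift0(2)[OF Gamma_Gens[OF that]] unfolding total_def
    by (metis (no_types, lifting) fst_conv scale_def sum.cong)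
  ultimately show ?thesis by (simp add: torsion_qz_def)
qed

lemma lift1:
  assumes i: "i \<in> Gens"
  shows "lift1 i \<in> carrier (M (n * n))" "scale n (lift1 i) = induced (gen i)" "snd (lift1 i) = act (gen i)"
proof -
  have snd: "snd (lift0 i) = act (gen i)" by (cases i) (simp_all add: lift0_def)
  interpret C: additive_subgroup_set "torsion_qz (n * n)" by (rule additive_torsion_qz)
  have e: "excess \<in> torsion_qz (n * n)" using excess_torsion torsion_qz_mono[of n "n * n"] by auto
  have "point_fun base excess \<in> supported_funs X (torsion_qz (n * n))"
    using e base(1) by (auto simp: supported_funs_def point_fun_def)
  then have "(\<lambda>x. fst (lift0 i) x - point_fun base excess x) \<in> supported_funs X (torsion_qz (n * n))"
    using lift0(1)[OF i] by (intro C.supported_funs_diff) simp_all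
  moreover have "nat_mult n (point_fun base excess x) = 0" for x
    using excess_torsion by (simp add: point_fun_def torsion_qz_def)
  ultimately show "lift1 i \<in> carrier (M (n * n))" "scale n (lift1 i) = induced (gen i)"
    "snd (lift1 i) = act (gen i)"
    using lift0[OF i] snd by (auto simp: lift1_def scale_def nat_mult_diff)
qed

lemma total_lift1: "(\<Sum>j<r. \<Sum>x\<in>X. fst (lift1 (Gamma j)) x) = 0"
proof -
  have pt: "(\<Sum>x\<in>X. point_fun base excess x) = excess"
    using finite_X base(1) by (simp add: point_fun_def)
  have "(\<Sum>x\<in>X. fst (lift1 (Gamma j)) x) = (\<Sum>x\<in>X. fst (lift0 (Gamma j)) x) - (if j = 0 then excess else 0)" for j
    by (simp add: lift1_def sum_subtractf pt)
  then have "(\<Sum>j<r. \<Sum>x\<in>X. fst (lift1 (Gamma j)) x) = excess - (\<Sum>j<r. if j = 0 then excess else 0)"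
    by (simp add: sum_subtractf excess_def)
  also have "\<dots> = 0"
  proof (cases "r = 0")
    case True
    have "excess = 0" by (subst excess_def) (simp add: True)
    then show ?thesis by (simp only:) simp
  qed simp
  finally show ?thesis .
qed

lemma X_transitive:
  assumes sub: "Y \<subseteq> X" and x0: "base \<in> Y"
    and closed: "\<And>b i x. b \<in> set blocks \<Longrightarrow> i \<in> block_gens b \<Longrightarrow> x \<in> Y \<Longrightarrow> act (gen i) x \<in> Y"
  shows "Y = X"
proof -
  let ?E = "{d \<in> carrier G. act d ` Y = Y}"
  interpret h: group_hom G "M n" induced
    using induced_hom group_M by (simp add: group_hom_def group_hom_axioms_def group_axioms)
  have finY: "finite Y" using sub finite_X by (rule finite_subset)
  have E: "subgroup ?E G"
  proof (rule subgroupI)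
    have "\<one> \<in> ?E" by (simp add: act_one)
    then show "?E \<noteq> {}" by blast
  next
    fix d assume d: "d \<in> ?E"
    then have "act (inv d) ` (act d ` Y) = Y"
      unfolding image_image using act_mult[of "inv d" d] by (simp add: act_one)
    then show "inv d \<in> ?E" using d by simp
    fix e assume "e \<in> ?E"
    then show "d \<otimes> e \<in> ?E" using d by (simp add: act_mult image_image[symmetric, of "act d" "act e"])
  qed auto
  have "openin T ?E"
  proof (rule openin_supergroup[OF _ induced_open E])
    show "\<one> \<in> kernel G (M n) induced" using h.subgroup_kernel by (rule subgroup.one_closed)
    show "kernel G (M n) induced \<subseteq> ?E" by (auto simp: kernel_def induced_def)
  qed
  moreover have "gen ` Gens \<subseteq> ?E"
  proof
    fix z assume "z \<in> gen ` Gens"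
    then obtain i where i: "i \<in> Gens" "z = gen i" by blast
    then obtain b where b: "b \<in> set blocks" "i \<in> block_gens b" using F_gens_blocks by blast
    have zG: "z \<in> carrier G" using i gen_closed by blast
    have "act z ` Y \<subseteq> Y" using closed[OF b] i(2) by blast
    moreover have "inj_on (act z) Y"
      using permutes_inj[OF act_permutes[OF zG]] by (rule inj_on_subset) simp
    ultimately have "act z ` Y = Y" using finY by (intro endo_inj_surj)
    then show "z \<in> ?E" using zG by simp
  qed
  ultimately have all: "?E = carrier G" by (rule open_subgroup_eq_carrier[OF E])
  have "X \<subseteq> Y"
  proof
    fix x assume x: "x \<in> X"
    have xG: "x \<in> carrier G" by (rule X_carrier[OF x])
    have "rep x = rep (x \<otimes> base)"
      by (rule rep_eq) (use xG base X_carrier[OF base(1)] in \<open>simp_all add: mult_inv_cancel\<close>)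
    then have "act x base = x" using base(1) rep_X[OF x] by (simp add: act_def)
    moreover have "act x ` Y = Y" using all xG by blast
    ultimately show "x \<in> Y" using x0 by (metis imageI)
  qed
  then show ?thesis using sub by blast
qed

sublocale D: monomial_deformation "torsion_qz (n * n)" "torsion_qz n" X base g r "length ns" "\<lambda>i. act (gen i)"
proof (intro monomial_deformation.intro monomial_deformation_axioms.intro)
  show "torsion_qz n \<subseteq> torsion_qz (n * n)" by (rule torsion_qz_mono) simp
  show "act (gen i) permutes X" if "b \<in> set blocks" "i \<in> block_gens b" for b i
    by (rule act_permutes[OF gen_closed[OF block_gens_Gens[OF that]]])
qed (simp_all add: additive_torsion_qz finite_X base(1) X_transitive)

text \<open>\<xi> is \<open>n\<close> times a character, because \<open>induced\<close> lifts along
  \<open>scale n\<close>. At the fixed point \<open>base\<close>, the coefficient of the lifted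
  \<open>x\<close> is killed by \<open>n\<close> since \<open>x [^] n = \<one>\<close>; but
  \<open>n\<close> times this coefficient is the value of \<xi> at \<open>x\<close>.\<close>

theorem character_vanishes:
  assumes x: "x \<in> H" "x [^] n = \<one>"
  shows "\<xi> x = 0"
proof -
  let ?M = "M (n * n)"
  have lifts: "lift1 \<in> D.lifts"
    unfolding D.lifts_def using lift1(1,3)[OF block_gens_Gens] by blast
  have closed: "lift1 i \<in> carrier ?M" if "b \<in> set blocks" "i \<in> block_gens b" for b i
    by (rule lift1(1)[OF block_gens_Gens[OF that]])
  interpret sc: group_hom ?M "M n" "scale n"
    using scale_hom group_M by (simp add: group_hom_def group_hom_axioms_def)
  let ?w = "blocks_product ?M lift1 blocks"
  have w: "?w \<in> carrier ?M" using closed by (rule D.M.blocks_product_closed)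
  have "scale n ?w = blocks_product (M n) (\<lambda>i. scale n (lift1 i)) blocks"
    using closed by (rule sc.hom_blocks_product)
  also have "\<dots> = blocks_product (M n) (\<lambda>i. induced (gen i)) blocks"
    by (rule blocks_product_cong) (rule lift1(2)[OF block_gens_Gens])
  finally have sw: "scale n ?w = (\<lambda>_. 0, id)" unfolding induced_blocks by simp
  then have w_id: "?w = (fst ?w, id)" by (simp add: scale_def prod_eq_iff)
  have "fst ?w x \<in> torsion_qz n" for x
    using sw by (simp add: scale_def torsion_qz_def fun_eq_iff)
  then have wB: "fst ?w \<in> supported_funs X (torsion_qz n)"
    using w by (simp add: supported_funs_def)
  have "total X (lift1 (Delta l)) = 0" if l: "l < length ns" for l
    using D.C.total_coboundary[OF act_permutes[OF gen_closed[OF Delta_Gens[OF l]]]]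
    by (simp add: lift1_def lift0_def)
  then have "total X ?w = 0"
    using D.C.total_relator[of g r "length ns" lift1 X, OF closed] total_lift1 by (simp add: total_def)
  then have sum: "(\<Sum>x\<in>X. fst ?w x) = 0" by (simp add: total_def)
  obtain y where y: "y \<in> D.lifts" "deformation X (torsion_qz n) lift1 y" "blocks_product ?M y blocks = \<one>\<^bsub>?M\<^esub>"
    using D.deform_to_relation[OF lifts w_id wB sum] by blast
  have y_closed: "y i \<in> carrier ?M" "snd (y i) = act (gen i)" if "i \<in> Gens" for i
    using y(1) that unfolding D.lifts_def F_gens_blocks by blast+
  have y_scale: "scale n (y i) = induced (gen i)" if i: "i \<in> Gens" for i
  proof -
    have "nat_mult n (fst (y i) x - fst (lift1 i) x) = 0" for x
      using deformation_fst[OF y(2), of i] by (simp add: supported_funs_def torsion_qz_def)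
    then have "nat_mult n (fst (y i) x) = nat_mult n (fst (lift1 i) x)" for x
      by (simp add: nat_mult_diff)
    then show ?thesis
      using lift1(2)[OF i] deformation_snd[OF y(2), of i] by (simp add: scale_def)
  qed
  have y_Delta: "y (Delta l) [^]\<^bsub>?M\<^esub> (ns ! l) = \<one>\<^bsub>?M\<^esub>" if l: "l < length ns" for l
  proof -
    let ?d = "gen (Delta l)"
    have d: "?d \<in> carrier G" by (rule gen_closed[OF Delta_Gens[OF l]])
    have s: "snd (lift1 (Delta l)) = act ?d" by (rule lift1(3)[OF Delta_Gens[OF l]])
    obtain b where b: "\<forall>x. fst (y (Delta l)) x = fst (lift1 (Delta l)) x + b (act ?d x) - b x"
      using deformation_Delta[OF y(2), of l] unfolding s by blast
    \<comment> \<open>The divided potential plus the potential of the deformation: the deformed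
      tuple is still a coboundary, which is what keeps the period.\<close>
    let ?h = "\<lambda>x. divide_n (hom_Delta l x) + b x"
    have "fst (y (Delta l)) = coboundary ?h (act ?d)"
      using b by (simp add: fun_eq_iff lift1_def lift0_def coboundary_def)
    then have eq: "y (Delta l) = (coboundary ?h (act ?d), act ?d)"
      using y_closed(2)[OF Delta_Gens[OF l]] by (simp add: prod_eq_iff)
    have "act ?d ^^ (ns ! l) = id"
      using act_pow[OF d, of "ns ! l"] relation_Delta[OF l] by (simp add: fun_eq_iff act_one)
    with y_closed(1)[OF Delta_Gens[OF l]] show ?thesis unfolding eq by (rule D.C.pow_coboundary)
  qed
  have fin: "finite (carrier ?M)"
    using finite_X finite_torsion_qz[of "n * n"] n by (intro finite_carrier_monomial_group) simp_all
  obtain \<Psi> where \<Psi>: "\<Psi> \<in> hom G ?M" "\<forall>i\<in>Gens. \<Psi> (gen i) = y i" "openin T (kernel G ?M \<Psi>)"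
    by (rule F_hom_extension[OF group_M fin y_closed(1) y(3) y_Delta])
  interpret \<Psi>: group_hom G ?M \<Psi>
    using \<Psi>(1) group_M by (simp add: group_hom_def group_hom_axioms_def group_axioms)
  have comp: "scale n \<circ> \<Psi> \<in> hom G (M n)" by (rule Group.hom_compose[OF \<Psi>(1) scale_hom])
  interpret comp: group_hom G "M n" "scale n \<circ> \<Psi>"
    using comp group_M by (simp add: group_hom_def group_hom_axioms_def group_axioms)
  have "openin T (kernel G (M n) (scale n \<circ> \<Psi>))"
  proof (rule openin_supergroup[OF _ \<Psi>(3) comp.subgroup_kernel])
    show "\<one> \<in> kernel G ?M \<Psi>" using \<Psi>.subgroup_kernel by (rule subgroup.one_closed)
    show "kernel G ?M \<Psi> \<subseteq> kernel G (M n) (scale n \<circ> \<Psi>)"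
      using sc.hom_one unfolding kernel_def by auto
  qed
  then have eq: "(scale n \<circ> \<Psi>) d = induced d" if "d \<in> carrier G" for d
    by (rule hom_eqI[OF group_M comp induced_hom _ induced_open _ that]) (simp add: \<Psi>(2) y_scale)
  have xG: "x \<in> carrier G" by (rule H_carrier[OF x(1)])
  have bG: "base \<in> carrier G" by (rule X_carrier[OF base(1)])
  have xb: "inv base \<otimes> x \<otimes> base \<in> H"
    using x(1) base(2) H(1) by (simp add: subgroup.m_closed subgroup.m_inv_closed)
  have fixed: "act x base = base" using act_fixed[OF base(1) xG] xb by simp
  have scale_x: "scale n (\<Psi> x) = (cocycle x, act x)" using eq[OF xG] by (simp add: induced_def)
  have "\<Psi> x [^]\<^bsub>?M\<^esub> n = \<one>\<^bsub>?M\<^esub>"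
    using \<Psi>.hom_nat_pow[OF xG, of n] x(2) \<Psi>.hom_one by (simp only:)
  then have "(\<Sum>i<n. fst (\<Psi> x) ((snd (\<Psi> x) ^^ i) base)) = 0"
    using D.C.monomial_group_pow[OF \<Psi>.hom_closed[OF xG], of n] by (simp add: fun_eq_iff)
  moreover have "(snd (\<Psi> x) ^^ i) base = base" for i
    using scale_x fixed by (induction i) (simp_all add: scale_def)
  ultimately have "nat_mult n (fst (\<Psi> x) base) = 0" by (simp add: nat_mult_def)
  then have "cocycle x base = 0" using scale_x by (simp add: scale_def fun_eq_iff)
  moreover have "rep (x \<otimes> base) = base" using fixed base(1) by (simp add: act_def)
  ultimately have "\<xi> (inv base \<otimes> (x \<otimes> base)) = 0" using base(1) by (simp add: cocycle_def)
  moreover have "\<xi> (inv base \<otimes> (x \<otimes> base)) = \<xi> (inv base) + (\<xi> x + \<xi> base)"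
    using x(1) base(2) H(1) by (simp add: \<xi>_mult subgroup.m_closed subgroup.m_inv_closed)
  moreover have "\<xi> \<one> = 0" using U(1,4) by blast
  then have "\<xi> (inv base) + \<xi> base = 0"
    using \<xi>_mult[OF subgroup.m_inv_closed[OF H(1) base(2)] base(2)] bG by simp
  ultimately show ?thesis by (simp add: algebra_simps)
qed

end

section \<open>Torsion-freeness\<close>

text \<open>An element \<open>x\<close> of order \<open>n\<close> in \<open>N\<close> generates together with a small open subgroup \<open>U\<close>
  normalised by \<open>x\<close> an open subgroup with a character which is trivial on \<open>U\<close> but not at \<open>x\<close>.\<close>

theorem (in F_group) torsion_free_if_periods_survive:
  assumes N: "N \<lhd> G" "openin T N"
    and order: "\<And>l j. l < length ns \<Longrightarrow> gen (Delta l) [^] (j::nat) \<in> N \<Longrightarrow> ns ! l dvd j"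
  shows "torsion_free G N"
proof -
  have "x = \<one>" if x: "x \<in> N" and n: "n > 0" and xn: "x [^] n = \<one>" for x and n :: nat
  proof (rule ccontr)
    assume "x \<noteq> \<one>"
    interpret N: normal N G by fact
    have xG: "x \<in> carrier G" using x by (rule N.mem_carrier)
    obtain U0 where U0: "subgroup U0 G" "openin T U0" "x \<notin> U0"
      by (rule open_subgroup_avoiding[OF xG \<open>x \<noteq> \<one>\<close>])
    \<comment> \<open>Intersecting with \<open>N\<close> ensures that the subgroup \<open>H\<close>
      formed below stays inside \<open>N\<close>.\<close>
    define V where "V = U0 \<inter> N"
    have V: "subgroup V G" "openin T V"
      unfolding V_def by (rule subgroups_Inter_pair[OF U0(1) N.subgroup_axioms], rule openin_Int[OF U0(2) N(2)])
    define U where "U = {z \<in> carrier G. \<forall>i::nat. inv (x [^] i) \<otimes> z \<otimes> x [^] i \<in> V}"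
    have pow_mod: "x [^] (i mod n) = x [^] i" for i :: nat
    proof -
      have "x [^] i = x [^] (n * (i div n) + i mod n)" by simp
      also have "\<dots> = (x [^] n) [^] (i div n) \<otimes> x [^] (i mod n)"
        using xG by (simp add: nat_pow_mult nat_pow_pow)
      finally show ?thesis using xn xG by simp
    qed
    have U_eq: "U = carrier G \<inter> (\<Inter>i\<in>{..<n}. {z \<in> carrier G. inv (x [^] i) \<otimes> z \<otimes> x [^] i \<in> V})"
    proof
      show "carrier G \<inter> (\<Inter>i\<in>{..<n}. {z \<in> carrier G. inv (x [^] i) \<otimes> z \<otimes> x [^] i \<in> V}) \<subseteq> U"
      proof
        fix z assume z: "z \<in> carrier G \<inter> (\<Inter>i\<in>{..<n}. {z \<in> carrier G. inv (x [^] i) \<otimes> z \<otimes> x [^] i \<in> V})"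
        have "inv (x [^] i) \<otimes> z \<otimes> x [^] i \<in> V" for i :: nat
        proof -
          have "i mod n \<in> {..<n}" using n by simp
          then have "inv (x [^] (i mod n)) \<otimes> z \<otimes> x [^] (i mod n) \<in> V" using z by blast
          then show ?thesis by (simp only: pow_mod)
        qed
        then show "z \<in> U" using z by (simp add: U_def)
      qed
    qed (auto simp: U_def)
    have U_open: "openin T U"
      unfolding U_eq by (rule openin_finite_INT) (use xG in \<open>simp_all add: openin_conjugate[OF V(2)]\<close>)
    have "subgroup (\<Inter>i\<in>(UNIV::nat set). {z \<in> carrier G. inv (x [^] i) \<otimes> z \<otimes> x [^] i \<in> V}) G"
      by (rule subgroups_Inter) (use xG subgroup_conjugate[OF V(1)] in auto)
    moreover have "(\<Inter>i\<in>(UNIV::nat set). {z \<in> carrier G. inv (x [^] i) \<otimes> z \<otimes> x [^] i \<in> V}) = U"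
      by (auto simp: U_def)
    ultimately have U: "subgroup U G" by (simp only:)
    have UG: "u \<in> carrier G" if "u \<in> U" for u using that by (simp add: U_def)
    have UV: "u \<in> V" if "u \<in> U" for u
    proof -
      have "inv (x [^] (0::nat)) \<otimes> u \<otimes> x [^] (0::nat) \<in> V" using that unfolding U_def by blast
      then show ?thesis using UG[OF that] by simp
    qed
    have U_conj: "inv (x [^] j) \<otimes> u \<otimes> x [^] j \<in> U" if u: "u \<in> U" for u and j :: nat
    proof -
      have "inv (x [^] i) \<otimes> (inv (x [^] j) \<otimes> u \<otimes> x [^] j) \<otimes> x [^] i \<in> V" for i :: nat
      proof -
        have "inv (x [^] (j + i)) \<otimes> u \<otimes> x [^] (j + i) \<in> V" using u unfolding U_def by blast
        then show ?thesis using xG UG[OF u] by (simp add: nat_pow_mult[symmetric] inv_mult_group m_assoc)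
      qed
      then show ?thesis using xG UG[OF u] by (simp add: U_def)
    qed
    \<comment> \<open>The order of \<open>x\<close> modulo \<open>U\<close>; the character below
      takes the value 1/m at \<open>x\<close>.\<close>
    define m where "m = (LEAST m::nat. m > 0 \<and> x [^] m \<in> U)"
    have "n > 0 \<and> x [^] n \<in> U" using n xn subgroup.one_closed[OF U] by simp
    then have "m > 0 \<and> x [^] m \<in> U" unfolding m_def by (rule LeastI[of "\<lambda>m::nat. m > 0 \<and> x [^] m \<in> U" n])
    then have m: "m > 0" "x [^] m \<in> U" by auto
    have least: "\<not> (k > 0 \<and> x [^] k \<in> U)" if "k < m" for k :: nat
      using that unfolding m_def by (rule not_less_Least)
    have m_dvd: "m dvd i" if i: "x [^] i \<in> U" for i :: nat
    proof -
      have "(x [^] m) [^] k \<in> U" for k :: nat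
        by (induction k) (simp_all add: m(2) subgroup.one_closed[OF U] subgroup.m_closed[OF U])
      then have "(x [^] m) [^] (i div m) \<in> U" .
      moreover have "x [^] i = (x [^] m) [^] (i div m) \<otimes> x [^] (i mod m)"
        using xG by (simp add: nat_pow_mult nat_pow_pow)
      ultimately have "inv ((x [^] m) [^] (i div m)) \<otimes> ((x [^] m) [^] (i div m) \<otimes> x [^] (i mod m)) \<in> U"
        using i subgroup.m_closed[OF U] subgroup.m_inv_closed[OF U] by simp
      then have mem: "x [^] (i mod m) \<in> U" using xG by (simp add: mult_inv_cancel)
      have "i mod m < m" using m(1) by simp
      then have "\<not> (i mod m > 0 \<and> x [^] (i mod m) \<in> U)" by (rule least)
      then have "\<not> i mod m > 0" using mem by simp
      then have "i mod m = 0" by simp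
      then show ?thesis by (rule mod_0_imp_dvd)
    qed
    define H where "H = {x [^] i \<otimes> u | (i::nat) u. u \<in> U}"
    \<comment> \<open>An element \<open>x [^] i \<otimes> u\<close> is sent to i/m. The exponent is
      determined modulo \<open>m\<close>, so the choice does not matter.\<close>
    define \<xi> where "\<xi> s = nat_mult (SOME i::nat. \<exists>u\<in>U. s = x [^] i \<otimes> u) (unit_qz m)" for s
    have exp_eq: "nat_mult i (unit_qz m) = nat_mult k (unit_qz m)"
      if eq: "x [^] i \<otimes> u = x [^] k \<otimes> w" and u: "u \<in> U" and w: "w \<in> U" and le: "i \<le> k" for i k :: nat and u w
    proof -
      have "x [^] k = x [^] i \<otimes> x [^] (k - i)" using le xG by (simp add: nat_pow_mult)
      then have "x [^] i \<otimes> u = x [^] i \<otimes> (x [^] (k - i) \<otimes> w)"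
        using eq xG UG[OF w] by (simp add: m_assoc)
      then have "u = x [^] (k - i) \<otimes> w" using xG UG[OF u] UG[OF w] by simp
      then have "x [^] (k - i) = u \<otimes> inv w" using xG UG[OF w] by (simp add: m_assoc)
      then have "x [^] (k - i) \<in> U" using u w subgroup.m_closed[OF U] subgroup.m_inv_closed[OF U] by simp
      then have "nat_mult (k - i) (unit_qz m) = 0" using m_dvd nat_mult_unit_qz_eq_0_iff[OF m(1)] by blast
      then show ?thesis using nat_mult_add_left[of i "k - i" "unit_qz m"] le by simp
    qed
    have \<xi>: "\<xi> (x [^] i \<otimes> u) = nat_mult i (unit_qz m)" if u: "u \<in> U" for i :: nat and u
    proof -
      let ?k = "SOME k::nat. \<exists>w\<in>U. x [^] i \<otimes> u = x [^] k \<otimes> w"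
      have "\<exists>w\<in>U. x [^] i \<otimes> u = x [^] i \<otimes> w" using u by blast
      then have "\<exists>w\<in>U. x [^] i \<otimes> u = x [^] ?k \<otimes> w" by (rule someI)
      then obtain w where w: "w \<in> U" "x [^] i \<otimes> u = x [^] ?k \<otimes> w" by blast
      have "nat_mult i (unit_qz m) = nat_mult ?k (unit_qz m)"
      proof (cases "i \<le> ?k")
        case True
        then show ?thesis by (rule exp_eq[OF w(2) u w(1)])
      next
        case False
        then have "?k \<le> i" by simp
        then show ?thesis by (rule exp_eq[OF w(2)[symmetric] w(1) u, symmetric])
      qed
      then show ?thesis by (simp add: \<xi>_def)
    qed
    have mult: "(x [^] i \<otimes> u) \<otimes> (x [^] k \<otimes> w) = x [^] (i + k) \<otimes> ((inv (x [^] k) \<otimes> u \<otimes> x [^] k) \<otimes> w)"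
      if "u \<in> U" "w \<in> U" for i k :: nat and u w
      using xG UG[OF that(1)] UG[OF that(2)] by (simp add: nat_pow_mult[symmetric] m_assoc mult_inv_cancel)
    have H_sub: "subgroup H G"
    proof (rule subgroupI)
      show "H \<subseteq> carrier G" using xG UG by (auto simp: H_def)
      show "H \<noteq> {}" using subgroup.one_closed[OF U] by (auto simp: H_def)
      fix s assume "s \<in> H"
      then obtain i :: nat and u where s: "s = x [^] i \<otimes> u" "u \<in> U" by (auto simp: H_def)
      \<comment> \<open>Exponents are natural numbers, so the inverse of \<open>x [^] i\<close> is
        expressed as this power, using \<open>x [^] n = \<one>\<close>.\<close>
      let ?k = "i * (n - 1)"
      have "?k + i = n * i" using n by (cases n) simp_all
      then have "x [^] ?k \<otimes> x [^] i = (x [^] n) [^] i"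
        using xG by (simp only: nat_pow_mult nat_pow_pow)
      then have "x [^] ?k \<otimes> x [^] i = \<one>" by (simp add: xn)
      then have k: "inv (x [^] i) = x [^] ?k" using xG by (simp add: inv_equality)
      have "inv s = x [^] ?k \<otimes> (inv (x [^] ?k) \<otimes> inv u \<otimes> x [^] ?k)"
        using xG UG[OF s(2)] s(1) by (simp add: inv_mult_group k m_assoc mult_inv_cancel)
      then show "inv s \<in> H"
        using U_conj[OF subgroup.m_inv_closed[OF U s(2)], of ?k] unfolding H_def by blast
      fix s' assume "s' \<in> H"
      then obtain k :: nat and w where s': "s' = x [^] k \<otimes> w" "w \<in> U" by (auto simp: H_def)
      have "(inv (x [^] k) \<otimes> u \<otimes> x [^] k) \<otimes> w \<in> U"
        by (rule subgroup.m_closed[OF U U_conj[OF s(2)] s'(2)])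
      then show "s \<otimes> s' \<in> H" unfolding s(1) s'(1) mult[OF s(2) s'(2)] H_def by blast
    qed
    have UH: "U \<subseteq> H"
    proof
      fix u assume u: "u \<in> U"
      then have "u = x [^] (0::nat) \<otimes> u" using UG by simp
      then show "u \<in> H" using u unfolding H_def by blast
    qed
    have "character_lifting G T g r ns \<phi> H U N \<xi> n"
    proof (intro character_lifting.intro character_lifting_axioms.intro F_group_axioms)
      show "subgroup H G" "U \<subseteq> H" "openin T U" "\<one> \<in> U" "N \<lhd> G" "n > 0"
        using H_sub UH U_open subgroup.one_closed[OF U] N n by auto
      show "openin T H" by (rule openin_supergroup[OF subgroup.one_closed[OF U] U_open H_sub UH])
      show "\<xi> u = 0" if "u \<in> U" for u using \<xi>[OF that, of 0] UG[OF that] by simp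
      have xN: "x [^] i \<in> N" for i :: nat by (induction i) (simp_all add: x)
      show "H \<subseteq> N" using xN UV by (auto simp: H_def V_def)
      have "m dvd n" using m_dvd[of n] xn subgroup.one_closed[OF U] by simp
      then have t: "nat_mult i (unit_qz m) \<in> torsion_qz n" for i
        using nat_mult_unit_qz_eq_0_iff[OF m(1), of "n * i"] by (simp add: torsion_qz_def flip: nat_mult_mult)
      show "\<xi> s \<in> torsion_qz n" if "s \<in> H" for s using that \<xi> t by (auto simp: H_def)
      show "\<xi> (s \<otimes> s') = \<xi> s + \<xi> s'" if ss: "s \<in> H" "s' \<in> H" for s s'
      proof -
        obtain i u where s: "s = x [^] (i::nat) \<otimes> u" "u \<in> U" using ss(1) by (auto simp: H_def)
        obtain k w where s': "s' = x [^] (k::nat) \<otimes> w" "w \<in> U" using ss(2) by (auto simp: H_def)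
        have "(inv (x [^] k) \<otimes> u \<otimes> x [^] k) \<otimes> w \<in> U"
          by (rule subgroup.m_closed[OF U U_conj[OF s(2)] s'(2)])
        then show ?thesis
          unfolding s(1) s'(1) mult[OF s(2) s'(2)] by (simp add: \<xi> s(2) s'(2) nat_mult_add_left)
      qed
      show "ns ! l dvd j" if "l < length ns" "gen (Delta l) [^] j \<in> N" for l j using that by (rule order)
    qed
    note vanishes = character_lifting.character_vanishes[OF this _ xn]
    have x1: "x [^] (1::nat) \<otimes> \<one> = x" using xG by simp
    have "x [^] (1::nat) \<otimes> \<one> \<in> H" using subgroup.one_closed[OF U] unfolding H_def by blast
    then have "\<xi> x = 0" unfolding x1 by (rule vanishes)
    moreover have "\<xi> x = nat_mult 1 (unit_qz m)"
      using \<xi>[OF subgroup.one_closed[OF U], of 1] unfolding x1 .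
    ultimately have "nat_mult 1 (unit_qz m) = 0" by simp
    then have "m dvd 1" using nat_mult_unit_qz_eq_0_iff[OF m(1)] by blast
    then have "x [^] (1::nat) \<in> U" using m(2) by simp
    then have "x \<in> V" using UV xG by simp
    then show False using U0(3) by (simp add: V_def)
  qed
  then show ?thesis unfolding torsion_free_def by blast
qed

section \<open>Quotients by open normal subgroups\<close>

context topological_group
begin

lemma quotient_topology_open_normal:
  assumes N: "N \<lhd> G" "openin T N"
  shows "quotient_topology G T N = discrete_topology (carrier (G Mod N))"
proof -
  interpret N: normal N G by fact
  have "openin T (\<Union>W)" if W: "W \<subseteq> carrier (G Mod N)" for W
  proof (rule openin_Union)
    fix A assume "A \<in> W"
    then obtain x where x: "x \<in> carrier G" "A = N #> x" using W by (auto simp: FactGroup_def RCOSETS_def)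
    have "{z \<in> carrier G. z \<otimes> inv x \<in> N} = N #> x"
    proof
      show "{z \<in> carrier G. z \<otimes> inv x \<in> N} \<subseteq> N #> x"
      proof
        fix z assume z: "z \<in> {z \<in> carrier G. z \<otimes> inv x \<in> N}"
        then have "z = (z \<otimes> inv x) \<otimes> x" using x(1) by (simp add: m_assoc)
        then show "z \<in> N #> x" using z unfolding r_coset_def by blast
      qed
      show "N #> x \<subseteq> {z \<in> carrier G. z \<otimes> inv x \<in> N}"
        using x(1) N.mem_carrier by (auto simp: r_coset_def m_assoc)
    qed
    then show "openin T A" using openin_translate(2)[OF N(2), of "inv x"] x by simp
  qed
  then have "openin (quotient_topology G T N) W \<longleftrightarrow> openin (discrete_topology (carrier (G Mod N))) W" for W
    using openin_quotient_topology[OF N(1)] by auto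
  then show ?thesis by (simp add: topology_eq)
qed

text \<open>The quotient is discrete and closures do nothing, so from here on the abstract derived
  series can be used.\<close>

lemma closed_derived_open_normal:
  assumes N: "N \<lhd> G" "openin T N"
  shows "closed_derived (G Mod N) (quotient_topology G T N) m = (derived (G Mod N) ^^ m) (carrier (G Mod N))"
proof (induction m)
  case (Suc m)
  interpret Q: group "G Mod N" using N(1) by (rule normal.factorgroup_is_group)
  have "derived (G Mod N) ((derived (G Mod N) ^^ m) (carrier (G Mod N))) \<subseteq> carrier (G Mod N)"
    by (rule Q.derived_in_carrier[OF Q.exp_of_derived_in_carrier]) simp
  then show ?case
    using Suc by (simp add: quotient_topology_open_normal[OF N] discrete_topology_closure_of Int_absorb1)
qed simp

lemma derived_length_quotient_le:
  assumes N: "N \<lhd> G" "openin T N" and d: "(derived G ^^ d) (carrier G) \<subseteq> N"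
  shows "derived_length (G Mod N) (quotient_topology G T N) \<le> enat d"
proof -
  interpret N: normal N G by fact
  interpret Q: group "G Mod N" by (rule N.factorgroup_is_group)
  interpret p: group_hom G "G Mod N" "\<lambda>x. N #> x"
    using N.r_coset_hom_Mod by (simp add: group_hom_def group_hom_axioms_def group_axioms Q.group_axioms)
  have car: "carrier (G Mod N) = (\<lambda>x. N #> x) ` carrier G" by (rule carrier_FactGroup)
  have "(derived (G Mod N) ^^ d) (carrier (G Mod N)) = (\<lambda>x. N #> x) ` ((derived G ^^ d) (carrier G))"
    unfolding car by (rule p.exp_of_derived_img) simp
  also have "\<dots> \<subseteq> {N}"
  proof
    fix A assume "A \<in> (\<lambda>x. N #> x) ` ((derived G ^^ d) (carrier G))"
    then obtain x where "x \<in> N" "A = N #> x" using d by blast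
    then show "A \<in> {N}" using coset_join2[OF N.mem_carrier N.subgroup_axioms] by simp
  qed
  finally have sub: "(derived (G Mod N) ^^ d) (carrier (G Mod N)) \<subseteq> {N}" .
  moreover have "N \<in> (derived (G Mod N) ^^ d) (carrier (G Mod N))"
    using subgroup.one_closed[OF Q.exp_of_derived_is_subgroup[OF Q.subgroup_self], of d] by simp
  ultimately have "closed_derived (G Mod N) (quotient_topology G T N) d = {\<one>\<^bsub>G Mod N\<^esub>}"
    unfolding closed_derived_open_normal[OF N] by auto
  then show ?thesis unfolding derived_length_def by (intro Inf_lower) simp
qed

lemma comm_group_quotient:
  assumes N: "N \<lhd> G" and d: "derived G (carrier G) \<subseteq> N"
  shows "comm_group (G Mod N)"
proof -
  interpret N: normal N G by fact
  interpret Q: group "G Mod N" by (rule N.factorgroup_is_group)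
  show ?thesis
  proof (rule Q.group_comm_groupI)
    fix A B assume "A \<in> carrier (G Mod N)" "B \<in> carrier (G Mod N)"
    then obtain x y where x: "x \<in> carrier G" "A = N #> x" and y: "y \<in> carrier G" "B = N #> y"
      by (auto simp: FactGroup_def RCOSETS_def)
    have "x \<otimes> y \<otimes> inv x \<otimes> inv y \<in> derived_set G (carrier G)" using x(1) y(1) by blast
    then have "x \<otimes> y \<otimes> inv x \<otimes> inv y \<in> N"
      using d generate.incl[of _ "derived_set G (carrier G)" G] unfolding derived_def by blast
    moreover have "x \<otimes> y = (x \<otimes> y \<otimes> inv x \<otimes> inv y) \<otimes> (y \<otimes> x)"
      using x(1) y(1) by (simp add: m_assoc mult_inv_cancel)
    ultimately have "x \<otimes> y \<in> N #> (y \<otimes> x)" unfolding r_coset_def by blast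
    then have "N #> (y \<otimes> x) = N #> (x \<otimes> y)"
      using x(1) y(1) by (intro repr_independence[OF _ _ N.subgroup_axioms]) simp_all
    then show "A \<otimes>\<^bsub>G Mod N\<^esub> B = B \<otimes>\<^bsub>G Mod N\<^esub> A"
      unfolding x(2) y(2) using N.rcos_sum[OF x(1) y(1)] N.rcos_sum[OF y(1) x(1)] by simp
  qed
qed

end

section \<open>Finite quotients preserving the periods\<close>

definition additive_group :: "'c::ab_group_add set \<Rightarrow> 'c monoid"
  where "additive_group C = \<lparr>carrier = C, mult = (+), one = 0\<rparr>"

lemma additive_group_simps [simp]:
  "carrier (additive_group C) = C" "mult (additive_group C) = (+)" "one (additive_group C) = 0"
  by (simp_all add: additive_group_def)

lemma (in additive_subgroup_set) comm_group_additive_group: "comm_group (additive_group C)"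
proof (rule comm_groupI)
  fix x assume "x \<in> carrier (additive_group C)"
  then show "\<exists>y\<in>carrier (additive_group C). y \<otimes>\<^bsub>additive_group C\<^esub> x = \<one>\<^bsub>additive_group C\<^esub>"
    by (intro bexI[of _ "- x"]) (simp_all add: uminus_mem)
qed (simp_all add: add_mem add.assoc add.commute)

lemma pow_additive_group: "x [^]\<^bsub>additive_group C\<^esub> (k::nat) = nat_mult k x"
  by (induction k) (simp_all add: nat_mult_Suc add.commute)

lemma (in additive_subgroup_set) blocks_product_additive_group:
  assumes "\<And>b i. b \<in> set (relator_blocks g r k) \<Longrightarrow> i \<in> block_gens b \<Longrightarrow> q i \<in> C"
  shows "blocks_product (additive_group C) q (relator_blocks g r k) =
    (\<Sum>j<r. q (Gamma j)) + (\<Sum>l<k. q (Delta l))"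
proof -
  interpret A: comm_group "additive_group C" by (rule comm_group_additive_group)
  have inv: "inv\<^bsub>additive_group C\<^esub> x = - x" if "x \<in> C" for x
    by (rule A.inv_equality) (use that in \<open>simp_all add: uminus_mem\<close>)
  have "blocks_product (additive_group C) q bs = (\<Sum>b\<leftarrow>bs. if b \<in> range Alpha then 0 else q b)"
    if "\<And>b i. b \<in> set bs \<Longrightarrow> i \<in> block_gens b \<Longrightarrow> q i \<in> C" for bs
    using that
  proof (induction bs)
    case (Cons b bs)
    have "block_value (additive_group C) q b = (if b \<in> range Alpha then 0 else q b)"
    proof (cases b)
      case (Alpha i)
      have "q (Alpha i) \<in> C" "q (Beta i) \<in> C" by (rule Cons.prems[of b], simp, simp add: Alpha)+
      then show ?thesis by (simp add: Alpha block_value_def commutator_def inv)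
    qed (auto simp: block_value_def)
    moreover have "blocks_product (additive_group C) q bs = (\<Sum>b\<leftarrow>bs. if b \<in> range Alpha then 0 else q b)"
      by (rule Cons.IH) (use Cons.prems in \<open>meson list.set_intros(2)\<close>)
    ultimately show ?case by simp
  qed simp
  from this[OF assms] have "blocks_product (additive_group C) q (relator_blocks g r k) =
      (\<Sum>b\<leftarrow>relator_blocks g r k. if b \<in> range Alpha then 0 else q b)" .
  moreover have "Gamma j \<notin> range Alpha" "Delta j \<notin> range Alpha" for j by auto
  ultimately show ?thesis
    by (simp add: relator_blocks_def o_def interv_sum_list_conv_sum_set_nat atLeast0LessThan)
qed

lemma (in group_hom) derived_subset_kernel:
  assumes A: "A \<subseteq> carrier G" and comm: "\<And>x y. x \<in> A \<Longrightarrow> y \<in> A \<Longrightarrow> h x \<otimes>\<^bsub>H\<^esub> h y = h y \<otimes>\<^bsub>H\<^esub> h x"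
  shows "derived G A \<subseteq> kernel G H h"
proof -
  have "derived_set G A \<subseteq> kernel G H h"
  proof
    fix z assume "z \<in> derived_set G A"
    then obtain x y where xy: "x \<in> A" "y \<in> A" "z = x \<otimes> y \<otimes> inv x \<otimes> inv y" by blast
    then have c: "x \<in> carrier G" "y \<in> carrier G" using A by auto
    have "h z = h x \<otimes>\<^bsub>H\<^esub> h y \<otimes>\<^bsub>H\<^esub> inv\<^bsub>H\<^esub> h x \<otimes>\<^bsub>H\<^esub> inv\<^bsub>H\<^esub> h y"
      using c xy(3) by simp
    also have "\<dots> = h y \<otimes>\<^bsub>H\<^esub> h x \<otimes>\<^bsub>H\<^esub> inv\<^bsub>H\<^esub> h x \<otimes>\<^bsub>H\<^esub> inv\<^bsub>H\<^esub> h y"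
      using comm[OF xy(1,2)] by simp
    also have "\<dots> = \<one>\<^bsub>H\<^esub>" using c by (simp add: H.m_assoc)
    finally show "z \<in> kernel G H h" using c xy(3) by (simp add: kernel_def)
  qed
  then show ?thesis
    unfolding derived_def by (rule G.generate_subgroup_incl[OF _ subgroup_kernel])
qed

context F_group
begin

text \<open>By compactness, such a \<open>V\<close> is the kernel of a finite quotient of derived
  length at most \<open>d\<close>.\<close>

definition derived_open_normal :: "nat \<Rightarrow> 'a set \<Rightarrow> bool"
  where "derived_open_normal d V \<longleftrightarrow> V \<lhd> G \<and> openin T V \<and> (derived G ^^ d) (carrier G) \<subseteq> V"

lemma derived_open_normal_Inter:
  assumes "finite I" "\<And>i. i \<in> I \<Longrightarrow> derived_open_normal d (V i)"
  obtains W where "derived_open_normal d W" "\<forall>i\<in>I. W \<subseteq> V i"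
proof -
  have "\<exists>W. derived_open_normal d W \<and> (\<forall>i\<in>I. W \<subseteq> V i)"
    using assms
  proof (induction I rule: finite_induct)
    case empty
    have "openin T (carrier G)" using topspace_eq openin_topspace[of T] by simp
    moreover have "carrier G \<lhd> G" by (auto simp: normal_inv_iff subgroup_self)
    ultimately have "derived_open_normal d (carrier G)"
      using exp_of_derived_in_carrier[of "carrier G" d] by (simp add: derived_open_normal_def)
    then show ?case by blast
  next
    case (insert i I)
    then obtain W where W: "derived_open_normal d W" "\<forall>i\<in>I. W \<subseteq> V i" by blast
    have "derived_open_normal d (W \<inter> V i)"
      using W(1) insert.prems[of i] normal_subgroup_intersect[of W "V i"] by (auto simp: derived_open_normal_def)
    then show ?case using W(2) by blast
  qed
  then show ?thesis using that by blast
qed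

lemma derived_open_normal_kernel:
  assumes "group Q" "\<Psi> \<in> hom G Q" "openin T (kernel G Q \<Psi>)" "(derived G ^^ d) (carrier G) \<subseteq> kernel G Q \<Psi>"
  shows "derived_open_normal d (kernel G Q \<Psi>)"
proof -
  interpret h: group_hom G Q \<Psi>
    using assms by (simp add: group_hom_def group_hom_axioms_def group_axioms)
  show ?thesis using assms h.normal_kernel by (simp add: derived_open_normal_def)
qed

lemma derived_open_normal_mono:
  assumes "derived_open_normal d V" "d \<le> d'"
  shows "derived_open_normal d' V"
proof -
  have "(derived G ^^ (k + d)) (carrier G) \<subseteq> (derived G ^^ d) (carrier G)" for k
  proof (induction k)
    case (Suc k)
    have "derived G ((derived G ^^ (k + d)) (carrier G)) \<subseteq> (derived G ^^ (k + d)) (carrier G)"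
      by (rule derived_incl[OF subset_refl]) (rule exp_of_derived_is_subgroup[OF subgroup_self])
    then show ?case using Suc by simp
  qed simp
  from this[of "d' - d"] show ?thesis using assms by (auto simp: derived_open_normal_def)
qed

text \<open>The periods can be treated one at a time: the intersection of the subgroups
  \<open>V\<close> preserves all of them with the same \<open>d\<close>, and so does its
  characteristic core, which is then torsion-free.\<close>

theorem derived_open_normal_characteristic:
  assumes "\<And>l. l < length ns \<Longrightarrow>
    \<exists>V. derived_open_normal d V \<and> (\<forall>j::nat. gen (Delta l) [^] j \<in> V \<longrightarrow> ns ! l dvd j)"
  shows "\<exists>N. torsion_free_open_characteristic N G T \<and> N \<lhd> G \<and> openin T N \<and> (derived G ^^ d) (carrier G) \<subseteq> N"
proof -
  obtain V where V: "\<forall>l<length ns. derived_open_normal d (V l) \<and> (\<forall>j::nat. gen (Delta l) [^] j \<in> V l \<longrightarrow> ns ! l dvd j)"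
    using assms by metis
  obtain W where W: "derived_open_normal d W" "\<forall>l\<in>{..<length ns}. W \<subseteq> V l"
    by (rule derived_open_normal_Inter[of "{..<length ns}" d V]) (use V in auto)
  let ?N = "char_core W"
  have Wn: "W \<lhd> G" "openin T W" "(derived G ^^ d) (carrier G) \<subseteq> W" using W(1) by (auto simp: derived_open_normal_def)
  have sub: "?N \<subseteq> W" by (rule char_core_subset) (use Wn(1) in \<open>simp add: normal_def subgroup.subset\<close>)
  have N: "?N \<lhd> G" "openin T ?N" by (rule normal_char_core[OF Wn(1)], rule open_char_core[OF Wn(1,2)])
  have "torsion_free G ?N"
    by (rule torsion_free_if_periods_survive[OF N]) (use V W(2) sub in blast)
  then show ?thesis
    using N characteristic_char_core[OF Wn(1)] derived_subset_char_core[OF Wn(3)]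
    unfolding torsion_free_open_characteristic_def by blast
qed

text \<open>In an abelian target the long relation reduces to \<open>sum\<close>, and the values at
  the \<open>Alpha\<close> and \<open>Beta\<close> generators are free.\<close>

lemma derived_open_normal_abelian:
  assumes L: "L > 0" and q: "\<And>i. i \<in> Gens \<Longrightarrow> q i \<in> torsion_qz L"
    and sum: "(\<Sum>j<r. q (Gamma j)) + (\<Sum>l<length ns. q (Delta l)) = 0"
    and period: "\<And>l. l < length ns \<Longrightarrow> nat_mult (ns ! l) (q (Delta l)) = 0"
  obtains V where "derived_open_normal 1 V" "\<forall>l<length ns. \<forall>j::nat. gen (Delta l) [^] j \<in> V \<longrightarrow> nat_mult j (q (Delta l)) = 0"
proof -
  interpret C: additive_subgroup_set "torsion_qz L" by (rule additive_torsion_qz)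
  let ?Q = "additive_group (torsion_qz L)"
  interpret Q: comm_group ?Q by (rule C.comm_group_additive_group)
  have "blocks_product ?Q q blocks = \<one>\<^bsub>?Q\<^esub>"
    using C.blocks_product_additive_group[of g r "length ns" q, OF q[OF block_gens_Gens]] sum by simp
  moreover have "q (Delta l) [^]\<^bsub>?Q\<^esub> (ns ! l) = \<one>\<^bsub>?Q\<^esub>" if "l < length ns" for l
    using period[OF that] by (simp add: pow_additive_group)
  moreover have "finite (carrier ?Q)" using finite_torsion_qz[OF L] by simp
  moreover have "q i \<in> carrier ?Q" if "i \<in> Gens" for i using q[OF that] by simp
  ultimately obtain \<Psi> where \<Psi>: "\<Psi> \<in> hom G ?Q" "\<forall>i\<in>Gens. \<Psi> (gen i) = q i" "openin T (kernel G ?Q \<Psi>)"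
    using F_hom_extension[OF Q.group_axioms, of q] by metis
  interpret h: group_hom G ?Q \<Psi>
    using \<Psi>(1) Q.group_axioms by (simp add: group_hom_def group_hom_axioms_def group_axioms)
  have "derived G (carrier G) \<subseteq> kernel G ?Q \<Psi>"
    by (rule h.derived_subset_kernel) (simp_all add: add.commute)
  then have "derived_open_normal 1 (kernel G ?Q \<Psi>)"
    by (intro derived_open_normal_kernel[OF Q.group_axioms \<Psi>(1,3)]) simp
  moreover have "nat_mult j (q (Delta l)) = 0" if l: "l < length ns" "gen (Delta l) [^] j \<in> kernel G ?Q \<Psi>" for l and j :: nat
  proof -
    have "\<Psi> (gen (Delta l) [^] j) = 0" using l(2) by (simp add: kernel_def)
    then show ?thesis
      using h.hom_nat_pow[OF gen_closed[OF Delta_Gens[OF l(1)]], of j] \<Psi>(2) Delta_Gens[OF l(1)]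
      by (simp add: pow_additive_group)
  qed
  ultimately show ?thesis using that by blast
qed

text \<open>\<open>y\<close> has the wanted coefficients but may violate the long relation.
  \<open>y'\<close> satisfies it and shows that the permutations of \<open>y\<close> multiply to the
  identity. Deformations range over all of \<open>torsion_qz n\<close> here, so the error is removed
  once its total is zero.\<close>

lemma monomial_hom:
  fixes y :: "F_gen \<Rightarrow> ('x \<Rightarrow> qz) \<times> ('x \<Rightarrow> 'x)"
  assumes n: "n > 0" and X: "finite X" "x0 \<in> X"
    and y: "\<And>i. i \<in> Gens \<Longrightarrow> y i \<in> carrier (monomial_group X (torsion_qz n))"
    and transitive: "\<And>Y. Y \<subseteq> X \<Longrightarrow> x0 \<in> Y \<Longrightarrow> (\<And>i x. i \<in> Gens \<Longrightarrow> x \<in> Y \<Longrightarrow> snd (y i) x \<in> Y) \<Longrightarrow> Y = X"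
    and y': "\<And>i. i \<in> Gens \<Longrightarrow> y' i \<in> carrier (monomial_group X (torsion_qz n)) \<and> snd (y' i) = snd (y i)"
      "blocks_product (monomial_group X (torsion_qz n)) y' blocks = \<one>\<^bsub>monomial_group X (torsion_qz n)\<^esub>"
    and sum: "(\<Sum>j<r. total X (y (Gamma j))) + (\<Sum>l<length ns. total X (y (Delta l))) = 0"
    and period: "\<And>l. l < length ns \<Longrightarrow>
      y (Delta l) [^]\<^bsub>monomial_group X (torsion_qz n)\<^esub> (ns ! l) = \<one>\<^bsub>monomial_group X (torsion_qz n)\<^esub>"
  obtains \<Psi> where "\<Psi> \<in> hom G (monomial_group X (torsion_qz n))"
    "openin T (kernel G (monomial_group X (torsion_qz n)) \<Psi>)"
    "\<forall>i\<in>Gens. snd (\<Psi> (gen i)) = snd (y i)"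
    "\<forall>l<length ns. \<exists>b. \<forall>x. fst (\<Psi> (gen (Delta l))) x = fst (y (Delta l)) x + coboundary b (snd (y (Delta l))) x"
proof -
  let ?M = "monomial_group X (torsion_qz n)"
  have y_blocks: "y i \<in> carrier ?M" if "b \<in> set blocks" "i \<in> block_gens b" for b i
    by (rule y[OF block_gens_Gens[OF that]])
  interpret D: monomial_deformation "torsion_qz n" "torsion_qz n" X x0 g r "length ns" "\<lambda>i. snd (y i)"
  proof (intro monomial_deformation.intro monomial_deformation_axioms.intro)
    fix Y assume "Y \<subseteq> X" "x0 \<in> Y"
      "\<And>b i x. b \<in> set blocks \<Longrightarrow> i \<in> block_gens b \<Longrightarrow> x \<in> Y \<Longrightarrow> snd (y i) x \<in> Y"
    then show "Y = X" by (intro transitive) (auto simp: F_gens_blocks)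
  qed (use X y_blocks in \<open>simp_all add: additive_torsion_qz\<close>)
  have lifts: "y \<in> D.lifts" "y' \<in> D.lifts"
    unfolding D.lifts_def using y_blocks y'(1)[OF block_gens_Gens] by blast+
  have "snd (blocks_product ?M y blocks) = snd (blocks_product ?M y' blocks)"
    using D.snd_blocks_product[OF lifts(1), of blocks] D.snd_blocks_product[OF lifts(2), of blocks] by simp
  then have id: "blocks_product ?M y blocks = (fst (blocks_product ?M y blocks), id)"
    unfolding y'(2) by (simp add: prod_eq_iff)
  have closed: "blocks_product ?M y blocks \<in> carrier ?M"
    using y_blocks by (rule D.M.blocks_product_closed)
  have "total X (blocks_product ?M y blocks) = 0"
    using D.C.total_relator[of g r "length ns" y X, OF y_blocks] sum by simp
  then have sum0: "(\<Sum>x\<in>X. fst (blocks_product ?M y blocks) x) = 0" by (simp add: total_def)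
  obtain z where z: "z \<in> D.lifts" "deformation X (torsion_qz n) y z" "blocks_product ?M z blocks = \<one>\<^bsub>?M\<^esub>"
    using D.deform_to_relation[OF lifts(1) id _ sum0] closed by auto
  have z_closed: "z i \<in> carrier ?M" "snd (z i) = snd (y i)" if "i \<in> Gens" for i
    using z(1) that unfolding D.lifts_def F_gens_blocks by blast+
  have z_fst: "\<exists>b. \<forall>x. fst (z (Delta l)) x = fst (y (Delta l)) x + coboundary b (snd (y (Delta l))) x" for l
    using deformation_Delta[OF z(2), of l] unfolding coboundary_def by (metis add_diff_eq)
  have z_period: "z (Delta l) [^]\<^bsub>?M\<^esub> (ns ! l) = \<one>\<^bsub>?M\<^esub>" if l: "l < length ns" for l
  proof -
    obtain b where b: "\<forall>x. fst (z (Delta l)) x = fst (y (Delta l)) x + coboundary b (snd (y (Delta l))) x"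
      using z_fst by blast
    let ?\<sigma> = "snd (y (Delta l))"
    have p: "(\<Sum>i<ns ! l. fst (y (Delta l)) ((?\<sigma> ^^ i) x)) = 0" "?\<sigma> ^^ (ns ! l) = id" for x
      using period[OF l] D.C.monomial_group_pow[OF y[OF Delta_Gens[OF l]], of "ns ! l"] by (simp_all add: fun_eq_iff)
    show ?thesis
      using D.C.monomial_group_pow[OF z_closed(1)[OF Delta_Gens[OF l]], of "ns ! l"]
      by (simp add: z_closed(2)[OF Delta_Gens[OF l]] b sum.distrib p sum_coboundary)
  qed
  have fin: "finite (carrier ?M)"
    by (rule finite_carrier_monomial_group[OF X(1) finite_torsion_qz[OF n]])
  obtain \<Psi> where \<Psi>: "\<Psi> \<in> hom G ?M" "\<forall>i\<in>Gens. \<Psi> (gen i) = z i" "openin T (kernel G ?M \<Psi>)"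
    by (rule F_hom_extension[OF D.M.group_axioms fin z_closed(1) z(3) z_period])
  show ?thesis
  proof (rule that[OF \<Psi>(1,3)])
    show "\<forall>i\<in>Gens. snd (\<Psi> (gen i)) = snd (y i)" using \<Psi>(2) z_closed(2) by simp
    show "\<forall>l<length ns. \<exists>b. \<forall>x.
        fst (\<Psi> (gen (Delta l))) x = fst (y (Delta l)) x + coboundary b (snd (y (Delta l))) x"
      using z_fst \<Psi>(2) Delta_Gens by simp
  qed
qed

end

section \<open>Translations and permutation actions for towers of monomial groups\<close>

definition shift :: "'c::ab_group_add set \<Rightarrow> 'c \<Rightarrow> 'c \<Rightarrow> 'c"
  where "shift A c x = (if x \<in> A then x + c else x)"

context additive_subgroup_set
begin

lemma shift_0: "shift C 0 = id"
  by (simp add: shift_def fun_eq_iff)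

lemma shift_add: "b \<in> C \<Longrightarrow> shift C a \<circ> shift C b = shift C (a + b)"
  by (auto simp: shift_def fun_eq_iff add_mem ac_simps)

lemma shift_permutes:
  assumes "c \<in> C"
  shows "shift C c permutes C"
proof (rule bij_imp_permutes)
  have "shift C (- c) (shift C c x) = x" "shift C c (shift C (- c) x) = x" for x
    using fun_cong[OF shift_add[OF assms, of "- c"], of x] fun_cong[OF shift_add[OF uminus_mem[OF assms], of c], of x]
    by (simp_all add: shift_0)
  then show "bij_betw (shift C c) C C"
    by (intro bij_betw_byWitness[where f' = "shift C (- c)"]) (auto simp: shift_def assms add_mem diff_mem)
qed (simp add: shift_def)

lemma shift_pow: "c \<in> C \<Longrightarrow> shift C c ^^ k = shift C (nat_mult k c)"
  by (induction k) (simp_all add: shift_0 nat_mult_Suc shift_add nat_mult_def sum_mem add.commute)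

end

text \<open>Forgets the coefficients without leaving the group, so that permutation parts can be
  compared as homomorphisms with one target.\<close>

lemma scale_0_hom:
  assumes "additive_subgroup_set C"
  shows "(\<lambda>p. ((\<lambda>_. 0), snd p)) \<in> hom (monomial_group X C) (monomial_group X C)"
  by (intro homI) (simp_all add: fun_eq_iff additive_subgroup_set.supported_funs_zero[OF assms])

text \<open>Turns a homomorphism to a monomial group into permutations of
  \<open>A \<times> C\<close>, over which the next monomial group of a tower is built.\<close>

definition monomial_action :: "'x set \<Rightarrow> 'c::ab_group_add set \<Rightarrow> ('x \<Rightarrow> 'c) \<times> ('x \<Rightarrow> 'x) \<Rightarrow> 'x \<times> 'c \<Rightarrow> 'x \<times> 'c"
  where "monomial_action A C p z =
    (if fst z \<in> A \<and> snd z \<in> C then (snd p (fst z), fst p (fst z) + snd z) else z)"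

context additive_subgroup_set
begin

lemma monomial_action_mult:
  assumes "q \<in> carrier (monomial_group A C)"
  shows "monomial_action A C (p \<otimes>\<^bsub>monomial_group A C\<^esub> q) = monomial_action A C p \<circ> monomial_action A C q"
proof
  fix z
  have "snd q x \<in> A \<longleftrightarrow> x \<in> A" "fst q x \<in> C" for x
    using assms by (simp_all add: permutes_in_image supported_funs_def)
  then show "monomial_action A C (p \<otimes>\<^bsub>monomial_group A C\<^esub> q) z = (monomial_action A C p \<circ> monomial_action A C q) z"
    by (cases "fst z \<in> A"; cases "snd z \<in> C") (simp_all add: monomial_action_def add_mem add.assoc)
qed

lemma monomial_action_one: "monomial_action A C \<one>\<^bsub>monomial_group A C\<^esub> = id"
  by (simp add: monomial_action_def fun_eq_iff)

lemma monomial_action_permutes: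
  assumes p: "p \<in> carrier (monomial_group A C)"
  shows "monomial_action A C p permutes A \<times> C"
proof (rule bij_imp_permutes)
  interpret M: group "monomial_group A C" by (rule group_monomial_group)
  let ?q = "inv\<^bsub>monomial_group A C\<^esub> p"
  have q: "?q \<in> carrier (monomial_group A C)" using p by (rule M.inv_closed)
  have inv: "monomial_action A C ?q (monomial_action A C p z) = z"
    "monomial_action A C p (monomial_action A C ?q z) = z" for z
    using fun_cong[OF monomial_action_mult[OF p, of ?q], of z] fun_cong[OF monomial_action_mult[OF q, of p], of z]
    unfolding M.l_inv[OF p] M.r_inv[OF p] monomial_action_one by simp_all
  have maps: "monomial_action A C z ` (A \<times> C) \<subseteq> A \<times> C" if "z \<in> carrier (monomial_group A C)" for z
    using that by (auto simp: monomial_action_def permutes_in_image supported_funs_def add_mem)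
  show "bij_betw (monomial_action A C p) (A \<times> C) (A \<times> C)"
    by (rule bij_betw_byWitness[where f' = "monomial_action A C ?q"]) (use inv maps[OF p] maps[OF q] in auto)
qed (auto simp: monomial_action_def)

lemma monomial_action_hom:
  assumes "additive_subgroup_set D"
  shows "(\<lambda>p. ((\<lambda>_. 0), monomial_action A C p)) \<in> hom (monomial_group A C) (monomial_group (A \<times> C) D)"
proof (rule homI)
  fix p assume p: "p \<in> carrier (monomial_group A C)"
  then show "((\<lambda>_. 0), monomial_action A C p) \<in> carrier (monomial_group (A \<times> C) D)"
    by (simp add: monomial_action_permutes additive_subgroup_set.supported_funs_zero[OF assms])
  fix q assume "q \<in> carrier (monomial_group A C)"
  from monomial_action_mult[OF this, of p]
  show "((\<lambda>_. 0), monomial_action A C (p \<otimes>\<^bsub>monomial_group A C\<^esub> q)) =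
      ((\<lambda>_. 0), monomial_action A C p) \<otimes>\<^bsub>monomial_group (A \<times> C) D\<^esub> ((\<lambda>_. 0), monomial_action A C q)"
    by (simp del: monomial_group_simps(2)) simp
qed

end

lemma sum_periodic:
  assumes "\<And>i. f (i + p) = f i"
  shows "(\<Sum>i<p * m. f i) = nat_mult m (\<Sum>i<(p::nat). f i)"
proof (induction m)
  case (Suc m)
  have "f (i + p * k) = f i" for i k
    by (induction k) (simp_all add: assms add.assoc[symmetric] add.commute[of p])
  then have "(\<Sum>i<p. f (i + p * m)) = (\<Sum>i<p. f i)" by simp
  moreover have "(\<Sum>i<p * m + p. f i) = (\<Sum>i<p * m. f i) + (\<Sum>i<p. f (i + p * m))"
    using sum.nat_group[of f p 0] sum.atLeastLessThan_concat[of 0 "p * m" "p * m + p" f]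
      sum.shift_bounds_nat_ivl[of f 0 "p * m" p] by (simp add: atLeast0LessThan add.commute)
  ultimately show ?case using Suc by (simp add: nat_mult_Suc ac_simps)
qed simp

context F_group
begin

text \<open>Elements acting by the identity permutation land in the abelian group of functions, so
  each storey of a tower costs one derived step.\<close>

lemma derived_monomial_step:
  assumes \<Psi>: "\<Psi> \<in> hom G (monomial_group X C)" and C: "additive_subgroup_set C"
    and perm: "\<And>d. d \<in> (derived G ^^ m) (carrier G) \<Longrightarrow> snd (\<Psi> d) = id"
  shows "(derived G ^^ Suc m) (carrier G) \<subseteq> kernel G (monomial_group X C) \<Psi>"
proof -
  interpret h: group_hom G "monomial_group X C" \<Psi>
    using \<Psi> additive_subgroup_set.group_monomial_group[OF C]
    by (simp add: group_hom_def group_hom_axioms_def group_axioms)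
  have "derived G ((derived G ^^ m) (carrier G)) \<subseteq> kernel G (monomial_group X C) \<Psi>"
  proof (rule h.derived_subset_kernel)
    show "(derived G ^^ m) (carrier G) \<subseteq> carrier G" by (rule exp_of_derived_in_carrier) simp
  qed (simp add: perm add.commute)
  then show ?thesis by simp
qed

text \<open>A cyclic cover in which \<open>\<delta>\<^bsub>l0\<^esub>\<close> splits completely, followed by an abelian cover in
  which it keeps its order.\<close>

lemma metabelian_hom:
  assumes p: "p > 1" and e: "\<And>i. i \<in> Gens \<Longrightarrow> e i \<in> torsion_qz p"
    and e_sum: "(\<Sum>j<r. e (Gamma j)) + (\<Sum>l<length ns. e (Delta l)) = 0"
    and e_unit: "i1 \<in> Gens" "e i1 = unit_qz p"
    and e_period: "\<And>l. l < length ns \<Longrightarrow> nat_mult (ns ! l) (e (Delta l)) = 0"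
    and l0: "l0 < length ns" "e (Delta l0) = 0"
  defines "n \<equiv> ns ! l0"
  defines "v \<equiv> \<lambda>x. point_fun 0 (unit_qz n) x - point_fun (unit_qz p) (unit_qz n) x"
  obtains \<Psi> where "\<Psi> \<in> hom G (monomial_group (torsion_qz p) (torsion_qz n))"
    "openin T (kernel G (monomial_group (torsion_qz p) (torsion_qz n)) \<Psi>)"
    "\<forall>i\<in>Gens. snd (\<Psi> (gen i)) = shift (torsion_qz p) (e i)"
    "\<forall>l<length ns. \<exists>b. \<forall>x. fst (\<Psi> (gen (Delta l))) x =
      (if l = l0 then v x else 0) + coboundary b (shift (torsion_qz p) (e (Delta l))) x"
    "(derived G ^^ 2) (carrier G) \<subseteq> kernel G (monomial_group (torsion_qz p) (torsion_qz n)) \<Psi>"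
proof -
  let ?A = "torsion_qz p" and ?C = "torsion_qz n"
  let ?M = "monomial_group ?A ?C"
  interpret A: additive_subgroup_set ?A by (rule additive_torsion_qz)
  interpret C: additive_subgroup_set ?C by (rule additive_torsion_qz)
  interpret M: group ?M by (rule C.group_monomial_group)
  have n: "n > 0" using period_pos[OF l0(1)] by (simp add: n_def)
  have p0: "p > 0" using p by simp
  \<comment> \<open>Only \<open>Delta l0\<close> receives coefficients: opposite ones at two points,
    so that the total is zero.\<close>
  define y where "y i = ((if i = Delta l0 then v else (\<lambda>_. 0)), shift ?A (e i))" for i
  have v: "v \<in> supported_funs ?A ?C"
    using unit_qz_mem_torsion[of p] unit_qz_mem_torsion[of n] C.uminus_mem[OF unit_qz_mem_torsion[of n]]
    by (auto simp: v_def supported_funs_def point_fun_def)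
  have v_sum: "(\<Sum>x\<in>?A. v x) = 0"
    using finite_torsion_qz[OF p0] unit_qz_mem_torsion[of p] by (simp add: v_def sum_subtractf point_fun_def)
  have y: "y i \<in> carrier ?M" if "i \<in> Gens" for i
    using v A.shift_permutes[OF e[OF that]] by (simp add: y_def)
  have "total ?A (y i) = 0" for i
    using v_sum by (simp add: total_def y_def)
  then have y_sum: "(\<Sum>j<r. total ?A (y (Gamma j))) + (\<Sum>l<length ns. total ?A (y (Delta l))) = 0" by simp
  have y_period: "y (Delta l) [^]\<^bsub>?M\<^esub> (ns ! l) = \<one>\<^bsub>?M\<^esub>" if l: "l < length ns" for l
  proof -
    have "(\<Sum>i<ns ! l. fst (y (Delta l)) ((shift ?A (e (Delta l)) ^^ i) x)) = 0" for x
    proof (cases "l = l0")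
      case True
      have "(shift ?A 0 ^^ i) x = x" for i by (simp add: A.shift_0)
      moreover have "nat_mult n (v x) = 0" using v by (simp add: supported_funs_def torsion_qz_def)
      ultimately show ?thesis using True l0(2) by (simp add: y_def nat_mult_def n_def)
    next
      case False
      then show ?thesis by (simp add: y_def)
    qed
    moreover have "shift ?A (e (Delta l)) ^^ (ns ! l) = id"
      using A.shift_pow[OF e[OF Delta_Gens[OF l]]] e_period[OF l] by (simp add: A.shift_0)
    ultimately show ?thesis
      using C.monomial_group_pow[OF y[OF Delta_Gens[OF l]], of "ns ! l"] by (simp add: y_def)
  qed
  \<comment> \<open>The cyclic cover with all coefficients zero is the tuple that satisfies the long
    relation.\<close>
  let ?t = "\<lambda>c. ((\<lambda>_. 0), shift ?A c)"
  have t_hom: "?t \<in> hom (additive_group ?A) ?M"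
    by (rule homI) (simp_all add: A.shift_permutes A.shift_add)
  interpret t: group_hom "additive_group ?A" ?M ?t
    using t_hom A.comm_group_additive_group M.group_axioms
    by (simp add: group_hom_def group_hom_axioms_def comm_group_def)
  have "blocks_product (additive_group ?A) e blocks = 0"
    using A.blocks_product_additive_group[of g r "length ns" e, OF e[OF block_gens_Gens]] e_sum by simp
  moreover have "?t (blocks_product (additive_group ?A) e blocks) = blocks_product ?M (\<lambda>i. ?t (e i)) blocks"
    by (rule t.hom_blocks_product) (simp add: e[OF block_gens_Gens])
  ultimately have y'_prod: "blocks_product ?M (\<lambda>i. ?t (e i)) blocks = \<one>\<^bsub>?M\<^esub>"
    using t.hom_one by simp
  have transitive: "Y = ?A"
    if Y: "Y \<subseteq> ?A" "0 \<in> Y" and closed: "\<And>i x. i \<in> Gens \<Longrightarrow> x \<in> Y \<Longrightarrow> snd (y i) x \<in> Y" for Y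
  proof -
    have "nat_mult k (unit_qz p) \<in> Y" for k
    proof (induction k)
      case (Suc k)
      then show ?case using closed[OF e_unit(1) Suc] Y(1) e_unit(2)
        by (auto simp: y_def shift_def nat_mult_Suc add.commute)
    qed (simp add: Y(2))
    then show ?thesis using torsion_qz_eq_multiples[OF p0] Y(1) by blast
  qed
  obtain \<Psi> where \<Psi>: "\<Psi> \<in> hom G ?M" "openin T (kernel G ?M \<Psi>)"
    "\<forall>i\<in>Gens. snd (\<Psi> (gen i)) = snd (y i)"
    "\<forall>l<length ns. \<exists>b. \<forall>x. fst (\<Psi> (gen (Delta l))) x = fst (y (Delta l)) x + coboundary b (snd (y (Delta l))) x"
  proof (rule monomial_hom[of n ?A 0 y "\<lambda>i. ?t (e i)", OF n finite_torsion_qz[OF p0] A.zero_mem y transitive _ y'_prod y_sum y_period])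
    show "?t (e i) \<in> carrier ?M \<and> snd (?t (e i)) = snd (y i)" if "i \<in> Gens" for i
      using A.shift_permutes[OF e[OF that]] by (simp add: y_def)
  qed
  interpret h: group_hom G ?M \<Psi>
    using \<Psi>(1) M.group_axioms by (simp add: group_hom_def group_hom_axioms_def group_axioms)
  \<comment> \<open>Every element, like the generators, acts by a translation. Translations commute,
    so the derived subgroup acts trivially.\<close>
  let ?E = "{d \<in> carrier G. \<exists>c\<in>?A. snd (\<Psi> d) = shift ?A c}"
  have E: "subgroup ?E G"
  proof (rule subgroupI)
    have "\<one> \<in> ?E" using A.shift_0 A.zero_mem h.hom_one by (auto intro!: bexI[of _ 0])
    then show "?E \<noteq> {}" by blast
  next
    fix d assume d: "d \<in> ?E"
    then obtain c where c: "c \<in> ?A" "snd (\<Psi> d) = shift ?A c" by blast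
    have "snd (\<Psi> (inv d)) \<circ> shift ?A c = id"
      using h.hom_mult[of "inv d" d] d c(2) h.hom_one by (simp add: prod_eq_iff del: h.hom_inv h.hom_mult)
    then have "snd (\<Psi> (inv d)) \<circ> (shift ?A c \<circ> shift ?A (- c)) = shift ?A (- c)"
      by (simp add: comp_assoc[symmetric])
    then have "snd (\<Psi> (inv d)) = shift ?A (- c)"
      using A.shift_add[OF A.uminus_mem[OF c(1)], of c] by (simp add: A.shift_0)
    then show "inv d \<in> ?E" using d A.uminus_mem[OF c(1)] by auto
    fix d' assume d': "d' \<in> ?E"
    then obtain c' where c': "c' \<in> ?A" "snd (\<Psi> d') = shift ?A c'" by blast
    have "snd (\<Psi> (d \<otimes> d')) = shift ?A (c + c')"
      using d d' c(2) c'(2) A.shift_add[OF c'(1), of c] by simp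
    then show "d \<otimes> d' \<in> ?E" using d d' A.add_mem[OF c(1) c'(1)] by auto
  qed auto
  have "openin T ?E"
  proof (rule openin_supergroup[OF _ \<Psi>(2) E])
    show "\<one> \<in> kernel G ?M \<Psi>" using h.subgroup_kernel by (rule subgroup.one_closed)
    show "kernel G ?M \<Psi> \<subseteq> ?E"
      using A.shift_0 A.zero_mem by (auto simp: kernel_def intro!: bexI[of _ 0])
  qed
  moreover have "gen ` Gens \<subseteq> ?E" using gen_closed \<Psi>(3) e by (auto simp: y_def)
  ultimately have all: "?E = carrier G" by (rule open_subgroup_eq_carrier[OF E])
  let ?z = "(\<lambda>p. ((\<lambda>_. 0), snd p)) \<circ> \<Psi>"
  interpret z: group_hom G ?M ?z
    using Group.hom_compose[OF \<Psi>(1) scale_0_hom[OF C.additive_subgroup_set_axioms]] M.group_axioms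
    by (simp add: group_hom_def group_hom_axioms_def group_axioms)
  have "derived G (carrier G) \<subseteq> kernel G ?M ?z"
  proof (rule z.derived_subset_kernel)
    fix a b assume "a \<in> carrier G" "b \<in> carrier G"
    then obtain c c' where "c \<in> ?A" "snd (\<Psi> a) = shift ?A c" "c' \<in> ?A" "snd (\<Psi> b) = shift ?A c'"
      using all by blast
    then show "?z a \<otimes>\<^bsub>?M\<^esub> ?z b = ?z b \<otimes>\<^bsub>?M\<^esub> ?z a"
      using A.shift_add[of c' c] A.shift_add[of c c'] by (simp add: add.commute)
  qed simp
  then have "snd (\<Psi> d) = id" if "d \<in> (derived G ^^ 1) (carrier G)" for d
    using that by (auto simp: kernel_def)
  then have "(derived G ^^ Suc 1) (carrier G) \<subseteq> kernel G ?M \<Psi>"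
    by (rule derived_monomial_step[OF \<Psi>(1) C.additive_subgroup_set_axioms])
  then have der: "(derived G ^^ 2) (carrier G) \<subseteq> kernel G ?M \<Psi>" by (simp only: Suc_1)
  show ?thesis
  proof (rule that[OF \<Psi>(1,2) _ _ der])
    show "\<forall>i\<in>Gens. snd (\<Psi> (gen i)) = shift ?A (e i)" using \<Psi>(3) by (simp add: y_def)
    show "\<forall>l<length ns. \<exists>b. \<forall>x. fst (\<Psi> (gen (Delta l))) x =
        (if l = l0 then v x else 0) + coboundary b (shift ?A (e (Delta l))) x"
    proof (intro allI impI)
      fix l assume l: "l < length ns"
      have "fst (y (Delta l)) = (\<lambda>x. if l = l0 then v x else 0)" "snd (y (Delta l)) = shift ?A (e (Delta l))"
        by (simp_all add: y_def)
      then show "\<exists>b. \<forall>x. fst (\<Psi> (gen (Delta l))) x =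
          (if l = l0 then v x else 0) + coboundary b (shift ?A (e (Delta l))) x"
        using \<Psi>(4)[rule_format, OF l] by simp
    qed
  qed
qed

text \<open>\<open>gen (Delta l0)\<close> acts on \<open>torsion_qz p\<close> by the identity, so
  the coboundary part of its coefficients vanishes and the coefficient at 0 is exactly
  \<open>unit_qz n\<close>. Here \<open>p > 1\<close> separates the two points that carry
  coefficients.\<close>

lemma survives_metabelian:
  assumes p: "p > 1" and e: "\<And>i. i \<in> Gens \<Longrightarrow> e i \<in> torsion_qz p"
    and e_sum: "(\<Sum>j<r. e (Gamma j)) + (\<Sum>l<length ns. e (Delta l)) = 0"
    and e_unit: "i1 \<in> Gens" "e i1 = unit_qz p"
    and e_period: "\<And>l. l < length ns \<Longrightarrow> nat_mult (ns ! l) (e (Delta l)) = 0"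
    and l0: "l0 < length ns" "e (Delta l0) = 0"
  shows "\<exists>V. derived_open_normal 2 V \<and> (\<forall>j::nat. gen (Delta l0) [^] j \<in> V \<longrightarrow> ns ! l0 dvd j)"
proof -
  define n where "n = ns ! l0"
  let ?A = "torsion_qz p" and ?C = "torsion_qz n"
  let ?M = "monomial_group ?A ?C"
  interpret A: additive_subgroup_set ?A by (rule additive_torsion_qz)
  interpret C: additive_subgroup_set ?C by (rule additive_torsion_qz)
  have n: "n > 0" using period_pos[OF l0(1)] by (simp add: n_def)
  have up: "unit_qz p \<noteq> 0" using nat_mult_unit_qz_eq_0_iff[of p 1] p by simp
  obtain \<Psi> where \<Psi>: "\<Psi> \<in> hom G ?M" "openin T (kernel G ?M \<Psi>)"
    "\<forall>i\<in>Gens. snd (\<Psi> (gen i)) = shift ?A (e i)"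
    "\<forall>l<length ns. \<exists>b. \<forall>x. fst (\<Psi> (gen (Delta l))) x =
      (if l = l0 then point_fun 0 (unit_qz n) x - point_fun (unit_qz p) (unit_qz n) x else 0)
      + coboundary b (shift ?A (e (Delta l))) x"
    "(derived G ^^ 2) (carrier G) \<subseteq> kernel G ?M \<Psi>"
    by (rule metabelian_hom[OF p e e_sum e_unit e_period l0, folded n_def])
  interpret h: group_hom G ?M \<Psi>
    using \<Psi>(1) C.group_monomial_group by (simp add: group_hom_def group_hom_axioms_def group_axioms)
  let ?d = "gen (Delta l0)"
  have d: "?d \<in> carrier G" by (rule gen_closed[OF Delta_Gens[OF l0(1)]])
  have snd: "snd (\<Psi> ?d) = id"
    using \<Psi>(3) Delta_Gens[OF l0(1)] l0(2) A.shift_0 by simp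
  have fst: "fst (\<Psi> ?d) 0 = unit_qz n"
    using \<Psi>(4)[rule_format, OF l0(1)] l0(2) up by (auto simp: A.shift_0 coboundary_def point_fun_def)
  have "n dvd j" if "?d [^] j \<in> kernel G ?M \<Psi>" for j :: nat
  proof -
    have "\<Psi> ?d [^]\<^bsub>?M\<^esub> j = \<one>\<^bsub>?M\<^esub>" using that h.hom_nat_pow[OF d, of j] by (simp add: kernel_def del: monomial_group_simps)
    then have "(\<Sum>i<j. fst (\<Psi> ?d) ((id ^^ i) 0)) = 0"
      using C.monomial_group_pow[OF h.hom_closed[OF d], of j] by (simp add: snd fun_eq_iff)
    then have "nat_mult j (unit_qz n) = 0" by (simp add: fst nat_mult_def)
    then show ?thesis using nat_mult_unit_qz_eq_0_iff[OF n] by simp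
  qed
  then show ?thesis
    using derived_open_normal_kernel[OF C.group_monomial_group \<Psi>(1,2,5)] unfolding n_def by blast
qed

end

context F_group
begin

text \<open>In the metabelian cover acting on \<open>X = torsion_qz p \<times> torsion_qz n\<close>, all cycles of
  \<open>\<delta>\<^bsub>i0\<^esub>\<close> have length \<open>p\<close> and there are \<open>n \<ge> 2\<close> of them. Opposite coefficients at points
  \<open>P\<close> and \<open>Q\<close> of two of these cycles restore the full order of \<open>\<delta>\<^bsub>i0\<^esub>\<close> in one further abelian cover.\<close>

lemma survives_three_step:
  assumes p: "p > 1" and e: "\<And>i. i \<in> Gens \<Longrightarrow> e i \<in> torsion_qz p"
    and e_sum: "(\<Sum>j<r. e (Gamma j)) + (\<Sum>l<length ns. e (Delta l)) = 0"
    and e_period: "\<And>l. l < length ns \<Longrightarrow> nat_mult (ns ! l) (e (Delta l)) = 0"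
    and l0: "l0 < length ns" "e (Delta l0) = 0" "ns ! l0 > 1"
    and i0: "i0 < length ns" "e (Delta i0) = unit_qz p" "ns ! i0 = p * m"
  shows "\<exists>V. derived_open_normal 3 V \<and> (\<forall>j::nat. gen (Delta i0) [^] j \<in> V \<longrightarrow> ns ! i0 dvd j)"
proof -
  define n where "n = ns ! l0"
  let ?A = "torsion_qz p" and ?C = "torsion_qz n" and ?D = "torsion_qz m"
  let ?X = "?A \<times> ?C"
  let ?M = "monomial_group ?A ?C" and ?M' = "monomial_group ?X ?D"
  interpret A: additive_subgroup_set ?A by (rule additive_torsion_qz)
  interpret C: additive_subgroup_set ?C by (rule additive_torsion_qz)
  interpret D: additive_subgroup_set ?D by (rule additive_torsion_qz)
  interpret M: group ?M by (rule C.group_monomial_group)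
  interpret M': group ?M' by (rule D.group_monomial_group)
  have p0: "p > 0" using p by simp
  have n: "n > 1" using l0(3) by (simp add: n_def)
  then have n0: "n > 0" by simp
  have m: "m > 0" using period_pos[OF i0(1)] i0(3) by (cases m) auto
  have up: "unit_qz p \<noteq> 0" using nat_mult_unit_qz_eq_0_iff[of p 1] p by simp
  have un: "unit_qz n \<noteq> 0" using nat_mult_unit_qz_eq_0_iff[of n 1] n by simp
  have i0_l0: "i0 \<noteq> l0" using i0(2) l0(2) up by auto
  obtain \<Psi> where \<Psi>: "\<Psi> \<in> hom G ?M" "openin T (kernel G ?M \<Psi>)"
    "\<forall>i\<in>Gens. snd (\<Psi> (gen i)) = shift ?A (e i)"
    "\<forall>l<length ns. \<exists>b. \<forall>x. fst (\<Psi> (gen (Delta l))) x =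
      (if l = l0 then point_fun 0 (unit_qz n) x - point_fun (unit_qz p) (unit_qz n) x else 0)
      + coboundary b (shift ?A (e (Delta l))) x"
    "(derived G ^^ 2) (carrier G) \<subseteq> kernel G ?M \<Psi>"
    by (rule metabelian_hom[OF p e e_sum Delta_Gens[OF i0(1)] i0(2) e_period l0(1,2), folded n_def])
  interpret h: group_hom G ?M \<Psi>
    using \<Psi>(1) M.group_axioms by (simp add: group_hom_def group_hom_axioms_def group_axioms)
  let ?\<Phi> = "\<lambda>q. ((\<lambda>_ :: qz \<times> qz. 0 :: qz), monomial_action ?A ?C q)"
  interpret \<Phi>: group_hom ?M ?M' ?\<Phi>
    using C.monomial_action_hom[OF D.additive_subgroup_set_axioms] M.group_axioms M'.group_axioms
    by (simp add: group_hom_def group_hom_axioms_def)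
  define \<rho> where "\<rho> i = monomial_action ?A ?C (\<Psi> (gen i))" for i
  have \<Psi>_gen: "\<Psi> (gen i) \<in> carrier ?M" if "i \<in> Gens" for i by (rule h.hom_closed[OF gen_closed[OF that]])
  have \<rho>_permutes: "\<rho> i permutes ?X" if "i \<in> Gens" for i
    unfolding \<rho>_def by (rule C.monomial_action_permutes[OF \<Psi>_gen[OF that]])
  have \<rho>_pow: "\<rho> i ^^ k = id" if i: "i \<in> Gens" and k: "\<Psi> (gen i) [^]\<^bsub>?M\<^esub> k = \<one>\<^bsub>?M\<^esub>" for i k
  proof -
    have "?\<Phi> (\<Psi> (gen i)) [^]\<^bsub>?M'\<^esub> k = \<one>\<^bsub>?M'\<^esub>"
      using \<Phi>.hom_nat_pow[OF \<Psi>_gen[OF i], of k] \<Phi>.hom_one unfolding k by (simp only:)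
    then show ?thesis
      using D.monomial_group_pow[OF \<Phi>.hom_closed[OF \<Psi>_gen[OF i]], of k] by (simp add: \<rho>_def)
  qed
  have \<Psi>_period: "\<Psi> (gen (Delta l)) [^]\<^bsub>?M\<^esub> (ns ! l) = \<one>\<^bsub>?M\<^esub>" if l: "l < length ns" for l
    using h.hom_nat_pow[OF gen_closed[OF Delta_Gens[OF l]], of "ns ! l"] relation_Delta[OF l] h.hom_one
    by (simp only:)
  have shift_unit: "shift ?A (unit_qz p) ^^ p = id"
    using A.shift_pow[OF unit_qz_mem_torsion, of p] nat_mult_unit_qz_eq_0_iff[OF p0, of p]
    by (simp add: A.shift_0)
  let ?d = "Delta i0"
  have d: "?d \<in> Gens" by (rule Delta_Gens[OF i0(1)])
  have snd_d: "snd (\<Psi> (gen ?d)) = shift ?A (unit_qz p)" using \<Psi>(3) d i0(2) by simp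
  \<comment> \<open>No coefficient was placed at \<open>i0\<close>, so its image is a coboundary
    over a \<open>p\<close>-cycle and its \<open>p\<close>-th power is trivial: at this stage the
    factor \<open>m\<close> of the period is lost.\<close>
  obtain b where "\<forall>x. fst (\<Psi> (gen ?d)) x = coboundary b (shift ?A (unit_qz p)) x"
    using \<Psi>(4)[rule_format, OF i0(1)] i0_l0 i0(2) by auto
  then have "\<Psi> (gen ?d) = (coboundary b (shift ?A (unit_qz p)), shift ?A (unit_qz p))"
    using snd_d by (simp add: prod_eq_iff fun_eq_iff)
  then have "\<Psi> (gen ?d) [^]\<^bsub>?M\<^esub> p = \<one>\<^bsub>?M\<^esub>"
    using C.pow_coboundary[OF _ shift_unit, of b] \<Psi>_gen[OF d] by (simp del: monomial_group_simps)
  then have \<rho>_p: "\<rho> ?d ^^ p = id" by (rule \<rho>_pow[OF d])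
  \<comment> \<open>Each step of \<open>\<rho> ?d\<close> adds 1/p to the first coordinate, so a
    cycle meets the fibre over 0 exactly once. Two points of this fibre lie on different
    cycles.\<close>
  define P :: "qz \<times> qz" where "P = (0, 0)"
  define Q where "Q = (0 :: qz, unit_qz n)"
  have PX: "P \<in> ?X" "Q \<in> ?X" by (simp_all add: P_def Q_def unit_qz_mem_torsion)
  have PQ: "P \<noteq> Q" using un by (auto simp: P_def Q_def)
  define w where "w z = point_fun P (unit_qz m) z - point_fun Q (unit_qz m) z" for z
  have finX: "finite ?X" using finite_torsion_qz[OF p0] finite_torsion_qz[OF n0] by simp
  have w: "w \<in> supported_funs ?X ?D"
    using PX unit_qz_mem_torsion[of m] D.uminus_mem[OF unit_qz_mem_torsion[of m]] D.diff_mem[OF unit_qz_mem_torsion unit_qz_mem_torsion]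
    unfolding supported_funs_def w_def point_fun_def by auto
  have w_sum: "(\<Sum>z\<in>?X. w z) = 0"
    using finX PX by (simp add: w_def sum_subtractf point_fun_def)
  define y where "y i = ((if i = ?d then w else (\<lambda>_. 0)), \<rho> i)" for i
  have y: "y i \<in> carrier ?M'" if "i \<in> Gens" for i
    using w \<rho>_permutes[OF that] by (simp add: y_def)
  have "total ?X (y i) = 0" for i using w_sum by (simp add: total_def y_def)
  then have y_sum: "(\<Sum>j<r. total ?X (y (Gamma j))) + (\<Sum>l<length ns. total ?X (y (Delta l))) = 0" by simp
  have w_cycles: "(\<Sum>i<p * t. w ((\<rho> ?d ^^ i) z)) = nat_mult t (\<Sum>i<p. w ((\<rho> ?d ^^ i) z))" for t z
    by (rule sum_periodic) (simp add: funpow_add \<rho>_p)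
  have y_period: "y (Delta l) [^]\<^bsub>?M'\<^esub> (ns ! l) = \<one>\<^bsub>?M'\<^esub>" if l: "l < length ns" for l
  proof -
    have "(\<Sum>i<ns ! l. fst (y (Delta l)) ((\<rho> (Delta l) ^^ i) z)) = 0" for z
    proof (cases "l = i0")
      case True
      have "(\<Sum>i<p. w ((\<rho> ?d ^^ i) z)) \<in> ?D"
        by (rule D.sum_mem) (use w in \<open>simp add: supported_funs_def del: split_paired_All\<close>)
      then show ?thesis using True w_cycles[of z m] i0(3) by (simp add: y_def torsion_qz_def)
    next
      case False
      then show ?thesis by (simp add: y_def)
    qed
    moreover have "\<rho> (Delta l) ^^ (ns ! l) = id" by (rule \<rho>_pow[OF Delta_Gens[OF l] \<Psi>_period[OF l]])
    ultimately show ?thesis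
      using D.monomial_group_pow[OF y[OF Delta_Gens[OF l]], of "ns ! l"] by (simp add: y_def)
  qed
  have "\<Psi> (blocks_product G gen blocks) = blocks_product ?M (\<lambda>i. \<Psi> (gen i)) blocks"
    by (rule h.hom_blocks_product) (rule gen_closed, rule block_gens_Gens)
  moreover have "?\<Phi> (blocks_product ?M (\<lambda>i. \<Psi> (gen i)) blocks) = blocks_product ?M' (\<lambda>i. ?\<Phi> (\<Psi> (gen i))) blocks"
    by (rule \<Phi>.hom_blocks_product) (rule \<Psi>_gen, rule block_gens_Gens)
  ultimately have y'_prod: "blocks_product ?M' (\<lambda>i. ?\<Phi> (\<Psi> (gen i))) blocks = \<one>\<^bsub>?M'\<^esub>"
    using relation_blocks h.hom_one \<Phi>.hom_one by (simp only:)
  have fst_\<rho>: "fst (\<rho> ?d z) = fst z + unit_qz p" "snd (\<rho> ?d z) = fst (\<Psi> (gen ?d)) (fst z) + snd z" if "z \<in> ?X" for z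
    using that snd_d by (auto simp: \<rho>_def monomial_action_def shift_def)
  \<comment> \<open>\<open>Delta l0\<close> moves the fibre over 0 by 1/n, and
    \<open>Delta i0\<close> carries each fibre bijectively to the next one.\<close>
  have transitive: "Y = ?X"
    if Y: "Y \<subseteq> ?X" "P \<in> Y" and closed: "\<And>i x. i \<in> Gens \<Longrightarrow> x \<in> Y \<Longrightarrow> snd (y i) x \<in> Y" for Y
  proof -
    let ?l = "Delta l0"
    have l: "?l \<in> Gens" by (rule Delta_Gens[OF l0(1)])
    have snd_l: "snd (\<Psi> (gen ?l)) = id" using \<Psi>(3) l l0(2) A.shift_0 by simp
    have fst_l: "fst (\<Psi> (gen ?l)) 0 = unit_qz n"
      using \<Psi>(4)[rule_format, OF l0(1)] l0(2) up by (auto simp: A.shift_0 coboundary_def point_fun_def)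
    have "(0, nat_mult k (unit_qz n)) \<in> Y" for k
    proof (induction k)
      case (Suc k)
      then have "\<rho> ?l (0, nat_mult k (unit_qz n)) \<in> Y" using closed[OF l Suc] by (simp add: y_def)
      moreover have "nat_mult k (unit_qz n) \<in> ?C" using Suc Y(1) by blast
      ultimately show ?case by (simp add: \<rho>_def monomial_action_def snd_l fst_l nat_mult_Suc)
    qed (use Y(2) in \<open>simp add: P_def\<close>)
    then have Y0: "(0, c) \<in> Y" if "c \<in> ?C" for c
      using torsion_qz_eq_multiples[OF n0 that] by blast
    have "\<forall>c\<in>?C. (nat_mult k (unit_qz p), c) \<in> Y" for k
    proof (induction k)
      case (Suc k)
      show ?case
      proof
        fix c assume c: "c \<in> ?C"
        let ?u = "nat_mult k (unit_qz p)"
        have "fst (\<Psi> (gen ?d)) ?u \<in> ?C" using \<Psi>_gen[OF d] by (simp add: supported_funs_def)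
        then have c': "c - fst (\<Psi> (gen ?d)) ?u \<in> ?C" using c by (intro C.diff_mem)
        then have mem: "(?u, c - fst (\<Psi> (gen ?d)) ?u) \<in> Y" using Suc by blast
        then have "\<rho> ?d (?u, c - fst (\<Psi> (gen ?d)) ?u) \<in> Y" using closed[OF d mem] by (simp add: y_def)
        moreover have "\<rho> ?d (?u, c - fst (\<Psi> (gen ?d)) ?u) = (nat_mult (Suc k) (unit_qz p), c)"
          using fst_\<rho>[of "(?u, c - fst (\<Psi> (gen ?d)) ?u)"] mem Y(1)
          by (auto simp: prod_eq_iff nat_mult_Suc add.commute)
        ultimately show "(nat_mult (Suc k) (unit_qz p), c) \<in> Y" by simp
      qed
    qed (use Y0 in simp)
    then have "?X \<subseteq> Y" using torsion_qz_eq_multiples[OF p0] by blast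
    then show ?thesis using Y(1) by blast
  qed
  obtain \<Theta> where \<Theta>: "\<Theta> \<in> hom G ?M'" "openin T (kernel G ?M' \<Theta>)"
    "\<forall>i\<in>Gens. snd (\<Theta> (gen i)) = snd (y i)"
    "\<forall>l<length ns. \<exists>b. \<forall>x. fst (\<Theta> (gen (Delta l))) x = fst (y (Delta l)) x + coboundary b (snd (y (Delta l))) x"
  proof (rule monomial_hom[of m ?X P y "\<lambda>i. ?\<Phi> (\<Psi> (gen i))", OF m finX PX(1) y transitive _ y'_prod y_sum y_period])
    show "?\<Phi> (\<Psi> (gen i)) \<in> carrier ?M' \<and> snd (?\<Phi> (\<Psi> (gen i))) = snd (y i)" if "i \<in> Gens" for i
      using \<Phi>.hom_closed[OF \<Psi>_gen[OF that]] by (simp add: y_def \<rho>_def)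
  qed
  interpret \<Theta>: group_hom G ?M' \<Theta>
    using \<Theta>(1) M'.group_axioms by (simp add: group_hom_def group_hom_axioms_def group_axioms)
  \<comment> \<open>The permutation part of \<Theta> is compared with \<Psi> acting on
    \<open>?X\<close>; they agree on the generators, hence everywhere. So the second derived
    subgroup, which \<Psi> kills, has trivial permutations under \<Theta>.\<close>
  let ?z = "(\<lambda>p. ((\<lambda>_ :: qz \<times> qz. 0 :: qz), snd p)) \<circ> \<Theta>"
  have z_hom: "?z \<in> hom G ?M'"
    by (rule Group.hom_compose[OF \<Theta>(1) scale_0_hom[OF D.additive_subgroup_set_axioms]])
  have \<Phi>\<Psi>_hom: "?\<Phi> \<circ> \<Psi> \<in> hom G ?M'"
    by (rule Group.hom_compose[OF \<Psi>(1) C.monomial_action_hom[OF D.additive_subgroup_set_axioms]])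
  interpret z: group_hom G ?M' ?z
    using z_hom M'.group_axioms by (simp add: group_hom_def group_hom_axioms_def group_axioms)
  interpret \<Phi>\<Psi>: group_hom G ?M' "?\<Phi> \<circ> \<Psi>"
    using \<Phi>\<Psi>_hom M'.group_axioms by (simp add: group_hom_def group_hom_axioms_def group_axioms)
  have z_open: "openin T (kernel G ?M' ?z)"
    by (rule openin_supergroup[OF subgroup.one_closed[OF \<Theta>.subgroup_kernel] \<Theta>(2) z.subgroup_kernel])
      (auto simp: kernel_def)
  have \<Phi>\<Psi>_open: "openin T (kernel G ?M' (?\<Phi> \<circ> \<Psi>))"
    by (rule openin_supergroup[OF subgroup.one_closed[OF h.subgroup_kernel] \<Psi>(2) \<Phi>\<Psi>.subgroup_kernel])
      (auto simp: kernel_def C.monomial_action_one[simplified])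
  have eq: "?z x = (?\<Phi> \<circ> \<Psi>) x" if "x \<in> carrier G" for x
    by (rule hom_eqI[OF M'.group_axioms z_hom \<Phi>\<Psi>_hom z_open \<Phi>\<Psi>_open _ that]) (simp add: \<Theta>(3) y_def \<rho>_def)
  have "snd (\<Theta> x) = id" if x: "x \<in> (derived G ^^ 2) (carrier G)" for x
  proof -
    have k: "x \<in> carrier G" "\<Psi> x = \<one>\<^bsub>?M\<^esub>" using \<Psi>(5) x unfolding kernel_def by blast+
    show ?thesis using eq[OF k(1)] k(2) C.monomial_action_one[of ?A] by simp
  qed
  then have "(derived G ^^ Suc 2) (carrier G) \<subseteq> kernel G ?M' \<Theta>"
    by (rule derived_monomial_step[OF \<Theta>(1) D.additive_subgroup_set_axioms])
  then have derived_open_normal: "derived_open_normal 3 (kernel G ?M' \<Theta>)"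
    by (intro derived_open_normal_kernel[OF M'.group_axioms \<Theta>(1,2)]) (simp only: eval_nat_numeral)
  have "ns ! i0 dvd j" if j: "gen ?d [^] j \<in> kernel G ?M' \<Theta>" for j :: nat
  proof -
    have dG: "gen ?d \<in> carrier G" by (rule gen_closed[OF d])
    obtain b where b: "\<forall>x. fst (\<Theta> (gen ?d)) x = w x + coboundary b (\<rho> ?d) x"
      using \<Theta>(4)[rule_format, OF i0(1)] by (auto simp: y_def)
    have snd: "snd (\<Theta> (gen ?d)) = \<rho> ?d" using \<Theta>(3) d by (simp add: y_def)
    have "\<Theta> (gen ?d) [^]\<^bsub>?M'\<^esub> j = \<one>\<^bsub>?M'\<^esub>"
      using j \<Theta>.hom_nat_pow[OF dG, of j] by (simp add: kernel_def del: monomial_group_simps)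
    then have "(\<lambda>z. \<Sum>i<j. fst (\<Theta> (gen ?d)) ((\<rho> ?d ^^ i) z), \<rho> ?d ^^ j) = (\<lambda>_. 0, id)"
      using D.monomial_group_pow[OF \<Theta>.hom_closed[OF dG], of j] by (simp only: snd monomial_group_simps)
    then have eqs: "(\<lambda>z. \<Sum>i<j. fst (\<Theta> (gen ?d)) ((\<rho> ?d ^^ i) z)) = (\<lambda>_. 0)" and pow2: "\<rho> ?d ^^ j = id"
      by (simp_all only: prod.inject)
    have pow1: "(\<Sum>i<j. w ((\<rho> ?d ^^ i) z)) = 0" for z
      using fun_cong[OF eqs, of z] by (simp add: b sum.distrib sum_coboundary pow2)
    have iter: "(\<rho> ?d ^^ i) P \<in> ?X \<and> fst ((\<rho> ?d ^^ i) P) = nat_mult i (unit_qz p)" for i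
    proof (induction i)
      case (Suc i)
      let ?q = "(\<rho> ?d ^^ i) P"
      have "\<rho> ?d ?q \<in> ?X" using conjunct1[OF Suc] by (simp only: permutes_in_image[OF \<rho>_permutes[OF d]])
      moreover have "fst (\<rho> ?d ?q) = fst ?q + unit_qz p" by (rule fst_\<rho>(1)) (rule conjunct1[OF Suc])
      ultimately show ?case using Suc by (simp add: nat_mult_Suc add.commute)
    qed (use PX in \<open>simp add: P_def\<close>)
    \<comment> \<open>The first coordinate detects the factor \<open>p\<close> of \<open>j\<close>;
      the remaining factor is read from the coefficients along the cycle of
      \<open>P\<close>.\<close>
    have "nat_mult j (unit_qz p) = 0" using iter[of j] pow2 by (simp add: P_def)
    then obtain t where t: "j = p * t" using nat_mult_unit_qz_eq_0_iff[OF p0] by auto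
    have "w ((\<rho> ?d ^^ i) P) = (if i = 0 then unit_qz m else 0)" if i: "i < p" for i
    proof (cases "i = 0")
      case True
      then show ?thesis using PQ by (simp add: w_def point_fun_def)
    next
      case False
      then have "\<not> p dvd i" using i by (auto dest: dvd_imp_le)
      then have "fst ((\<rho> ?d ^^ i) P) \<noteq> 0" using iter[of i] nat_mult_unit_qz_eq_0_iff[OF p0] by simp
      then have "(\<rho> ?d ^^ i) P \<noteq> P" "(\<rho> ?d ^^ i) P \<noteq> Q" by (auto simp: P_def Q_def)
      then show ?thesis using False by (simp add: w_def point_fun_def)
    qed
    then have "(\<Sum>i<p. w ((\<rho> ?d ^^ i) P)) = unit_qz m" using p0 by simp
    then have "nat_mult t (unit_qz m) = 0"
      using pow1[of P] w_cycles[of P t] t by simp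
    then show ?thesis using nat_mult_unit_qz_eq_0_iff[OF m] t i0(3) by simp
  qed
  then show ?thesis using derived_open_normal by blast
qed

end

text \<open>The multiplicity of a prime in a least common multiple is the maximum of its
  multiplicities in the entries, so it is attained.\<close>

lemma prime_power_dvd_Lcm:
  fixes q :: nat
  assumes "finite A" "0 \<notin> A" "prime q" "e > 0" "q ^ e dvd Lcm A"
  shows "\<exists>a\<in>A. q ^ e dvd a"
  using assms(1,2,5)
proof (induction A rule: finite_induct)
  case empty
  then have "q ^ e = 1" by simp
  then show ?case using assms(3,4) by (simp add: prime_nat_iff)
next
  case (insert a A)
  have nz: "a \<noteq> 0" "Lcm A \<noteq> 0" using insert.prems(1) insert.hyps(1) by (auto simp: Lcm_0_iff)
  have q: "\<not> is_unit q" using assms(3) by (simp add: prime_nat_iff)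
  have "q ^ e dvd lcm a (Lcm A)" using insert.prems(2) by simp
  then have "e \<le> multiplicity q (lcm a (Lcm A))"
    using nz q by (intro multiplicity_geI) (simp_all add: lcm_eq_0_iff)
  then have "e \<le> multiplicity q a \<or> e \<le> multiplicity q (Lcm A)"
    using multiplicity_lcm[of a "Lcm A" q] nz assms(3) by (simp add: le_max_iff_disj)
  then have "q ^ e dvd a \<or> q ^ e dvd Lcm A" by (blast intro: multiplicity_dvd')
  then show ?case using insert by auto
qed

lemma dvd_if_prime_powers_dvd:
  fixes n k :: nat
  assumes "n > 0" "\<And>q. q \<in> prime_factors n \<Longrightarrow> q ^ multiplicity q n dvd k"
  shows "n dvd k"
proof (cases "k = 0")
  case False
  show ?thesis
  proof (rule multiplicity_le_imp_dvd)
    fix q :: nat assume q: "prime q"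
    show "multiplicity q n \<le> multiplicity q k"
    proof (cases "q dvd n")
      case True
      then have "q ^ multiplicity q n dvd k" using assms q by (simp add: in_prime_factors_iff)
      then show ?thesis using False q by (intro multiplicity_geI) (auto simp: prime_nat_iff)
    qed (simp add: not_dvd_imp_multiplicity_0)
  qed (use assms(1) in simp)
qed simp

lemma list_mult_Nil [simp]: "list_mult G [] = \<one>\<^bsub>G\<^esub>"
  and list_mult_Cons [simp]: "list_mult G (x # xs) = x \<otimes>\<^bsub>G\<^esub> list_mult G xs"
  by (simp_all add: list_mult_def)

lemma (in comm_group) list_mult_closed: "set xs \<subseteq> carrier G \<Longrightarrow> list_mult G xs \<in> carrier G"
  by (induction xs) auto

lemma (in comm_group) list_mult_pow:
  "set xs \<subseteq> carrier G \<Longrightarrow> list_mult G xs [^] (c::nat) = list_mult G (map (\<lambda>x. x [^] c) xs)"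
  by (induction xs) (simp_all add: nat_pow_distrib list_mult_closed)

lemma (in comm_group) list_mult_single:
  assumes "distinct ls" "l \<in> set ls" "f l \<in> carrier G" "\<And>j. j \<in> set ls \<Longrightarrow> j \<noteq> l \<Longrightarrow> f j = \<one>"
  shows "list_mult G (map f ls) = f l"
  using assms
proof (induction ls)
  case (Cons j ls)
  have one: "list_mult G (map f xs) = \<one>" if "\<And>j. j \<in> set xs \<Longrightarrow> f j = \<one>" for xs
    using that by (induction xs) auto
  show ?case
  proof (cases "j = l")
    case True
    then have "list_mult G (map f ls) = \<one>" using Cons.prems by (intro one) auto
    then show ?thesis using True Cons.prems by simp
  next
    case False
    then have "f j = \<one>" "list_mult G (map f ls) = f l" using Cons by auto
    then show ?thesis using Cons.prems by simp
  qed
qed simp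

lemma (in group) pow_coprime_eq_one:
  assumes x: "x \<in> carrier G" and "x [^] (a::nat) = \<one>" "x [^] (b::nat) = \<one>" "coprime a b"
  shows "x = \<one>"
proof (cases "a = 0")
  case True
  then have "b = 1" using assms(4) by simp
  then show ?thesis using assms(3) x by simp
next
  case False
  then obtain u v where uv: "a * u = b * v + 1" using bezout_nat[of a b] assms(4) by auto
  have "x [^] (a * u) = \<one>" using x assms(2) by (simp add: nat_pow_pow[symmetric])
  moreover have "x [^] (b * v + 1) = x" using x assms(3) by (simp add: nat_pow_pow[symmetric])
  ultimately show ?thesis using uv by simp
qed

section \<open>Survival of a single period, case by case\<close>

context F_group
begin

text \<open>A parabolic generator carries no period, so \<open>Gamma 0\<close> can take the value
  that cancels \<open>Delta l\<close> in the long relation.\<close>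

lemma survives_affine:
  assumes r: "r > 0" and l: "l < length ns"
  shows "\<exists>V. derived_open_normal 1 V \<and> (\<forall>j::nat. gen (Delta l) [^] j \<in> V \<longrightarrow> ns ! l dvd j)"
proof -
  let ?u = "unit_qz (ns ! l)"
  interpret C: additive_subgroup_set "torsion_qz (ns ! l)" by (rule additive_torsion_qz)
  define q where "q i = (if i = Delta l then ?u else if i = Gamma 0 then - ?u else 0)" for i
  have pos: "ns ! l > 0" by (rule period_pos[OF l])
  have "q i \<in> torsion_qz (ns ! l)" for i
    by (simp add: q_def unit_qz_mem_torsion C.uminus_mem)
  moreover have "q (Gamma j) = (if j = 0 then - ?u else 0)" "q (Delta j) = (if j = l then ?u else 0)" for j
    by (simp_all add: q_def)
  then have "(\<Sum>j<r. q (Gamma j)) = - ?u" "(\<Sum>j<length ns. q (Delta j)) = ?u"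
    using r l by simp_all
  moreover have "nat_mult (ns ! j) (q (Delta j)) = 0" for j
    using nat_mult_unit_qz_eq_0_iff[OF pos] by (simp add: q_def)
  ultimately obtain V where V: "derived_open_normal 1 V"
    "\<forall>l<length ns. \<forall>j::nat. gen (Delta l) [^] j \<in> V \<longrightarrow> nat_mult j (q (Delta l)) = 0"
    using derived_open_normal_abelian[OF pos, of q] by auto
  have "q (Delta l) = ?u" by (simp add: q_def)
  then have "\<forall>j::nat. gen (Delta l) [^] j \<in> V \<longrightarrow> ns ! l dvd j"
    using V(2)[rule_format, OF l] nat_mult_unit_qz_eq_0_iff[OF pos] by simp
  then show ?thesis using V(1) by blast
qed

lemma sum_opposite_units:
  fixes u :: qz
  assumes "a < k" "b < k" "a \<noteq> b"
  shows "(\<Sum>l<(k::nat). if l = a then u else if l = b then - u else 0) = 0"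
proof -
  have "(if l = a then u else if l = b then - u else 0) = (if l = a then u else 0) + (if l = b then - u else 0)" for l
    using assms(3) by simp
  then show ?thesis using assms by (simp add: sum.distrib)
qed

text \<open>Without cusps the values at the \<delta>s have to cancel among themselves; a second
  period divisible by \<open>q\<close> can take the value opposite to 1/q.\<close>

lemma survives_prime_power:
  assumes r: "r = 0" and l: "l < length ns" "q dvd ns ! l" and j: "j < length ns" "j \<noteq> l" "q dvd ns ! j"
  shows "\<exists>V. derived_open_normal 1 V \<and> (\<forall>k::nat. gen (Delta l) [^] k \<in> V \<longrightarrow> q dvd k)"
proof -
  let ?u = "unit_qz q"
  interpret C: additive_subgroup_set "torsion_qz q" by (rule additive_torsion_qz)
  have pos: "q > 0" using l(2) period_pos[OF l(1)] by (metis dvd_0_left_iff gr0I)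
  define e where "e i = (if i = Delta l then ?u else if i = Delta j then - ?u else 0)" for i
  have "e i \<in> torsion_qz q" for i by (simp add: e_def unit_qz_mem_torsion C.uminus_mem)
  moreover have "e (Delta i) = (if i = l then ?u else if i = j then - ?u else 0)" for i
    by (simp add: e_def)
  then have "(\<Sum>i<length ns. e (Delta i)) = 0"
    using sum_opposite_units[of l "length ns" j ?u] l j by simp
  moreover have "nat_mult (ns ! i) (e (Delta i)) = 0" for i
    using nat_mult_unit_qz_eq_0_iff[OF pos] l j by (simp add: e_def nat_mult_uminus)
  ultimately obtain V where V: "derived_open_normal 1 V"
    "\<forall>l<length ns. \<forall>k::nat. gen (Delta l) [^] k \<in> V \<longrightarrow> nat_mult k (e (Delta l)) = 0"
    using derived_open_normal_abelian[OF pos, of e] r by auto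
  have "e (Delta l) = ?u" by (simp add: e_def)
  then have "\<forall>k::nat. gen (Delta l) [^] k \<in> V \<longrightarrow> q dvd k"
    using V(2)[rule_format, OF l(1)] nat_mult_unit_qz_eq_0_iff[OF pos] by simp
  then show ?thesis using V(1) by blast
qed

text \<open>For each prime power in the period, the condition supplies a partner \<open>j\<close>
  whose period it divides. The partner varies with the prime, so the subgroups found for the primes
  are intersected.\<close>

lemma survives_abelian_period:
  assumes r: "r = 0" and apc: "abelian_period_condition ns" and l: "l < length ns"
  shows "\<exists>V. derived_open_normal 1 V \<and> (\<forall>k::nat. gen (Delta l) [^] k \<in> V \<longrightarrow> ns ! l dvd k)"
proof -
  let ?A = "{ns ! j | j. j < length ns \<and> j \<noteq> l}"
  have pos: "ns ! l > 0" by (rule period_pos[OF l])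
  have Lcm: "ns ! l dvd Lcm ?A" using apc l by (auto simp: abelian_period_condition_def)
  have fin: "finite ?A" by (rule finite_subset[of _ "set ns"]) auto
  have nz: "0 \<notin> ?A" using period_pos by auto
  have "\<exists>V. derived_open_normal 1 V \<and> (\<forall>k::nat. gen (Delta l) [^] k \<in> V \<longrightarrow> q ^ multiplicity q (ns ! l) dvd k)"
    if q: "q \<in> prime_factors (ns ! l)" for q
  proof -
    have prime: "prime q" and dvd: "q dvd ns ! l" using q by (auto simp: in_prime_factors_iff)
    have e: "multiplicity q (ns ! l) > 0"
      using pos prime dvd by (simp add: prime_multiplicity_gt_zero_iff)
    have "q ^ multiplicity q (ns ! l) dvd Lcm ?A" using dvd_trans[OF multiplicity_dvd Lcm] .
    from prime_power_dvd_Lcm[OF fin nz prime e this]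
    obtain j where j: "j < length ns" "j \<noteq> l" "q ^ multiplicity q (ns ! l) dvd ns ! j" by auto
    show ?thesis by (rule survives_prime_power[OF r l multiplicity_dvd j])
  qed
  then obtain V where V: "\<forall>q\<in>prime_factors (ns ! l). derived_open_normal 1 (V q) \<and>
      (\<forall>k::nat. gen (Delta l) [^] k \<in> V q \<longrightarrow> q ^ multiplicity q (ns ! l) dvd k)"
    by metis
  obtain W where W: "derived_open_normal 1 W" "\<forall>q\<in>prime_factors (ns ! l). W \<subseteq> V q"
    by (rule derived_open_normal_Inter[of "prime_factors (ns ! l)" 1 V]) (use V in auto)
  have "ns ! l dvd k" if "gen (Delta l) [^] k \<in> W" for k :: nat
    by (rule dvd_if_prime_powers_dvd[OF pos]) (use V W(2) that in blast)
  then show ?thesis using W(1) by blast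
qed

text \<open>\<open>Alpha 0\<close> takes an arbitrary value in an abelian quotient. The value 1/2
  gives a double cover in which every \<delta> splits, and the metabelian construction applies above
  it.\<close>

lemma survives_positive_genus:
  assumes g: "g > 0" and l: "l < length ns"
  shows "\<exists>V. derived_open_normal 3 V \<and> (\<forall>j::nat. gen (Delta l) [^] j \<in> V \<longrightarrow> ns ! l dvd j)"
proof -
  define e where "e i = (if i = Alpha 0 then unit_qz 2 else 0)" for i
  have "e i \<in> torsion_qz 2" for i
    using unit_qz_mem_torsion[of 2] by (simp add: e_def torsion_qz_def)
  moreover have "(\<Sum>j<r. e (Gamma j)) + (\<Sum>l<length ns. e (Delta l)) = 0"
    "nat_mult k (e (Delta j)) = 0" "e (Delta l) = 0" "Alpha 0 \<in> Gens" "e (Alpha 0) = unit_qz 2" for k j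
    using g by (simp_all add: e_def F_gens_def)
  ultimately have "\<exists>V. derived_open_normal 2 V \<and> (\<forall>j::nat. gen (Delta l) [^] j \<in> V \<longrightarrow> ns ! l dvd j)"
    by (intro survives_metabelian[of 2 e "Alpha 0" l] l) simp_all
  then show ?thesis using derived_open_normal_mono[of 2 _ 3] by auto
qed

text \<open>The cyclic cover is ramified over \<open>a\<close> and \<open>b\<close> and split over a
  third period \<open>l0\<close>. For \<open>l\<close> other than \<open>a\<close> and
  \<open>b\<close> the metabelian cover above it is enough; for these two a third storey is needed,
  and exchanging the signs exchanges their roles.\<close>

lemma survives_common_prime:
  assumes gr: "r = 0" and periods2: "\<forall>n\<in>set ns. n \<ge> 2"
    and ab: "a < length ns" "b < length ns" "a \<noteq> b" "p > 1" "p dvd ns ! a" "p dvd ns ! b"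
    and l: "l < length ns" and len: "length ns \<ge> 3"
  shows "\<exists>V. derived_open_normal 3 V \<and> (\<forall>j::nat. gen (Delta l) [^] j \<in> V \<longrightarrow> ns ! l dvd j)"
proof -
  interpret C: additive_subgroup_set "torsion_qz p" by (rule additive_torsion_qz)
  have p0: "p > 0" using ab(4) by simp
  define e where "e c d i = (if i = Delta c then unit_qz p else if i = Delta d then - unit_qz p else 0)" for c d i
  have e: "e c d i \<in> torsion_qz p" for c d i
    by (simp add: e_def unit_qz_mem_torsion C.uminus_mem)
  have e_sum: "(\<Sum>j<r. e c d (Gamma j)) + (\<Sum>l<length ns. e c d (Delta l)) = 0"
    if "c < length ns" "d < length ns" "c \<noteq> d" for c d
  proof -
    have "e c d (Delta l) = (if l = c then unit_qz p else if l = d then - unit_qz p else 0)" for l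
      by (simp add: e_def)
    then show ?thesis using sum_opposite_units[OF that, of "unit_qz p"] gr by simp
  qed
  have e_period: "nat_mult (ns ! l) (e c d (Delta l)) = 0" if "p dvd ns ! c" "p dvd ns ! d" for c d l
    using nat_mult_unit_qz_eq_0_iff[OF p0] that by (simp add: e_def nat_mult_uminus)
  obtain l0 where l0: "l0 < length ns" "l0 \<noteq> a" "l0 \<noteq> b"
  proof -
    have "card ({..<length ns} - {a, b}) > 0" using len ab by (simp add: card_Diff_subset)
    then have "{..<length ns} - {a, b} \<noteq> {}" by (metis card.empty less_irrefl)
    then show ?thesis using that by blast
  qed
  have n0: "ns ! l0 > 1" using periods2 l0(1) by (metis less_le_trans nth_mem one_less_numeral_iff semiring_norm(76))
  have three: "\<exists>V. derived_open_normal 3 V \<and> (\<forall>j::nat. gen (Delta c) [^] j \<in> V \<longrightarrow> ns ! c dvd j)"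
    if cd: "c < length ns" "d < length ns" "c \<noteq> d" "p dvd ns ! c" "p dvd ns ! d" "l0 \<noteq> c" "l0 \<noteq> d" for c d
  proof -
    obtain m where m: "ns ! c = p * m" using cd(4) by (elim dvdE)
    show ?thesis
      by (rule survives_three_step[of p "e c d" l0 c m])
        (use ab(4) e e_sum[OF cd(1-3)] e_period[OF cd(4,5)] l0(1) n0 cd m in \<open>simp_all add: e_def\<close>)
  qed
  consider "l = a" | "l = b" | "l \<noteq> a" "l \<noteq> b" by blast
  then show ?thesis
  proof cases
    case 1
    then show ?thesis using three[of a b] ab l0 by simp
  next
    case 2
    then show ?thesis using three[of b a] ab l0 by simp
  next
    case 3
    have "\<exists>V. derived_open_normal 2 V \<and> (\<forall>j::nat. gen (Delta l) [^] j \<in> V \<longrightarrow> ns ! l dvd j)"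
      by (rule survives_metabelian[of p "e a b" "Delta a" l])
        (use ab e e_sum[OF ab(1-3)] e_period[OF ab(5,6)] l 3 Delta_Gens[OF ab(1)] in \<open>simp_all add: e_def\<close>)
    then show ?thesis using derived_open_normal_mono[of 2 _ 3] by auto
  qed
qed

text \<open>In the abelianization, \<open>\<delta>\<^sub>l\<close> is killed by its own period and, because of the long relation,
  by the product of the other periods.\<close>

lemma perfect_if_coprime_periods:
  assumes gr: "g = 0" "r = 0"
    and coprime: "\<And>a b. a < length ns \<Longrightarrow> b < length ns \<Longrightarrow> a \<noteq> b \<Longrightarrow> coprime (ns ! a) (ns ! b)"
  shows "perfect G T"
proof -
  let ?D = "derived G (carrier G)"
  have D: "?D \<lhd> G" by (rule derived_self_is_normal)
  interpret D: normal ?D G by (rule D)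
  interpret Q: comm_group "G Mod ?D" by (rule comm_group_quotient[OF D subset_refl])
  interpret p: group_hom G "G Mod ?D" "\<lambda>x. ?D #> x"
    using D.r_coset_hom_Mod Q.group_axioms by (simp add: group_hom_def group_hom_axioms_def group_axioms)
  let ?x = "\<lambda>l. ?D #> gen (Delta l)"
  have x: "?x l \<in> carrier (G Mod ?D)" if "l < length ns" for l
    by (rule p.hom_closed[OF gen_closed[OF Delta_Gens[OF that]]])
  have x_pow: "?x l [^]\<^bsub>G Mod ?D\<^esub> (ns ! l) = \<one>\<^bsub>G Mod ?D\<^esub>" if "l < length ns" for l
    using p.hom_nat_pow[OF gen_closed[OF Delta_Gens[OF that]], of "ns ! l"] relation_Delta[OF that] p.hom_one
    by (simp only:)
  have "(\<lambda>x. ?D #> x) (blocks_product G gen blocks) = blocks_product (G Mod ?D) (\<lambda>i. ?D #> gen i) blocks"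
    by (rule p.hom_blocks_product) (rule gen_closed, rule block_gens_Gens)
  then have "blocks_product (G Mod ?D) (\<lambda>i. ?D #> gen i) blocks = \<one>\<^bsub>G Mod ?D\<^esub>"
    using relation_blocks p.hom_one by (simp only:)
  then have prod: "list_mult (G Mod ?D) (map ?x [0..<length ns]) = \<one>\<^bsub>G Mod ?D\<^esub>"
    using gr by (simp add: blocks_product_def relator_blocks_def block_value_def o_def)
  have "gen (Delta l) \<in> ?D" if l: "l < length ns" for l
  proof -
    \<comment> \<open>Raised to the power \<open>c\<close>, all other generators die in the
      abelianization, so the long relation becomes a relation for \<open>gen (Delta l)\<close>
      alone.\<close>
    define c where "c = (\<Prod>j\<in>{..<length ns} - {l}. ns ! j)"
    have c_dvd: "ns ! j dvd c" if "j < length ns" "j \<noteq> l" for j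
      unfolding c_def by (rule dvd_prodI) (use that in auto)
    have "?x j [^]\<^bsub>G Mod ?D\<^esub> c = \<one>\<^bsub>G Mod ?D\<^esub>" if j: "j < length ns" "j \<noteq> l" for j
    proof -
      obtain m where "c = ns ! j * m" using c_dvd[OF j] by (elim dvdE)
      then show ?thesis using Q.nat_pow_pow[OF x[OF j(1)], of "ns ! j" m] x_pow[OF j(1)] Q.nat_pow_one[of m] by simp
    qed
    then have "list_mult (G Mod ?D) (map (\<lambda>j. ?x j [^]\<^bsub>G Mod ?D\<^esub> c) [0..<length ns]) = ?x l [^]\<^bsub>G Mod ?D\<^esub> c"
      by (intro Q.list_mult_single) (use l x in auto)
    moreover have "list_mult (G Mod ?D) (map ?x [0..<length ns]) [^]\<^bsub>G Mod ?D\<^esub> c =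
        list_mult (G Mod ?D) (map (\<lambda>y. y [^]\<^bsub>G Mod ?D\<^esub> c) (map ?x [0..<length ns]))"
      by (rule Q.list_mult_pow) (use x in auto)
    ultimately have "?x l [^]\<^bsub>G Mod ?D\<^esub> c = \<one>\<^bsub>G Mod ?D\<^esub>"
      unfolding prod Q.nat_pow_one by (simp add: o_def)
    moreover have "coprime (ns ! l) c"
      unfolding c_def by (rule prod_coprime_right) (use coprime l in auto)
    ultimately have "?x l = \<one>\<^bsub>G Mod ?D\<^esub>"
      using Q.pow_coprime_eq_one[OF x[OF l] x_pow[OF l]] by blast
    then show ?thesis
      using coset_join1[OF _ gen_closed[OF Delta_Gens[OF l]] D.subgroup_axioms] by simp
  qed
  moreover have "Gens = Delta ` {..<length ns}" using gr by (auto simp: F_gens_def)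
  ultimately have "gen ` Gens \<subseteq> ?D" by auto
  then have gen_D: "generate G (gen ` Gens) \<subseteq> ?D" by (rule generate_subgroup_incl[OF _ D.subgroup_axioms])
  have "carrier G \<subseteq> T closure_of ?D"
  proof
    fix x assume x: "x \<in> carrier G"
    have "\<exists>y\<in>?D. y \<in> V" if "x \<in> V" "openin T V" for V
      using dense_generate[OF that(2)] that(1) gen_D by blast
    then show "x \<in> T closure_of ?D" using x topspace_eq by (auto simp: in_closure_of)
  qed
  then show ?thesis
    using closure_of_subset_topspace[of T ?D] topspace_eq by (auto simp: perfect_def)
qed

text \<open>The long relation makes one generator the inverse of the other, so a finite cyclic
  subgroup is dense. It is closed and hence everything, and the trivial subgroup serves as
  \<open>N\<close>. This covers the case in which no third period is available.\<close>

lemma two_periods: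
  assumes gr: "g = 0" "r = 0" and len: "length ns = 2"
  shows "\<exists>N. torsion_free_open_characteristic N G T \<and> N \<lhd> G \<and> openin T N \<and> (derived G ^^ 1) (carrier G) \<subseteq> N"
proof -
  let ?x = "gen (Delta 0)"
  define n where "n = ns ! 0"
  have x: "?x \<in> carrier G" by (rule gen_closed[OF Delta_Gens]) (simp add: len)
  have y: "gen (Delta 1) \<in> carrier G" by (rule gen_closed[OF Delta_Gens]) (simp add: len)
  have xn: "?x [^] n = \<one>" and n: "n > 0"
    using relation_Delta[of 0] period_pos[of 0] len by (simp_all add: n_def)
  have "?x \<otimes> gen (Delta 1) = \<one>"
    using relation_blocks gr len x y
    by (simp add: blocks_product_def relator_blocks_def block_value_def upt_rec numeral_2_eq_2)
  then have y_eq: "gen (Delta 1) = inv ?x" using x y inv_equality inv_comm by metis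
  let ?Z = "(\<lambda>i. ?x [^] (i::nat)) ` {..<n}"
  have pow: "?x [^] (i::nat) \<in> ?Z" for i
  proof -
    have "?x [^] i = ?x [^] (n * (i div n) + i mod n)" by simp
    also have "\<dots> = (?x [^] n) [^] (i div n) \<otimes> ?x [^] (i mod n)"
      using x by (simp only: nat_pow_mult nat_pow_pow nat_pow_closed)
    also have "\<dots> = ?x [^] (i mod n)" using x by (simp add: xn)
    finally show ?thesis using n by (intro image_eqI[of _ _ "i mod n"]) simp_all
  qed
  have inv_pow: "inv (?x [^] (i::nat)) \<in> ?Z" for i
  proof -
    have "i * (n - 1) + i = n * i" using n by (cases n) simp_all
    then have "?x [^] (i * (n - 1)) \<otimes> ?x [^] i = (?x [^] n) [^] i"
      using x by (simp only: nat_pow_mult nat_pow_pow)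
    then have "inv (?x [^] i) = ?x [^] (i * (n - 1))" using x xn by (simp add: inv_equality)
    then show ?thesis using pow by simp
  qed
  have Z: "subgroup ?Z G"
  proof (rule subgroupI)
    show "?Z \<subseteq> carrier G" using x by auto
    show "?Z \<noteq> {}" using n by auto
    fix a assume "a \<in> ?Z"
    then obtain i :: nat where a: "a = ?x [^] i" by blast
    then show "inv a \<in> ?Z" using inv_pow by simp
    fix b assume "b \<in> ?Z"
    then obtain j :: nat where b: "b = ?x [^] j" by blast
    then show "a \<otimes> b \<in> ?Z" using pow[of "i + j"] x by (simp add: a nat_pow_mult)
  qed
  have "Gens = {Delta 0, Delta 1}" using gr len by (auto simp: F_gens_def lessThan_Suc numeral_2_eq_2)
  then have "gen ` Gens \<subseteq> ?Z" using pow[of 1] inv_pow[of 1] x y_eq by simp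
  then have gen_Z: "generate G (gen ` Gens) \<subseteq> ?Z" by (rule generate_subgroup_incl[OF _ Z])
  have closed: "closedin T A" if "finite A" "A \<subseteq> carrier G" for A
    using that Hausdorff topspace_eq by (intro closedin_Hausdorff_finite) simp_all
  have "openin T (carrier G - ?Z)"
    using closed[of ?Z] subgroup.subset[OF Z] topspace_eq openin_diff[OF openin_topspace[of T], of ?Z] by simp
  then have "carrier G - ?Z = {}" using dense_generate gen_Z by blast
  then have car: "carrier G = ?Z" using subgroup.subset[OF Z] by blast
  then have fin: "finite (carrier G)" by (metis finite_imageI finite_lessThan)
  have open1: "openin T {\<one>}"
  proof -
    have "openin T (topspace T - (carrier G - {\<one>}))"
      by (rule openin_diff[OF openin_topspace closed]) (use fin in auto)
    moreover have "topspace T - (carrier G - {\<one>}) = {\<one>}" using topspace_eq by auto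
    ultimately show ?thesis by simp
  qed
  have "derived_set G (carrier G) \<subseteq> {\<one>}"
  proof
    fix z assume "z \<in> derived_set G (carrier G)"
    then obtain a b where ab: "a \<in> carrier G" "b \<in> carrier G" "z = a \<otimes> b \<otimes> inv a \<otimes> inv b" by blast
    then obtain i j :: nat where "a = ?x [^] i" "b = ?x [^] j" using car by blast
    then have "a \<otimes> b = b \<otimes> a" using x by (simp add: nat_pow_mult add.commute)
    then have "z = b \<otimes> a \<otimes> inv a \<otimes> inv b" using ab(3) by simp
    then show "z \<in> {\<one>}" using ab(1,2) by (simp add: m_assoc)
  qed
  then have der: "derived G (carrier G) \<subseteq> {\<one>}"
    unfolding derived_def by (rule generate_subgroup_incl[OF _ triv_subgroup])
  have "\<theta> ` {\<one>} = {\<one>}" if "\<theta> \<in> top_iso G T G T" for \<theta>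
  proof -
    have "\<theta> \<in> hom G G" using that by (simp add: top_iso_def iso_def)
    then have "\<theta> \<one> = \<one>" using hom_one group_axioms by blast
    then show ?thesis by simp
  qed
  then have "torsion_free_open_characteristic {\<one>} G T"
    using open1 triv_subgroup
    by (auto simp: torsion_free_open_characteristic_def torsion_free_def characteristic_subgroup_def)
  then show ?thesis using one_is_normal open1 der by (intro exI[of _ "{\<one>}"]) simp
qed

end

theorem theorem1p3:
  fixes \<Delta> :: "('a, 'b) monoid_scheme" and T :: "'a topology"
    and g r :: nat and ns :: "nat list"
  assumes "profinite_F_group \<Delta> T g r ns"
    and "\<not> perfect \<Delta> T"
  shows "(\<exists>N. torsion_free_open_characteristic N \<Delta> T \<and>
            derived_length (\<Delta> Mod N) (quotient_topology \<Delta> T N) \<le> 3) \<and>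
         (r \<ge> 1 \<or> (r = 0 \<and> abelian_period_condition ns) \<longrightarrow>
           (\<exists>N. torsion_free_open_characteristic N \<Delta> T \<and> comm_group (\<Delta> Mod N)))"
proof -
  let ?X = "F_gens g r ns"
  let ?F = "free_profinite ?X" and ?S = "free_profinite_topology ?X"
  let ?R = "F_relators ?F (free_gen ?X) g r ns"
  have prof: "profinite_group \<Delta> T" and periods2: "\<forall>n\<in>set ns. n \<ge> 2"
    and pres: "has_profinite_presentation \<Delta> T ?X ?R"
    using assms(1) by (simp_all add: profinite_F_group_def Let_def)
  obtain \<phi> where \<phi>: "\<phi> \<in> top_iso (?F Mod closed_normal_closure ?F ?S ?R)
      (quotient_topology ?F ?S (closed_normal_closure ?F ?S ?R)) \<Delta> T"
    using pres unfolding has_profinite_presentation_def Let_def by blast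
  interpret \<Delta>: profinite_group \<Delta> T by (rule prof)
  have "?R \<subseteq> carrier ?F"
    by (rule group.F_relators_closed[OF group_free_profinite free_gen_closed])
  then have "profinite_presentation \<Delta> T ?X ?R \<phi>"
    using \<phi> by (intro profinite_presentation.intro profinite_presentation_axioms.intro prof)
  then interpret \<Delta>: F_group \<Delta> T g r ns \<phi>
    using periods2 by (intro F_group.intro F_group_axioms.intro \<Delta>.group_axioms) auto
  have conclusion: "\<exists>N. torsion_free_open_characteristic N \<Delta> T \<and>
      derived_length (\<Delta> Mod N) (quotient_topology \<Delta> T N) \<le> 3"
    if "torsion_free_open_characteristic N \<Delta> T" "N \<lhd> \<Delta>" "openin T N"
      "(derived \<Delta> ^^ d) (carrier \<Delta>) \<subseteq> N" "d \<le> 3" for N d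
  proof -
    have "derived_length (\<Delta> Mod N) (quotient_topology \<Delta> T N) \<le> enat d"
      by (rule \<Delta>.derived_length_quotient_le[OF that(2-4)])
    also have "\<dots> \<le> 3" using that(5) by (simp add: numeral_eq_enat)
    finally show ?thesis using that(1) by blast
  qed
  have abelian: "\<exists>N. torsion_free_open_characteristic N \<Delta> T \<and> N \<lhd> \<Delta> \<and> openin T N \<and>
      (derived \<Delta> ^^ 1) (carrier \<Delta>) \<subseteq> N"
    if "r \<ge> 1 \<or> (r = 0 \<and> abelian_period_condition ns)"
    by (rule \<Delta>.derived_open_normal_characteristic)
      (use that \<Delta>.survives_affine \<Delta>.survives_abelian_period in auto)
  have general: "\<exists>N d. torsion_free_open_characteristic N \<Delta> T \<and> N \<lhd> \<Delta> \<and> openin T N \<and>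
      (derived \<Delta> ^^ d) (carrier \<Delta>) \<subseteq> N \<and> d \<le> 3"
  proof (cases "r = 0")
    case False
    then obtain N where "torsion_free_open_characteristic N \<Delta> T \<and> N \<lhd> \<Delta> \<and> openin T N \<and>
        (derived \<Delta> ^^ 1) (carrier \<Delta>) \<subseteq> N" using abelian by auto
    then show ?thesis by (intro exI[of _ N] exI[of _ 1]) simp
  next
    case r: True
    show ?thesis
    proof (cases "g = 0")
      case False
      then have "\<exists>N. torsion_free_open_characteristic N \<Delta> T \<and> N \<lhd> \<Delta> \<and> openin T N \<and>
          (derived \<Delta> ^^ 3) (carrier \<Delta>) \<subseteq> N"
        by (intro \<Delta>.derived_open_normal_characteristic \<Delta>.survives_positive_genus) simp_all
      then show ?thesis by blast
    next
      case g: True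
      obtain a b where ab: "a < length ns" "b < length ns" "a \<noteq> b" "\<not> coprime (ns ! a) (ns ! b)"
        using \<Delta>.perfect_if_coprime_periods[OF g r] assms(2) by blast
      \<comment> \<open>The greatest common divisor serves as the degree of the cyclic cover; what
        enters below is that it exceeds 1 and divides both periods.\<close>
      define p where "p = gcd (ns ! a) (ns ! b)"
      have p: "p > 1" "p dvd ns ! a" "p dvd ns ! b"
        using ab(4) \<Delta>.period_pos[OF ab(1)] unfolding p_def coprime_iff_gcd_eq_1
        by (simp_all add: nat_neq_iff)
      \<comment> \<open>Two distinct indices already exclude fewer than two periods.\<close>
      consider "length ns = 2" | "length ns \<ge> 3" using ab(1-3) by linarith
      then show ?thesis
      proof cases
        case 1
        then show ?thesis using \<Delta>.two_periods[OF g r] by (meson one_le_numeral)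
      next
        case 2
        have "\<exists>N. torsion_free_open_characteristic N \<Delta> T \<and> N \<lhd> \<Delta> \<and> openin T N \<and>
            (derived \<Delta> ^^ 3) (carrier \<Delta>) \<subseteq> N"
          by (rule \<Delta>.derived_open_normal_characteristic) (rule \<Delta>.survives_common_prime[OF r periods2 ab(1-3) p _ 2])
        then show ?thesis by blast
      qed
    qed
  qed
  show ?thesis
  proof (intro conjI impI)
    show "\<exists>N. torsion_free_open_characteristic N \<Delta> T \<and>
        derived_length (\<Delta> Mod N) (quotient_topology \<Delta> T N) \<le> 3"
      using general conclusion by blast
    assume "r \<ge> 1 \<or> (r = 0 \<and> abelian_period_condition ns)"
    then obtain N where "torsion_free_open_characteristic N \<Delta> T" "N \<lhd> \<Delta>" "(derived \<Delta> ^^ 1) (carrier \<Delta>) \<subseteq> N"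
      using abelian by blast
    then show "\<exists>N. torsion_free_open_characteristic N \<Delta> T \<and> comm_group (\<Delta> Mod N)"
      using \<Delta>.comm_group_quotient[of N] by auto
  qed
qed

end
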